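(* For every complex number $t$, the following identity of formal power series in $x$ holds: \[ \prod_{k \geq 1}(1-x^k)^{2t^2+t} \;=\; \sum_{\lambda \in DD}\delta_\lambda\, x^{|\lambda|/2} \prod_{h \in \mathcal{H}(\lambda)} \left( 1- \frac{2t+2}{h\, \varepsilon_h }\right), \] where the sum ranges over all doubled distinct partitions $\lambda$ (including the empty one).
   Context: A partition $\lambda=(\lambda_1\ge\lambda_2\ge\dots\ge\lambda_\ell>0)$ has weight $|\lambda|=\sum_i\lambda_i$; its diagram is the set of boxes $(i,j)$ with $1\le i\le \ell$, $1\le j\le\lambda_i$, and $\lambda'$ denotes the conjugate partition. The hook length of the box $(i,j)$ is $h(i,j)=\lambda_i-j+\lambda'_j-i+1$, and $\mathcal{H}(\lambda)$ is the multiset of hook lengths of all boxes of $\lambda$. For $h\in\mathcal{H}(\lambda)$ coming from the box $(i,j)$, set $\varepsilon_h=-1$ if $j<i$ (the box lies strictly on the side of the diagonal containing the boxes $(i,1)$, $i\ge2$) and $\varepsilon_h=1$ otherwise. The Durfee length $D(\lambda)$ is the number of $i$ with $\lambda_i\ge i$, and $\delta_\lambda=(-1)^{D(\lambda)}$. A doubled distinct partition is either the empty partition or, for integers $a_1>a_2>\dots>a_d\ge1$, the partition $\lambda$ with $D(\lambda)=d$, $\lambda_i-i=a_i$ and $\lambda'_i-i=a_i-1$ for $1\le i\le d$ (Frobenius coordinates $(a_1,\dots,a_d\mid a_1-1,\dots,a_d-1)$); its weight is even. $DD$ is the set of doubled distinct partitions. For complex $t$, the left side means $\exp\!\big(-(2t^2+t)\sum_{k\ge1}\frac{x^k}{k(1-x^k)}\big)$.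 *)

theory Defs
  imports
    "HOL-Analysis.Analysis"
    "HOL-Computational_Algebra.Formal_Power_Series"
begin

definition is_partition :: "nat list \<Rightarrow> bool" where
  "is_partition l \<longleftrightarrow> sorted_wrt (\<ge>) l \<and> (\<forall>p\<in>set l. p > 0)"

text \<open>Parts are numbered from 1, and parts beyond the length are 0.\<close>

definition part :: "nat list \<Rightarrow> nat \<Rightarrow> nat" where
  "part l i = (if 1 \<le> i \<and> i \<le> length l then l ! (i - 1) else 0)"

definition weight :: "nat list \<Rightarrow> nat" where
  "weight l = sum_list l"

definition diagram :: "nat list \<Rightarrow> (nat \<times> nat) set" where
  "diagram l = {(i, j). 1 \<le> i \<and> i \<le> length l \<and> 1 \<le> j \<and> j \<le> part l i}"

definition conjugate :: "nat list \<Rightarrow> nat list" where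
  "conjugate l = map (\<lambda>j. card {i. (i, j) \<in> diagram l}) [1..<Suc (part l 1)]"

text \<open>For a box of the diagram both truncated differences are genuine ones.\<close>

definition hook :: "nat list \<Rightarrow> nat \<Rightarrow> nat \<Rightarrow> nat" where
  "hook l i j = (part l i - j) + (part (conjugate l) j - i) + 1"

definition hook_sign :: "nat \<Rightarrow> nat \<Rightarrow> int" where
  "hook_sign i j = (if j < i then -1 else 1)"

definition durfee :: "nat list \<Rightarrow> nat" where
  "durfee l = card {i. 1 \<le> i \<and> i \<le> part l i}"

definition durfee_sign :: "nat list \<Rightarrow> int" where
  "durfee_sign l = (-1) ^ durfee l"

definition DD :: "nat list set" where
  "DD = {l. is_partition l \<and> (l = [] \<or>
     (\<exists>(d::nat) (a :: nat \<Rightarrow> nat). d \<ge> 1 \<and> strict_antimono_on {1..d} a \<and> a d \<ge> 1 \<and>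
        durfee l = d \<and>
        (\<forall>i\<in>{1..d}. int (part l i) - int i = int (a i) \<and>
                     int (part (conjugate l) i) - int i = int (a i) - 1)))}"

text \<open>
  The formal power series $\prod_{k\ge 1} (1-x^k)^c$ for complex $c$, read as
  $\exp(-c \sum_{k\ge 1} x^k/(k(1-x^k)))$. The inner series converges in the
  $x$-adic topology (the library's topology on power series), as shown below;
  its constant term is 0, so that the composition with the exponential is meaningful.
\<close>

definition log_term :: "nat \<Rightarrow> complex fps" where
  "log_term k = fps_X ^ k / (of_nat k * (1 - fps_X ^ k))"

definition euler_product_power :: "complex \<Rightarrow> complex fps" where
  "euler_product_power c =
     fps_exp 1 oo (fps_const (- c) * (\<Sum>k. log_term (Suc k)))"

lemma log_term_nth_0:
  assumes "k \<ge> 1" "n < k"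
  shows "fps_nth (log_term k) n = 0"
proof -
  let ?d = "of_nat k * (1 - fps_X ^ k) :: complex fps"
  have "fps_nth ?d 0 \<noteq> 0"
    using assms by (simp add: fps_mult_nth_0)
  then have "log_term k = fps_X ^ k * inverse ?d"
    by (simp add: log_term_def fps_divide_unit)
  then show ?thesis
    using assms by (simp add: fps_X_power_mult_nth)
qed

lemma sums_log_term:
  "(\<lambda>k. log_term (Suc k)) sums Abs_fps (\<lambda>n. \<Sum>k<n. fps_nth (log_term (Suc k)) n)"
  unfolding sums_def
proof (rule tendsto_fpsI)
  fix n
  have "fps_nth (\<Sum>k<m. log_term (Suc k)) n = (\<Sum>k<n. fps_nth (log_term (Suc k)) n)"
    if "m \<ge> n" for m
    unfolding fps_sum_nth
    by (rule sum.mono_neutral_right) (use that in \<open>auto simp: log_term_nth_0\<close>)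
  then show "\<forall>\<^sub>F m in sequentially. fps_nth (\<Sum>k<m. log_term (Suc k)) n =
      fps_nth (Abs_fps (\<lambda>n. \<Sum>k<n. fps_nth (log_term (Suc k)) n)) n"
    by (auto simp: eventually_sequentially)
qed

lemma summable_log_term: "summable (\<lambda>k. log_term (Suc k))"
  using sums_log_term by (rule sums_summable)

lemma suminf_log_term_nth_0: "fps_nth (\<Sum>k. log_term (Suc k)) 0 = 0"
  using sums_unique[OF sums_log_term] by (simp flip: sums_unique[OF sums_log_term])

end

theory Submission
  imports Defs "Jordan_Normal_Form.Determinant"
begin

text \<open>
  Both coefficients of \<open>x^N\<close> are polynomials in \<open>t\<close>, so it suffices to treat integers \<open>t = n \<ge> N\<close>.
  For these the hook products are the quotients of type \<open>C\<close> Vandermonde products that arise from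
  \<open>1, \<dots>, n\<close> by moving \<open>n + 1 - a\<close> to \<open>n + 1 + a\<close> for the parts \<open>a\<close> of a strict partition of \<open>N\<close>.
  Hence the right side is, modulo \<open>x^(n + 1)\<close>, the determinant \<open>F(g)\<close> of the map that multiplies
  series invariant under \<open>w \<mapsto> 1 / w\<close> by \<open>g / w\<close> and reduces modulo series invariant under
  \<open>w \<mapsto> x / w\<close>, for \<open>g = (1 - w)^(-2 n)\<close>.

  Write \<open>1 / (1 - w) = E / \<theta>\<close>, with \<open>\<theta>\<close> a theta series invariant under \<open>w \<mapsto> x / w\<close> and \<open>E\<close>
  invariant under \<open>w \<mapsto> 1 / w\<close>. Multiplication by \<open>1 / \<theta>\<close> and by \<open>E\<close> on the two sides turns
  the map of \<open>g\<close> into that of \<open>g / (1 - w)\<close>; the two multiplications commute with Toeplitz matrices up to rows of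
  increasing \<open>x\<close>-order, and the determinants of the resulting commutators are independent of \<open>g\<close>.
  So \<open>F(g / (1 - w)^2) F(g) / F(g / (1 - w))^2\<close> is constant, and \<open>F((1 - w)^(-z))\<close> is
  determined by its values at \<open>z = -2, -1, 0\<close>, where the matrix is triangular: it is the Euler
  product to the power \<open>z (z + 1) / 2\<close>.
\<close>

subsection \<open>Determinants of infinite matrices over formal power series\<close>

text \<open>Multiplication matrices have no determinant of their own; only matrices differing from
  \<open>1\<close> by one whose row i is divisible by x^(i + 1) do. The matrix of g is brought to
  this form by dividing by the upper triangular Toeplitz matrix of g, which for g(0) = 1 leaves
  truncated determinants unchanged. The passage from g to g / (1 - w) is then regrouped into factors
  of this form and conjugates of them. Beside the old determinant two factors appear: one compares E
  / theta with 1 / (1 - w), is the same for every g and cancels in the second quotient; the other is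
  the determinant of the group commutator of the Toeplitz matrix of g with multiplication by theta,
  and it gains a fixed factor when g gains 1 / (1 - w). Hence the exponent is quadratic in z, and at
  z = 2 n it is 2 n^2 + n, the source of 2 t^2 + t. The weight x^a comes from the reflection w -> x
  / w: row a - 1 is an unmoved row minus x^a times a moved one, so expanding over subsets of rows
  lists the strict partitions with parts at most n.\<close>

definition fps_cong :: "nat \<Rightarrow> 'a::zero fps \<Rightarrow> 'a fps \<Rightarrow> bool" where
  "fps_cong n f g \<longleftrightarrow> (\<forall>m\<le>n. fps_nth f m = fps_nth g m)"

lemma fps_cong_refl [simp]: "fps_cong n f f"
  by (simp add: fps_cong_def)

lemma fps_cong_sym: "fps_cong n f g \<Longrightarrow> fps_cong n g f"
  by (simp add: fps_cong_def)

lemma fps_cong_trans [trans]: "fps_cong n f g \<Longrightarrow> fps_cong n g h \<Longrightarrow> fps_cong n f h"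
  by (simp add: fps_cong_def)

lemma fps_eqI_cong: "(\<And>n. fps_cong n f g) \<Longrightarrow> f = g"
  by (auto simp: fps_cong_def fps_eq_iff)

lemma fps_cong_add:
  fixes f g :: "'a::ab_group_add fps"
  shows "fps_cong n f f' \<Longrightarrow> fps_cong n g g' \<Longrightarrow> fps_cong n (f + g) (f' + g')"
  by (simp add: fps_cong_def)

lemma fps_cong_diff:
  fixes f g :: "'a::ab_group_add fps"
  shows "fps_cong n f f' \<Longrightarrow> fps_cong n g g' \<Longrightarrow> fps_cong n (f - g) (f' - g')"
  by (simp add: fps_cong_def)

lemma fps_cong_mult:
  fixes f g :: "'a::comm_ring_1 fps"
  shows "fps_cong n f f' \<Longrightarrow> fps_cong n g g' \<Longrightarrow> fps_cong n (f * g) (f' * g')"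
  by (simp add: fps_cong_def fps_mult_nth)

lemma fps_cong_sum:
  fixes f g :: "'b \<Rightarrow> 'a::ab_group_add fps"
  shows "(\<And>x. x \<in> A \<Longrightarrow> fps_cong n (f x) (g x)) \<Longrightarrow> fps_cong n (sum f A) (sum g A)"
  by (simp add: fps_cong_def fps_sum_nth)

lemma fps_cong_prod:
  fixes f g :: "'b \<Rightarrow> 'a::comm_ring_1 fps"
  shows "(\<And>x. x \<in> A \<Longrightarrow> fps_cong n (f x) (g x)) \<Longrightarrow> fps_cong n (prod f A) (prod g A)"
  by (induction A rule: infinite_finite_induct) (auto intro: fps_cong_mult)

text \<open>The entry \<open>(i, j)\<close> is divisible by \<open>x\<close> to the power \<open>i - j\<close>, so that all sums in a
  matrix product converge \<open>x\<close>-adically.\<close>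

typedef bmat = "{B :: nat \<Rightarrow> nat \<Rightarrow> complex fps. \<forall>i j b. b + j < i \<longrightarrow> fps_nth (B i j) b = 0}"
  morphisms ent Bmat
  by (rule exI[of _ "\<lambda>_ _. 0"]) simp

lemma ent_nth_0: "b + j < i \<Longrightarrow> fps_nth (ent B i j) b = 0"
  using ent[of B] by blast

lemma bmat_eqI: "(\<And>i j. ent A i j = ent B i j) \<Longrightarrow> A = B"
  by (metis ent_inverse ext)

lemma ent_Bmat: "(\<And>i j b. b + j < i \<Longrightarrow> fps_nth (B i j) b = 0) \<Longrightarrow> ent (Bmat B) = B"
  by (rule Bmat_inverse) blast

instantiation bmat :: "{zero, one, plus, minus, uminus, times}"
begin

definition "0 = Bmat (\<lambda>_ _. 0)"
definition "1 = Bmat (\<lambda>i j. if i = j then 1 else 0)"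
definition "A + B = Bmat (\<lambda>i j. ent A i j + ent B i j)"
definition "A - B = Bmat (\<lambda>i j. ent A i j - ent B i j)"
definition "- A = Bmat (\<lambda>i j. - ent A i j)"
definition "A * B = Bmat (\<lambda>i j. Abs_fps (\<lambda>m. \<Sum>k\<le>j + m. fps_nth (ent A i k * ent B k j) m))"

instance ..

end

lemma ent_zero: "ent 0 i j = 0"
  unfolding zero_bmat_def by (subst ent_Bmat) auto

lemma ent_one: "ent 1 i j = (if i = j then 1 else 0)"
  unfolding one_bmat_def by (subst ent_Bmat) auto

lemma ent_add: "ent (A + B) i j = ent A i j + ent B i j"
  unfolding plus_bmat_def by (subst ent_Bmat) (auto simp: ent_nth_0)

lemma ent_diff: "ent (A - B) i j = ent A i j - ent B i j"
  unfolding minus_bmat_def by (subst ent_Bmat) (auto simp: ent_nth_0)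

lemma ent_uminus: "ent (- A) i j = - ent A i j"
  unfolding uminus_bmat_def by (subst ent_Bmat) (auto simp: ent_nth_0)

lemma fps_mult_nth_0_if:
  fixes f g :: "'a::comm_ring_1 fps"
  assumes "\<And>b. b < k \<Longrightarrow> fps_nth f b = 0" "\<And>b. b < l \<Longrightarrow> fps_nth g b = 0" "m < k + l"
  shows "fps_nth (f * g) m = 0"
proof -
  have "fps_nth f b * fps_nth g (m - b) = 0" if "b \<le> m" for b
  proof (cases "b < k")
    case False
    then have "m - b < l" using assms(3) that by linarith
    then show ?thesis using assms(2) by simp
  qed (use assms(1) in simp)
  then show ?thesis
    by (simp add: fps_mult_nth)
qed

text \<open>With truncated subtraction \<open>k + (i - k)\<close> is the maximum of \<open>i\<close>
  and \<open>k\<close>. The orders i - k and k - j of the two factors add up to at least this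
  maximum minus \<open>j\<close>, which bounds the inner index of a product by j + m.\<close>

lemma ent_mult_nth_0:
  assumes "m + j < k + (i - k)"
  shows "fps_nth (ent A i k * ent B k j) m = 0"
  by (rule fps_mult_nth_0_if[where k = "i - k" and l = "k - j"])
     (use assms in \<open>auto intro!: ent_nth_0\<close>)

lemma ent_mult: "ent (A * B) i j = Abs_fps (\<lambda>m. \<Sum>k\<le>j + m. fps_nth (ent A i k * ent B k j) m)"
  unfolding times_bmat_def
  by (subst ent_Bmat) (auto intro!: sum.neutral ent_mult_nth_0)

lemma ent_mult_cong:
  assumes "j + b < L"
  shows "fps_cong b (ent (A * B) i j) (\<Sum>k<L. ent A i k * ent B k j)"
  unfolding fps_cong_def
proof (intro allI impI)
  fix m assume "m \<le> b"
  have "(\<Sum>k\<le>j + m. fps_nth (ent A i k * ent B k j) m) = (\<Sum>k<L. fps_nth (ent A i k * ent B k j) m)"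
    by (rule sum.mono_neutral_left)
       (use assms \<open>m \<le> b\<close> in \<open>auto intro!: ent_mult_nth_0\<close>)
  then show "fps_nth (ent (A * B) i j) m = fps_nth (\<Sum>k<L. ent A i k * ent B k j) m"
    by (simp add: ent_mult fps_sum_nth)
qed

lemma bmat_eqI_cong: "(\<And>i j b. fps_cong b (ent A i j) (ent B i j)) \<Longrightarrow> A = B"
  by (intro bmat_eqI fps_eqI_cong)

lemma bmat_mult_assoc: "(A * B) * C = A * (B * C)" for A B C :: bmat
proof (rule bmat_eqI_cong)
  fix i j b
  \<comment> \<open>\<open>K\<close> bounds the inner index next to column \<open>j\<close>;
    \<open>L\<close> then bounds the other inner index uniformly for all columns
    \<open>k < K\<close>.\<close>
  define K where "K = Suc (j + b)"
  define L where "L = K + b"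
  have "fps_cong b (ent (A * B * C) i j) (\<Sum>k<K. ent (A * B) i k * ent C k j)"
    by (rule ent_mult_cong) (simp add: K_def)
  also have "fps_cong b \<dots> (\<Sum>k<K. (\<Sum>l<L. ent A i l * ent B l k) * ent C k j)"
    by (intro fps_cong_sum fps_cong_mult ent_mult_cong) (auto simp: L_def)
  also have "\<dots> = (\<Sum>l<L. ent A i l * (\<Sum>k<K. ent B l k * ent C k j))"
    by (simp add: sum_distrib_left sum_distrib_right mult.assoc) (rule sum.swap)
  also have "fps_cong b \<dots> (\<Sum>l<L. ent A i l * ent (B * C) l j)"
    by (intro fps_cong_sum fps_cong_mult fps_cong_sym[OF ent_mult_cong]) (auto simp: K_def)
  also have "fps_cong b \<dots> (ent (A * (B * C)) i j)"
    by (rule fps_cong_sym[OF ent_mult_cong]) (simp add: K_def L_def)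
  finally show "fps_cong b (ent (A * B * C) i j) (ent (A * (B * C)) i j)" .
qed

instance bmat :: ring_1
proof
  fix A B C :: bmat
  show "A * B * C = A * (B * C)" by (rule bmat_mult_assoc)
  show "1 * A = A"
    by (rule bmat_eqI) (auto simp: ent_mult ent_one fps_eq_iff if_distrib[of "\<lambda>x. x * _"] if_distrib[of "\<lambda>x. fps_nth x _"] ent_nth_0 cong: if_cong)
  show "A * 1 = A"
    by (rule bmat_eqI) (auto simp: ent_mult ent_one fps_eq_iff if_distrib[of "\<lambda>x. _ * x"] if_distrib[of "\<lambda>x. fps_nth x _"] cong: if_cong)
  show "(A + B) * C = A * C + B * C" "A * (B + C) = A * B + A * C"
    by (rule bmat_eqI; simp add: ent_mult ent_add fps_eq_iff algebra_simps sum.distrib)+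
  show "(0::bmat) \<noteq> 1"
    by (metis ent_one ent_zero zero_neq_one)
qed (rule bmat_eqI; simp add: ent_add ent_zero ent_diff ent_uminus)+

section \<open>The ideal of matrices whose row i is divisible by x^(i + 1)\<close>

definition small :: "bmat \<Rightarrow> bool" where
  "small A \<longleftrightarrow> (\<forall>i j b. b \<le> i \<longrightarrow> fps_nth (ent A i j) b = 0)"

lemma small_add: "small A \<Longrightarrow> small B \<Longrightarrow> small (A + B)"
  by (simp add: small_def ent_add)

lemma small_diff: "small A \<Longrightarrow> small B \<Longrightarrow> small (A - B)"
  by (simp add: small_def ent_diff)

lemma small_mult_right: "small A \<Longrightarrow> small (A * B)"
  unfolding small_def ent_mult
proof (intro allI impI)
  fix i j b :: nat
  assume A: "\<forall>i j b. b \<le> i \<longrightarrow> fps_nth (ent A i j) b = 0" and "b \<le> i"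
  have "fps_nth (ent A i k * ent B k j) b = 0" for k
    by (rule fps_mult_nth_0_if[where k = "Suc i" and l = 0]) (use A \<open>b \<le> i\<close> in auto)
  then show "fps_nth (Abs_fps (\<lambda>m. \<Sum>k\<le>j + m. fps_nth (ent A i k * ent B k j) m)) b = 0"
    by simp
qed

text \<open>Row i of \<open>A\<close> has order at least i - k in column k, and row k of
  \<open>B\<close> has order at least k + 1; together this is at least i + 1. With
  \<open>small_mult_right\<close> the small matrices form a two-sided ideal.\<close>

lemma small_mult_left: "small B \<Longrightarrow> small (A * B)"
  unfolding small_def ent_mult
proof (intro allI impI)
  fix i j b :: nat
  assume B: "\<forall>i j b. b \<le> i \<longrightarrow> fps_nth (ent B i j) b = 0" and "b \<le> i"
  have "fps_nth (ent A i k * ent B k j) b = 0" for k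
    by (rule fps_mult_nth_0_if[where k = "i - k" and l = "Suc k"])
       (use B \<open>b \<le> i\<close> in \<open>auto intro!: ent_nth_0\<close>)
  then show "fps_nth (Abs_fps (\<lambda>m. \<Sum>k\<le>j + m. fps_nth (ent A i k * ent B k j) m)) b = 0"
    by simp
qed

lemma small_mult_minus_one:
  assumes "small (A - 1)" "small (B - 1)"
  shows "small (A * B - 1)"
proof -
  have eq: "A * B - 1 = (A - 1) * B + (B - 1)"
    by (simp add: algebra_simps)
  show ?thesis
    unfolding eq by (intro small_add small_mult_right assms)
qed

lemma small_conj_minus_one:
  assumes "small (A - 1)" "G * G' = 1"
  shows "small (G * A * G' - 1)"
proof -
  have eq: "G * A * G' - 1 = G * (A - 1) * G'"
    using assms(2) by (simp add: algebra_simps)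
  show ?thesis
    unfolding eq by (intro small_mult_right small_mult_left assms)
qed

section \<open>Determinants of finite truncations\<close>

definition trunc_det :: "nat \<Rightarrow> (nat \<Rightarrow> nat \<Rightarrow> 'a::comm_ring_1) \<Rightarrow> 'a" where
  "trunc_det n A = Determinant.det (mat n n (\<lambda>(i, j). A i j))"

lemma trunc_det_altdef:
  "trunc_det n A = (\<Sum>p | p permutes {0..<n}. signof p * (\<Prod>i = 0..<n. A i (p i)))"
  unfolding trunc_det_def
  by (subst det_def'[of _ n]) (auto intro!: sum.cong prod.cong simp: permutes_in_image)

lemma trunc_det_cong:
  assumes "\<And>i j. i < n \<Longrightarrow> j < n \<Longrightarrow> A i j = B i j"
  shows "trunc_det n A = trunc_det n B"
  unfolding trunc_det_def by (rule arg_cong[of _ _ Determinant.det]) (auto simp: assms)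

lemma trunc_det_fps_cong:
  fixes A B :: "nat \<Rightarrow> nat \<Rightarrow> 'a::comm_ring_1 fps"
  assumes "\<And>i j. i < n \<Longrightarrow> j < n \<Longrightarrow> fps_cong b (A i j) (B i j)"
  shows "fps_cong b (trunc_det n A) (trunc_det n B)"
  unfolding trunc_det_altdef
  by (intro fps_cong_sum fps_cong_mult fps_cong_prod assms) (auto simp: permutes_in_image)

lemma trunc_det_mult:
  fixes A B :: "nat \<Rightarrow> nat \<Rightarrow> 'a::comm_ring_1"
  shows "trunc_det n (\<lambda>i j. \<Sum>k<n. A i k * B k j) = trunc_det n A * trunc_det n B"
proof -
  have "mat n n (\<lambda>(i, j). \<Sum>k<n. A i k * B k j) = mat n n (\<lambda>(i, j). A i j) * mat n n (\<lambda>(i, j). B i j)"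
    by (rule eq_matI) (auto simp: scalar_prod_def lessThan_atLeast0)
  then show ?thesis
    unfolding trunc_det_def by (simp add: det_mult[of _ n])
qed

lemma trunc_det_upper:
  fixes A :: "nat \<Rightarrow> nat \<Rightarrow> 'a::comm_ring_1"
  assumes "\<And>i j. j < i \<Longrightarrow> i < n \<Longrightarrow> A i j = 0"
  shows "trunc_det n A = (\<Prod>i<n. A i i)"
proof -
  have "trunc_det n A = prod_list (diag_mat (mat n n (\<lambda>(i, j). A i j)))"
    unfolding trunc_det_def by (rule det_upper_triangular) (auto simp: assms)
  also have "diag_mat (mat n n (\<lambda>(i, j). A i j)) = map (\<lambda>i. A i i) [0..<n]"
    by (auto simp: diag_mat_def)
  finally show ?thesis
    by (simp add: interv_sum_list_conv_sum_set_nat prod.distinct_set_conv_list[symmetric] lessThan_atLeast0)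
qed

lemma trunc_det_identity_rows:
  fixes A :: "nat \<Rightarrow> nat \<Rightarrow> 'a::idom"
  assumes "m \<le> n" "\<And>i j. m \<le> i \<Longrightarrow> i < n \<Longrightarrow> j < n \<Longrightarrow> A i j = (if i = j then 1 else 0)"
  shows "trunc_det n A = trunc_det m A"
proof -
  have "mat n n (\<lambda>(i, j). A i j) =
      four_block_mat (mat m m (\<lambda>(i, j). A i j)) (mat m (n - m) (\<lambda>(i, j). A i (j + m)))
        (0\<^sub>m (n - m) m) (1\<^sub>m (n - m))"
    using assms by (intro eq_matI) auto
  then show ?thesis
    unfolding trunc_det_def
    by (simp add: det_four_block_mat_lower_left_zero[of _ m _ "n - m"])
qed

text \<open>Sylvester's identity. Both sides are the determinant of the block matrix
  \<open>M\<close>: multiplying by \<open>L\<close> clears its lower left block, multiplying by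
  \<open>R\<close> its upper right one.\<close>

lemma det_one_plus_mult_commute:
  fixes A B :: "'a::idom mat"
  assumes A: "A \<in> carrier_mat n n" and B: "B \<in> carrier_mat n n"
  shows "Determinant.det (1\<^sub>m n + A * B) = Determinant.det (1\<^sub>m n + B * A)"
proof -
  define M where "M = four_block_mat (1\<^sub>m n) A (- B) (1\<^sub>m n)"
  have M: "M \<in> carrier_mat (n + n) (n + n)"
    unfolding M_def using A B by (intro four_block_carrier_mat) auto
  define L where "L = four_block_mat (1\<^sub>m n) (0\<^sub>m n n) B (1\<^sub>m n)"
  define R where "R = four_block_mat (1\<^sub>m n) (- A) (0\<^sub>m n n) (1\<^sub>m n)"
  have L: "L \<in> carrier_mat (n + n) (n + n)" and R: "R \<in> carrier_mat (n + n) (n + n)"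
    unfolding L_def R_def using A B by auto
  have detL: "Determinant.det L = 1" and detR: "Determinant.det R = 1"
    unfolding L_def R_def using A B
    by (simp_all add: det_four_block_mat_upper_right_zero[of _ n _ n]
        det_four_block_mat_lower_left_zero[of _ n _ n])
  have "L * M = four_block_mat (1\<^sub>m n) A (0\<^sub>m n n) (B * A + 1\<^sub>m n)"
    unfolding L_def M_def using A B
    by (subst mult_four_block_mat[where ?nr1.0 = n and ?n1.0 = n and ?n2.0 = n and ?nr2.0 = n and ?nc1.0 = n and ?nc2.0 = n]) auto
  then have "Determinant.det (L * M) = Determinant.det (B * A + 1\<^sub>m n)"
    using A B by (simp add: det_four_block_mat_lower_left_zero[of _ n _ n])
  moreover have "R * M = four_block_mat (1\<^sub>m n + A * B) (0\<^sub>m n n) (- B) (1\<^sub>m n)"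
    unfolding R_def M_def using A B
    by (subst mult_four_block_mat[where ?nr1.0 = n and ?n1.0 = n and ?n2.0 = n and ?nr2.0 = n and ?nc1.0 = n and ?nc2.0 = n]) auto
  then have "Determinant.det (R * M) = Determinant.det (1\<^sub>m n + A * B)"
    using A B by (simp add: det_four_block_mat_upper_right_zero[of _ n _ n])
  ultimately show ?thesis
    using det_mult[OF L M] det_mult[OF R M] detL detR A B
    by (simp add: comm_add_mat[of _ n n])
qed

lemma trunc_det_one_plus_mult_commute:
  fixes A B :: "nat \<Rightarrow> nat \<Rightarrow> 'a::idom"
  shows "trunc_det n (\<lambda>i j. (if i = j then 1 else 0) + (\<Sum>k<n. A i k * B k j)) =
    trunc_det n (\<lambda>i j. (if i = j then 1 else 0) + (\<Sum>k<n. B i k * A k j))"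
proof -
  have "mat n n (\<lambda>(i, j). (if i = j then 1 else 0) + (\<Sum>k<n. A i k * B k j)) =
      1\<^sub>m n + mat n n (\<lambda>(i, j). A i j) * mat n n (\<lambda>(i, j). B i j)" for A B :: "nat \<Rightarrow> nat \<Rightarrow> 'a"
    by (rule eq_matI) (auto simp: scalar_prod_def lessThan_atLeast0)
  then show ?thesis
    unfolding trunc_det_def by (simp add: det_one_plus_mult_commute[of _ n])
qed

section \<open>The infinite determinant of 1 plus a small matrix\<close>

definition idet :: "bmat \<Rightarrow> complex fps" where
  "idet A = Abs_fps (\<lambda>m. fps_nth (trunc_det m (ent A)) m)"

lemma small_minus_one_cong:
  assumes "small (A - 1)" "b \<le> i"
  shows "fps_cong b (ent A i j) (if i = j then 1 else 0)"
  unfolding fps_cong_def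
proof (intro allI impI)
  fix m assume "m \<le> b"
  then have "fps_nth (ent (A - 1) i j) m = 0"
    using assms by (simp add: small_def)
  then show "fps_nth (ent A i j) m = fps_nth (if i = j then 1 else 0) m"
    by (auto simp: ent_diff ent_one split: if_splits)
qed

lemma trunc_det_small_minus_one:
  fixes A :: "nat \<Rightarrow> nat \<Rightarrow> 'a::idom fps"
  assumes "\<And>i j. b \<le> i \<Longrightarrow> i < n \<Longrightarrow> j < n \<Longrightarrow> fps_cong b (A i j) (if i = j then 1 else 0)"
    and "b \<le> n"
  shows "fps_cong b (trunc_det n A) (trunc_det b A)"
proof -
  define A' where "A' = (\<lambda>i j. if b \<le> i then if i = j then 1 else 0 else A i j)"
  have "fps_cong b (trunc_det n A) (trunc_det n A')"
    by (rule trunc_det_fps_cong) (use assms(1) in \<open>auto simp: A'_def\<close>)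
  also have "trunc_det n A' = trunc_det b A'"
    by (rule trunc_det_identity_rows) (use assms(2) in \<open>auto simp: A'_def\<close>)
  also have "\<dots> = trunc_det b A"
    by (rule trunc_det_cong) (auto simp: A'_def)
  finally show ?thesis .
qed

text \<open>Up to order \<open>b\<close> the rows from \<open>b\<close> on are those of the
  identity, so all truncations of size at least \<open>b\<close> have the same determinant. This is
  why \<open>idet\<close> may read its coefficient \<open>m\<close> off the truncation of size
  \<open>m\<close>.\<close>

lemma idet_cong:
  assumes "small (A - 1)" "b \<le> n"
  shows "fps_cong b (idet A) (trunc_det n (ent A))"
  unfolding fps_cong_def
proof (intro allI impI)
  fix m assume "m \<le> b"
  have "fps_cong m (trunc_det n (ent A)) (trunc_det m (ent A))"
    by (rule trunc_det_small_minus_one)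
       (use assms(2) \<open>m \<le> b\<close> in \<open>simp_all del: if_split add: small_minus_one_cong[OF assms(1)]\<close>)
  then show "fps_nth (idet A) m = fps_nth (trunc_det n (ent A)) m"
    by (simp add: idet_def fps_cong_def)
qed

text \<open>Truncation could fail to be multiplicative only through inner indices
  \<open>k \<ge> n\<close>. There \<open>ent B k j\<close> with \<open>j < n\<close> is an
  off-diagonal entry of a row that agrees with the identity up to order \<open>b\<close>, so it
  vanishes to that order whatever \<open>A\<close> is.\<close>

lemma trunc_det_mult_small:
  assumes "small (B - 1)" "b \<le> n"
  shows "fps_cong b (trunc_det n (ent (A * B))) (trunc_det n (ent A) * trunc_det n (ent B))"
  unfolding trunc_det_mult[symmetric]
proof (rule trunc_det_fps_cong)
  fix i j assume ij: "i < n" "j < n"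
  define L where "L = n + Suc (j + b)"
  have "fps_cong b (ent (A * B) i j) (\<Sum>k<L. ent A i k * ent B k j)"
    by (rule ent_mult_cong) (simp add: L_def)
  also have "fps_cong b \<dots> (\<Sum>k<L. if k < n then ent A i k * ent B k j else 0)"
  proof (rule fps_cong_sum)
    fix k
    show "fps_cong b (ent A i k * ent B k j) (if k < n then ent A i k * ent B k j else 0)"
    proof (cases "k < n")
      case False
      then have "fps_cong b (ent B k j) 0"
        using small_minus_one_cong[OF assms(1), of b k j] ij assms(2) by auto
      then show ?thesis
        using False fps_cong_mult[OF fps_cong_refl, of b "ent B k j" 0] by auto
    qed auto
  qed
  also have "(\<Sum>k<L. if k < n then ent A i k * ent B k j else 0) = (\<Sum>k<n. ent A i k * ent B k j)"
    by (rule sum.mono_neutral_cong_right) (auto simp: L_def)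
  finally show "fps_cong b (ent (A * B) i j) (\<Sum>k<n. ent A i k * ent B k j)" .
qed

lemma idet_mult:
  assumes "small (A - 1)" "small (B - 1)"
  shows "idet (A * B) = idet A * idet B"
proof (rule fps_eqI_cong)
  fix b
  have "fps_cong b (idet (A * B)) (trunc_det b (ent (A * B)))"
    by (intro idet_cong small_mult_minus_one assms) auto
  also have "fps_cong b \<dots> (trunc_det b (ent A) * trunc_det b (ent B))"
    by (rule trunc_det_mult_small) (use assms in auto)
  also have "fps_cong b \<dots> (idet A * idet B)"
    by (intro fps_cong_mult fps_cong_sym[OF idet_cong] assms) auto
  finally show "fps_cong b (idet (A * B)) (idet A * idet B)" .
qed

lemma trunc_det_mult_upper:
  assumes "\<And>i j. j < i \<Longrightarrow> ent B i j = 0"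
  shows "trunc_det n (ent (A * B)) = trunc_det n (ent A) * trunc_det n (ent B)"
  unfolding trunc_det_mult[symmetric]
proof (rule trunc_det_cong, rule fps_eqI_cong)
  fix i j b assume "i < n" "j < n"
  have "fps_cong b (ent (A * B) i j) (\<Sum>k<n + Suc (j + b). ent A i k * ent B k j)"
    by (rule ent_mult_cong) auto
  also have "(\<Sum>k<n + Suc (j + b). ent A i k * ent B k j) = (\<Sum>k<n. ent A i k * ent B k j)"
    by (rule sum.mono_neutral_right) (use assms \<open>j < n\<close> in auto)
  finally show "fps_cong b (ent (A * B) i j) (\<Sum>k<n. ent A i k * ent B k j)" .
qed

text \<open>Smallness is asked of \<open>B\<close> alone. This gives conjugation invariance for
  conjugating matrices that have no determinant themselves, such as
  \<open>odd_mat theta\<close>.\<close>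

lemma idet_one_plus_mult_commute:
  assumes "small B"
  shows "idet (1 + A * B) = idet (1 + B * A)"
proof (rule fps_eqI_cong)
  fix b :: nat
  \<comment> \<open>In \<open>A * B\<close> the inner index could be cut at \<open>b\<close>. In
    \<open>B * A\<close> the entry \<open>ent A k j\<close> contributes only the order k - j, and
    for \<open>j < b\<close> this exceeds \<open>b\<close> once
    \<open>k \<ge> 2 * b\<close>.\<close>
  define n where "n = 2 * b"
  have B: "fps_nth (ent B i j) m = 0" if "m \<le> i" for i j m
    using assms that by (simp add: small_def)
  have AB: "fps_nth (ent A i k * ent B k j) m = 0" if "m \<le> k" for i j k m
    by (rule fps_mult_nth_0_if[where k = 0 and l = "Suc k"]) (use that B in auto)
  have BA: "fps_nth (ent B i k * ent A k j) m = 0" if "m + j \<le> i + k \<or> m \<le> i" for i j k m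
    by (rule fps_mult_nth_0_if[where k = "Suc i" and l = "k - j"]) (use that B in \<open>auto intro!: ent_nth_0\<close>)
  have "fps_cong b (idet (1 + A * B)) (trunc_det n (ent (1 + A * B)))"
    by (rule idet_cong) (auto simp: n_def small_mult_left assms)
  also have "fps_cong b \<dots> (trunc_det n (\<lambda>i j. (if i = j then 1 else 0) + (\<Sum>k<n. ent A i k * ent B k j)))"
  proof (rule trunc_det_fps_cong)
    fix i j assume "i < n" "j < n"
    have "fps_cong b (ent (A * B) i j) (\<Sum>k<n + Suc (j + b). ent A i k * ent B k j)"
      by (rule ent_mult_cong) auto
    also have "fps_cong b \<dots> (\<Sum>k<n. ent A i k * ent B k j)"
      unfolding fps_cong_def fps_sum_nth
      by (intro allI impI sum.mono_neutral_right) (auto simp: n_def intro!: AB)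
    finally show "fps_cong b (ent (1 + A * B) i j) ((if i = j then 1 else 0) + (\<Sum>k<n. ent A i k * ent B k j))"
      unfolding ent_add ent_one by (intro fps_cong_add) auto
  qed
  also have "trunc_det n (\<lambda>i j. (if i = j then 1 else 0) + (\<Sum>k<n. ent A i k * ent B k j)) =
      trunc_det n (\<lambda>i j. (if i = j then 1 else 0) + (\<Sum>k<n. ent B i k * ent A k j))"
    by (rule trunc_det_one_plus_mult_commute)
  also have "fps_cong b \<dots> (trunc_det b (\<lambda>i j. (if i = j then 1 else 0) + (\<Sum>k<n. ent B i k * ent A k j)))"
  proof (rule trunc_det_small_minus_one)
    fix i j assume "b \<le> i"
    show "fps_cong b ((if i = j then 1 else 0) + (\<Sum>k<n. ent B i k * ent A k j)) (if i = j then 1 else 0)"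
      using \<open>b \<le> i\<close> by (auto simp: fps_cong_def fps_sum_nth intro!: sum.neutral BA)
  qed (auto simp: n_def)
  also have "fps_cong b \<dots> (trunc_det b (ent (1 + B * A)))"
  proof (rule trunc_det_fps_cong)
    fix i j assume ij: "i < b" "j < b"
    have "fps_cong b (ent (B * A) i j) (\<Sum>k<n + Suc (j + b). ent B i k * ent A k j)"
      by (rule ent_mult_cong) auto
    also have "fps_cong b \<dots> (\<Sum>k<n. ent B i k * ent A k j)"
      unfolding fps_cong_def fps_sum_nth
      by (intro allI impI sum.mono_neutral_right) (use ij in \<open>auto simp: n_def intro!: BA\<close>)
    finally show "fps_cong b ((if i = j then 1 else 0) + (\<Sum>k<n. ent B i k * ent A k j)) (ent (1 + B * A) i j)"
      unfolding ent_add ent_one by (intro fps_cong_add fps_cong_sym[of b "ent _ _ _"]) auto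
  qed
  also have "fps_cong b \<dots> (idet (1 + B * A))"
    by (rule fps_cong_sym, rule idet_cong) (auto simp: small_mult_right assms)
  finally show "fps_cong b (idet (1 + A * B)) (idet (1 + B * A))" .
qed

lemma idet_conj:
  assumes "small (A - 1)" "G * G' = 1" "G' * G = 1"
  shows "idet (G * A * G') = idet A"
proof -
  have "G * A * G' = 1 + G * ((A - 1) * G')"
    using assms(2) by (simp add: algebra_simps)
  also have "idet \<dots> = idet (1 + (A - 1) * G' * G)"
    by (rule idet_one_plus_mult_commute) (simp add: small_mult_right assms)
  also have "1 + (A - 1) * G' * G = A"
    using assms(3) by (simp add: mult.assoc)
  finally show ?thesis .
qed

subsection \<open>Symbols and their matrices\<close>

text \<open>A double power series \<open>F\<close> stands for the sum over \<open>b\<close> of \<open>(x / w)^b F_b(w)\<close>, so that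
  multiplication of symbols is multiplication in \<open>complex fps fps\<close>; \<open>wcoeff F m\<close> is the
  coefficient of \<open>w^m\<close>.\<close>

definition wcoeff :: "complex fps fps \<Rightarrow> int \<Rightarrow> complex fps" where
  "wcoeff F m = Abs_fps (\<lambda>b. if m + int b \<ge> 0 then fps_nth (fps_nth F b) (nat (m + int b)) else 0)"

lemma wcoeff_nth: "fps_nth (wcoeff F m) b = (if m + int b \<ge> 0 then fps_nth (fps_nth F b) (nat (m + int b)) else 0)"
  by (simp add: wcoeff_def)

lemma wcoeff_nth_0: "int b + m < 0 \<Longrightarrow> fps_nth (wcoeff F m) b = 0"
  by (simp add: wcoeff_nth)

lemma wcoeff_one: "wcoeff 1 m = (if m = 0 then 1 else 0)"
  by (auto simp: fps_eq_iff wcoeff_nth)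

lemma wcoeff_fps_const: "wcoeff (fps_const g) m = (if m \<ge> 0 then fps_const (fps_nth g (nat m)) else 0)"
  by (auto simp: fps_eq_iff wcoeff_nth)

text \<open>The coefficient of w^k is divisible by x^(-k) when k is negative. Up to order
  \<open>b\<close> the convolution therefore involves only k from -b to b + m, and any finite index
  set containing this range will do.\<close>

lemma wcoeff_mult:
  assumes "finite I" "{- int b..int b + m} \<subseteq> I"
  shows "fps_cong b (wcoeff (F * G) m) (\<Sum>k\<in>I. wcoeff F (m - k) * wcoeff G k)"
  unfolding fps_cong_def
proof (intro allI impI)
  fix n assume n: "n \<le> b"
  have "fps_nth (\<Sum>k\<in>I. wcoeff F (m - k) * wcoeff G k) n =
      (\<Sum>c\<le>n. \<Sum>k\<in>I. fps_nth (wcoeff F (m - k)) c * fps_nth (wcoeff G k) (n - c))"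
    unfolding fps_sum_nth fps_mult_nth atLeast0AtMost by (rule sum.swap)
  also have "\<dots> = (\<Sum>c\<le>n. if m + int n \<ge> 0 then fps_nth (fps_nth F c * fps_nth G (n - c)) (nat (m + int n)) else 0)"
  proof (rule sum.cong)
    fix c assume "c \<in> {..n}"
    then have c: "c \<le> n" by simp
    have "(\<Sum>k\<in>I. fps_nth (wcoeff F (m - k)) c * fps_nth (wcoeff G k) (n - c)) =
        (\<Sum>k\<in>{int c - int n..m + int c}. fps_nth (fps_nth F c) (nat (m - k + int c)) * fps_nth (fps_nth G (n - c)) (nat (k + int (n - c))))"
      by (rule sum.mono_neutral_cong_right) (use assms n c in \<open>auto simp: wcoeff_nth\<close>)
    also have "\<dots> = (if m + int n \<ge> 0 then fps_nth (fps_nth F c * fps_nth G (n - c)) (nat (m + int n)) else 0)"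
    proof (cases "m + int n \<ge> 0")
      case True
      have "(\<Sum>k\<in>{int c - int n..m + int c}. fps_nth (fps_nth F c) (nat (m - k + int c)) * fps_nth (fps_nth G (n - c)) (nat (k + int (n - c)))) =
          (\<Sum>a\<in>{0..nat (m + int n)}. fps_nth (fps_nth F c) a * fps_nth (fps_nth G (n - c)) (nat (m + int n) - a))"
        by (rule sum.reindex_bij_witness[of _ "\<lambda>a. m + int c - int a" "\<lambda>k. nat (m + int c - k)"])
           (use True c in \<open>auto intro!: arg_cong2[of _ _ _ _ "(*)"] arg_cong2[of _ _ _ _ fps_nth]\<close>)
      then show ?thesis using True by (simp add: fps_mult_nth)
    qed (use c in auto)
    finally show "(\<Sum>k\<in>I. fps_nth (wcoeff F (m - k)) c * fps_nth (wcoeff G k) (n - c)) = \<dots>" .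
  qed auto
  also have "\<dots> = fps_nth (wcoeff (F * G) m) n"
    by (simp add: wcoeff_nth fps_mult_nth[of F G] fps_sum_nth atLeast0AtMost)
  finally show "fps_nth (wcoeff (F * G) m) n = fps_nth (\<Sum>k\<in>I. wcoeff F (m - k) * wcoeff G k) n" by simp
qed

text \<open>Invariance of the symbol under \<open>w \<mapsto> x / w\<close>.\<close>

definition reflect_sym :: "complex fps fps \<Rightarrow> bool" where
  "reflect_sym F \<longleftrightarrow> (\<forall>a b. fps_nth (fps_nth F a) b = fps_nth (fps_nth F b) a)"

lemma reflect_sym_wcoeff:
  assumes "reflect_sym F"
  shows "wcoeff F (- int m) = fps_X ^ m * wcoeff F (int m)"
proof (rule fps_ext)
  fix n
  have "nat (- int m + int n) = n - m" "nat (int m + int (n - m)) = n" if "m \<le> n"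
    using that by auto
  then show "fps_nth (wcoeff F (- int m)) n = fps_nth (fps_X ^ m * wcoeff F (int m)) n"
    using assms by (auto simp: wcoeff_nth fps_X_power_mult_nth reflect_sym_def)
qed

text \<open>In the independent variables w and x / w the reflection is the exchange of the two
  variables, the ring automorphism \<open>sw\<close>. It fixes \<open>F\<close>, so it maps the
  inverse of \<open>F\<close> to an inverse of \<open>F\<close>, and inverses are unique.\<close>

lemma reflect_sym_inverse:
  assumes "reflect_sym F" "F * G = 1"
  shows "reflect_sym G"
proof -
  define sw where "sw = (\<lambda>F :: complex fps fps. Abs_fps (\<lambda>b. Abs_fps (\<lambda>a. fps_nth (fps_nth F a) b)))"
  have sw_mult: "sw (F * G) = sw F * sw G" for F G
  proof (intro fps_ext)
    fix b a
    show "fps_nth (fps_nth (sw (F * G)) b) a = fps_nth (fps_nth (sw F * sw G) b) a"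
      by (simp add: sw_def fps_mult_nth fps_sum_nth) (rule sum.swap)
  qed
  have sw_F: "sw F = F"
  proof (intro fps_ext)
    fix b a
    have "fps_nth (fps_nth (sw F) b) a = fps_nth (fps_nth F a) b"
      by (simp add: sw_def)
    also have "\<dots> = fps_nth (fps_nth F b) a"
      using assms(1) unfolding reflect_sym_def by blast
    finally show "fps_nth (fps_nth (sw F) b) a = fps_nth (fps_nth F b) a" .
  qed
  have "sw 1 = 1"
    by (auto simp: sw_def fps_eq_iff)
  with sw_mult[of F G] assms(2) sw_F have "F * sw G = 1"
    by simp
  then have one: "sw G * F = 1"
    by (simp only: mult.commute)
  have "sw G = sw G * (F * G)"
    by (simp add: assms(2))
  also have "\<dots> = G"
    unfolding mult.assoc[symmetric] one by simp
  finally have "sw G = G" .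
  have "fps_nth (fps_nth G a) b = fps_nth (fps_nth G b) a" for a b
  proof -
    have "fps_nth (fps_nth (sw G) b) a = fps_nth (fps_nth G a) b"
      by (simp add: sw_def)
    then show ?thesis by (simp add: \<open>sw G = G\<close>)
  qed
  then show ?thesis
    by (auto simp: reflect_sym_def)
qed

text \<open>\<open>odd_coeff i s F\<close> is the coefficient of \<open>1 / w^(i + 1)\<close> minus \<open>x^(i + 1)\<close> times the coefficient
  of \<open>w^(i + 1)\<close> in \<open>F / w^s\<close>; these functionals vanish on series invariant under
  \<open>w \<mapsto> x / w\<close>.\<close>

definition odd_coeff :: "nat \<Rightarrow> int \<Rightarrow> complex fps fps \<Rightarrow> complex fps" where
  "odd_coeff i s F = wcoeff F (s - int i - 1) - fps_X ^ Suc i * wcoeff F (s + int i + 1)"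

text \<open>\<open>odd_mat c\<close> is multiplication by \<open>c\<close> modulo the series invariant under \<open>w \<mapsto> x / w\<close>.
  The columns of \<open>fold_mat H\<close> are the images of the basis \<open>1\<close>, \<open>w^j + w^(-j)\<close> of the series
  invariant under \<open>w \<mapsto> 1 / w\<close> after multiplication by \<open>H / w\<close>.\<close>

definition odd_mat :: "complex fps fps \<Rightarrow> bmat" where
  "odd_mat c = Bmat (\<lambda>i j. odd_coeff i (1 + int j) c)"

definition fold_mat :: "complex fps fps \<Rightarrow> bmat" where
  "fold_mat H = Bmat (\<lambda>i j. odd_coeff i (1 + int j) H + (if j = 0 then 0 else odd_coeff i (1 - int j) H))"

text \<open>As in \<open>odd_mat\<close>, row i and column j stand for w^(-i - 1) and w^(-j - 1):
  multiplication by \<open>F\<close> compressed to the negative powers of w, without the reflected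
  term of \<open>odd_mat\<close>.\<close>

definition toeplitz :: "complex fps fps \<Rightarrow> bmat" where
  "toeplitz F = Bmat (\<lambda>i j. wcoeff F (int j - int i))"

lemma odd_coeff_nth_0: "b \<le> i \<Longrightarrow> int b + s \<le> int i \<Longrightarrow> fps_nth (odd_coeff i s F) b = 0"
  by (auto simp: odd_coeff_def wcoeff_nth_0 fps_X_power_mult_nth simp del: power_Suc)

lemma ent_odd_mat: "ent (odd_mat c) i j = odd_coeff i (1 + int j) c"
  unfolding odd_mat_def by (subst ent_Bmat) (auto simp: odd_coeff_nth_0)

lemma ent_fold_mat: "ent (fold_mat H) i j = odd_coeff i (1 + int j) H + (if j = 0 then 0 else odd_coeff i (1 - int j) H)"
  unfolding fold_mat_def by (subst ent_Bmat) (auto simp: odd_coeff_nth_0)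

lemma ent_toeplitz: "ent (toeplitz F) i j = wcoeff F (int j - int i)"
  unfolding toeplitz_def by (subst ent_Bmat) (auto simp: wcoeff_nth_0)

lemma sum_symmetric_int:
  fixes f :: "int \<Rightarrow> 'a::comm_monoid_add"
  shows "(\<Sum>m\<in>{- int L..int L}. f m) = f 0 + (\<Sum>k<L. f (int k + 1) + f (- int k - 1))"
proof (induction L)
  case (Suc L)
  have "{- int (Suc L)..int (Suc L)} = insert (int L + 1) (insert (- int L - 1) {- int L..int L})"
    by auto
  then show ?case
    using Suc by (simp add: algebra_simps)
qed auto

text \<open>\<open>\<gamma> m\<close> is the value of the functional of row \<open>i\<close> on c
  w^m. Invariance of \<open>c\<close> makes \<open>\<gamma>\<close> odd under the reflection, so in
  its pairing with the coefficients of F / w^s the positive powers fold onto the negative ones and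
  only the combinations \<open>odd_coeff k s F\<close> survive. Thus multiplication by
  \<open>c\<close> acts on the quotient by invariant series.\<close>

lemma odd_coeff_mult_cong:
  assumes "reflect_sym c" "b + i + 2 * nat \<bar>s\<bar> + 1 < L"
  shows "fps_cong b (odd_coeff i s (c * F)) (\<Sum>k<L. ent (odd_mat c) i k * odd_coeff k s F)"
proof -
  define \<gamma> where "\<gamma> m = wcoeff c (- int i - 1 - m) - fps_X ^ Suc i * wcoeff c (int i + 1 - m)" for m
  have \<gamma>_odd: "\<gamma> (int k + 1) = - (fps_X ^ Suc k * \<gamma> (- int k - 1))" for k
  proof -
    have e: "- int i - 1 - (int k + 1) = - int (Suc i + Suc k)" "int i + 1 - (int k + 1) = int i - int k"
      "- int i - 1 - (- int k - 1) = int k - int i" "int i + 1 - (- int k - 1) = int (Suc i + Suc k)"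
      by auto
    have "fps_X ^ Suc i * wcoeff c (int i - int k) = fps_X ^ Suc k * wcoeff c (int k - int i)"
    proof (cases "i \<le> k")
      case True
      have "wcoeff c (int i - int k) = fps_X ^ (k - i) * wcoeff c (int k - int i)"
        using True reflect_sym_wcoeff[OF assms(1), of "k - i"] by (simp add: of_nat_diff)
      then show ?thesis
        using True by (simp add: power_add[symmetric] mult.assoc[symmetric] del: power_Suc)
    next
      case False
      have "wcoeff c (int k - int i) = fps_X ^ (i - k) * wcoeff c (int i - int k)"
        using False reflect_sym_wcoeff[OF assms(1), of "i - k"] by (simp add: of_nat_diff)
      then show ?thesis
        using False by (simp add: power_add[symmetric] mult.assoc[symmetric] del: power_Suc)
    qed
    then show ?thesis
      unfolding \<gamma>_def e reflect_sym_wcoeff[OF assms(1)] power_add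
      by (simp only: right_diff_distrib mult_minus_left mult.assoc) (simp only: mult_ac minus_diff_eq)
  qed
  have *: "fps_cong b (wcoeff (c * F) p) (\<Sum>m\<in>{- int L..int L}. wcoeff c (p - (m + s)) * wcoeff F (m + s))"
    if "\<bar>p\<bar> \<le> int i + 1 + \<bar>s\<bar>" for p
  proof -
    have "fps_cong b (wcoeff (c * F) p) (\<Sum>k\<in>{- int L + s..int L + s}. wcoeff c (p - k) * wcoeff F k)"
      by (rule wcoeff_mult) (use assms(2) that in auto)
    also have "(\<Sum>k\<in>{- int L + s..int L + s}. wcoeff c (p - k) * wcoeff F k) =
        (\<Sum>m\<in>{- int L..int L}. wcoeff c (p - (m + s)) * wcoeff F (m + s))"
      by (rule sum.reindex_bij_witness[of _ "\<lambda>m. m + s" "\<lambda>k. k - s"]) auto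
    finally show ?thesis .
  qed
  have "fps_cong b (odd_coeff i s (c * F))
      ((\<Sum>m\<in>{- int L..int L}. wcoeff c (s - int i - 1 - (m + s)) * wcoeff F (m + s)) -
        fps_X ^ Suc i * (\<Sum>m\<in>{- int L..int L}. wcoeff c (s + int i + 1 - (m + s)) * wcoeff F (m + s)))"
    unfolding odd_coeff_def by (intro fps_cong_diff fps_cong_mult fps_cong_refl *) auto
  also have "\<dots> = (\<Sum>m\<in>{- int L..int L}. \<gamma> m * wcoeff F (m + s))"
    unfolding sum_distrib_left sum_subtractf[symmetric]
  proof (rule sum.cong)
    fix m
    have "s - int i - 1 - (m + s) = - int i - 1 - m" "s + int i + 1 - (m + s) = int i + 1 - m"
      by auto
    then show "wcoeff c (s - int i - 1 - (m + s)) * wcoeff F (m + s) - fps_X ^ Suc i * (wcoeff c (s + int i + 1 - (m + s)) * wcoeff F (m + s)) =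
        \<gamma> m * wcoeff F (m + s)"
      by (simp only: \<gamma>_def left_diff_distrib mult.assoc)
  qed simp
  also have "\<dots> = \<gamma> 0 * wcoeff F s + (\<Sum>k<L. \<gamma> (int k + 1) * wcoeff F (int k + 1 + s) + \<gamma> (- int k - 1) * wcoeff F (- int k - 1 + s))"
    by (simp add: sum_symmetric_int)
  \<comment> \<open>The same oddness removes the power w^0, so the functionals can start at
    w^(-1).\<close>
  also have "\<gamma> 0 = 0"
  proof -
    have e: "- int i - 1 - 0 = - int (Suc i)" "int i + 1 - 0 = int (Suc i)"
      by auto
    show ?thesis
      unfolding \<gamma>_def e reflect_sym_wcoeff[OF assms(1)] by simp
  qed
  also have "0 * wcoeff F s + (\<Sum>k<L. \<gamma> (int k + 1) * wcoeff F (int k + 1 + s) + \<gamma> (- int k - 1) * wcoeff F (- int k - 1 + s)) =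
      (\<Sum>k<L. \<gamma> (- int k - 1) * (wcoeff F (- int k - 1 + s) - fps_X ^ Suc k * wcoeff F (int k + 1 + s)))"
    unfolding \<gamma>_odd by (simp add: right_diff_distrib mult_ac del: power_Suc)
  also have "\<dots> = (\<Sum>k<L. ent (odd_mat c) i k * odd_coeff k s F)"
  proof (rule sum.cong)
    fix k
    have e: "- int i - 1 - (- int k - 1) = 1 + int k - int i - 1" "int i + 1 - (- int k - 1) = 1 + int k + int i + 1"
      "- int k - 1 + s = s - int k - 1" "int k + 1 + s = s + int k + 1"
      by auto
    show "\<gamma> (- int k - 1) * (wcoeff F (- int k - 1 + s) - fps_X ^ Suc k * wcoeff F (int k + 1 + s)) = ent (odd_mat c) i k * odd_coeff k s F"
      unfolding ent_odd_mat odd_coeff_def \<gamma>_def e ..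
  qed simp
  finally show ?thesis .
qed

lemma odd_mat_mult:
  assumes "reflect_sym c"
  shows "odd_mat c * odd_mat d = odd_mat (c * d)"
proof (rule bmat_eqI_cong)
  fix i j b :: nat
  define L where "L = b + i + 2 * j + 5"
  have "fps_cong b (ent (odd_mat c * odd_mat d) i j) (\<Sum>k<L. ent (odd_mat c) i k * ent (odd_mat d) k j)"
    by (rule ent_mult_cong) (simp add: L_def)
  also have "fps_cong b \<dots> (ent (odd_mat (c * d)) i j)"
    unfolding ent_odd_mat[of d] ent_odd_mat[of "c * d"]
    by (rule fps_cong_sym, rule odd_coeff_mult_cong) (auto simp: L_def assms)
  finally show "fps_cong b (ent (odd_mat c * odd_mat d) i j) (ent (odd_mat (c * d)) i j)" .
qed

lemma odd_mat_one: "odd_mat 1 = 1"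
  by (rule bmat_eqI) (auto simp: ent_odd_mat odd_coeff_def wcoeff_one ent_one)

lemma odd_mat_mult_fold_mat:
  assumes "reflect_sym c"
  shows "odd_mat c * fold_mat H = fold_mat (c * H)"
proof (rule bmat_eqI_cong)
  fix i j b :: nat
  define L where "L = b + i + 2 * j + 5"
  have "fps_cong b (ent (odd_mat c * fold_mat H) i j) (\<Sum>k<L. ent (odd_mat c) i k * ent (fold_mat H) k j)"
    by (rule ent_mult_cong) (simp add: L_def)
  also have "\<dots> = (\<Sum>k<L. ent (odd_mat c) i k * odd_coeff k (1 + int j) H) +
      (if j = 0 then 0 else \<Sum>k<L. ent (odd_mat c) i k * odd_coeff k (1 - int j) H)"
    by (simp add: ent_fold_mat sum.distrib algebra_simps)
  also have "fps_cong b \<dots> (ent (fold_mat (c * H)) i j)"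
  proof -
    have "fps_cong b (\<Sum>k<L. ent (odd_mat c) i k * odd_coeff k s H) (odd_coeff i s (c * H))"
      if "\<bar>s\<bar> \<le> 1 + int j" for s
      by (rule fps_cong_sym, rule odd_coeff_mult_cong) (use that in \<open>auto simp: L_def assms\<close>)
    from this[of "1 + int j"] this[of "1 - int j"] show ?thesis
      by (simp add: ent_fold_mat fps_cong_add)
  qed
  finally show "fps_cong b (ent (odd_mat c * fold_mat H) i j) (ent (fold_mat (c * H)) i j)" .
qed

text \<open>The theta series \<open>\<Sum>k. (-1)^k x^(k (k - 1) / 2) w^k\<close> over all integers \<open>k\<close>. It is invariant
  under \<open>w \<mapsto> x / w\<close>, and its quotient by \<open>1 - w\<close> is invariant under \<open>w \<mapsto> 1 / w\<close>.\<close>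

definition theta :: "complex fps fps" where
  "theta = Abs_fps (\<lambda>b. Abs_fps (\<lambda>a. if 2 * int b = (int a - int b) * (int a - int b - 1)
     then (- 1) ^ nat \<bar>int a - int b\<bar> else 0))"

lemma wcoeff_theta_nth:
  "fps_nth (wcoeff theta m) b = (if 2 * int b = m * (m - 1) then (- 1) ^ nat \<bar>m\<bar> else 0)"
proof (cases "m + int b \<ge> 0")
  case False
  \<comment> \<open>Out of range means -m \<ge> b + 1, and then also 1 - m \<ge> 2; so m (m - 1) is
    larger than 2 b and the coefficient is zero by either description.\<close>
  then have "(int b + 1) * 2 \<le> (- m) * (1 - m)"
    by (intro mult_mono) auto
  then have "2 * int b \<noteq> m * (m - 1)"
    by (simp add: algebra_simps)
  with False show ?thesis by (simp add: wcoeff_nth)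
qed (simp add: wcoeff_nth theta_def)

text \<open>In terms of series, theta(1 / w) = - theta(w) / w: the exponent m (m - 1) / 2 is
  symmetric under m -> 1 - m while the sign alternates. Since 1 - w has the same behaviour, the
  quotient is invariant under w -> 1 / w.\<close>

lemma wcoeff_theta_reflect: "wcoeff theta (1 - m) = - wcoeff theta m"
proof -
  have "(- 1 :: complex) ^ nat \<bar>1 - m\<bar> = - ((- 1) ^ nat \<bar>m\<bar>)"
  proof (cases "m \<ge> 1")
    case True
    then have "nat \<bar>m\<bar> = Suc (nat \<bar>1 - m\<bar>)" by simp
    then show ?thesis by (simp only: power_Suc mult_minus_left mult_1_left minus_minus)
  next
    case False
    then have "nat \<bar>1 - m\<bar> = Suc (nat \<bar>m\<bar>)" by simp
    then show ?thesis by (simp only: power_Suc mult_minus_left mult_1_left minus_minus)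
  qed
  then show ?thesis
    by (auto simp: fps_eq_iff wcoeff_theta_nth algebra_simps)
qed

lemma reflect_sym_theta: "reflect_sym theta"
proof -
  have "2 * int a = (int b - int a) * (int b - int a - 1) \<longleftrightarrow> 2 * int b = (int a - int b) * (int a - int b - 1)" for a b
    by (auto simp: algebra_simps)
  then show ?thesis
    by (simp add: reflect_sym_def theta_def abs_minus_commute)
qed

text \<open>The part of \<open>theta\<close> free of x / w consists of the terms with k (k - 1) = 0,
  that is 1 - w; hence the seed \<open>inverse (1 - fps_X)\<close>.\<close>

definition theta_inv :: "complex fps fps" where
  "theta_inv = fps_right_inverse theta (inverse (1 - fps_X))"

lemma theta_mult_inv: "theta * theta_inv = 1"
proof -
  have "fps_nth theta 0 = 1 - fps_X"
  proof (rule fps_ext)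
    fix a
    have "int a * (int a - 1) = 0 \<longleftrightarrow> a = 0 \<or> a = 1"
      by auto
    then show "fps_nth (fps_nth theta 0) a = fps_nth (1 - fps_X) a"
      by (auto simp: theta_def)
  qed
  then show ?thesis
    unfolding theta_inv_def
    by (intro fps_right_inverse) (simp add: inverse_mult_eq_1')
qed

text \<open>This is the factor E of the factorization of 1 / (1 - w); inside
  \<open>fps_const\<close> the variable \<open>fps_X\<close> plays the role of w.\<close>

definition theta_quot :: "complex fps fps" where
  "theta_quot = theta * fps_const (inverse (1 - fps_X))"

lemma wcoeff_fps_const_diff_mult:
  "wcoeff (fps_const (1 - fps_X) * F) m = wcoeff F m - wcoeff F (m - 1)"
proof (rule fps_ext)
  fix b
  have "nat (m - 1 + int b) = nat (m + int b) - 1"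
    by simp
  then show "fps_nth (wcoeff (fps_const (1 - fps_X) * F) m) b = fps_nth (wcoeff F m - wcoeff F (m - 1)) b"
    by (auto simp: wcoeff_nth algebra_simps)
qed

lemma wcoeff_theta_quot_diff: "wcoeff theta_quot m - wcoeff theta_quot (m - 1) = wcoeff theta m"
proof -
  have "fps_const (1 - fps_X) * theta_quot = theta * fps_const ((1 - fps_X) * inverse (1 - fps_X))"
    by (simp only: theta_quot_def mult_ac fps_const_mult)
  also have "\<dots> = theta"
    by (simp add: inverse_mult_eq_1')
  finally show ?thesis
    by (metis wcoeff_fps_const_diff_mult)
qed

lemma wcoeff_theta_quot_minus: "wcoeff theta_quot (- m) = wcoeff theta_quot m"
proof -
  define d where "d m = wcoeff theta_quot m - wcoeff theta_quot (- m)" for m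
  have step: "d m = d (m - 1)" for m
    using wcoeff_theta_quot_diff[of m] wcoeff_theta_quot_diff[of "1 - m"] wcoeff_theta_reflect[of m]
    by (simp add: d_def algebra_simps)
  have "d m = d 0"
  proof (induction m rule: int_induct[of _ 0])
    case (step1 i)
    then show ?case using step[of "i + 1"] by simp
  qed (use step in auto)
  then show ?thesis by (simp add: d_def)
qed

text \<open>The general bound covers negative powers of w, and symmetry carries it over to positive
  ones. It is what makes the entries of \<open>even_mat\<close> divisible by the required powers of
  x.\<close>

lemma wcoeff_theta_quot_nth_0: "int b < \<bar>m\<bar> \<Longrightarrow> fps_nth (wcoeff theta_quot m) b = 0"
  using wcoeff_nth_0[of b m theta_quot] wcoeff_nth_0[of b "- m" theta_quot] wcoeff_theta_quot_minus[of m]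
  by (cases "m \<ge> 0") auto

text \<open>Multiplication by \<open>theta_quot\<close> on the series invariant under \<open>w \<mapsto> 1 / w\<close>.\<close>

definition even_mat :: bmat where
  "even_mat = Bmat (\<lambda>i j. wcoeff theta_quot (int i - int j) + (if j = 0 then 0 else wcoeff theta_quot (int i + int j)))"

lemma ent_even_mat:
  "ent even_mat i j = wcoeff theta_quot (int i - int j) + (if j = 0 then 0 else wcoeff theta_quot (int i + int j))"
  unfolding even_mat_def by (subst ent_Bmat) (auto simp: wcoeff_theta_quot_nth_0)

text \<open>The free shift \<open>t\<close> is taken to be -j for s = 1 + j and j for s = 1 - j, so
  that both halves of a column are expanded in the same functionals
  \<open>odd_coeff i (1 + k)\<close>.\<close>

lemma odd_coeff_mult_theta_quot_cong:
  assumes "nat \<bar>s\<bar> + b + i + nat \<bar>t\<bar> + 1 < L"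
  shows "fps_cong b (odd_coeff i s (H * theta_quot))
    (\<Sum>k\<in>{- int L..int L}. wcoeff theta_quot (k + t) * odd_coeff i (s + t + k) H)"
proof -
  have *: "fps_cong b (wcoeff (H * theta_quot) p) (\<Sum>k\<in>{- int L..int L}. wcoeff H (p + t + k) * wcoeff theta_quot (k + t))"
    if "\<bar>p\<bar> \<le> \<bar>s\<bar> + int i + 1" for p
  proof -
    have "fps_cong b (wcoeff (H * theta_quot) p) (\<Sum>k\<in>{- int L - t..int L - t}. wcoeff H (p - k) * wcoeff theta_quot k)"
      by (rule wcoeff_mult) (use assms that in auto)
    also have "(\<Sum>k\<in>{- int L - t..int L - t}. wcoeff H (p - k) * wcoeff theta_quot k) =
        (\<Sum>k\<in>{- int L..int L}. wcoeff H (p + t + k) * wcoeff theta_quot (- (k + t)))"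
      by (rule sum.reindex_bij_witness[of _ "\<lambda>k. - k - t" "\<lambda>k. - k - t"]) auto
    finally show ?thesis by (simp only: wcoeff_theta_quot_minus)
  qed
  have "fps_cong b (odd_coeff i s (H * theta_quot))
      ((\<Sum>k\<in>{- int L..int L}. wcoeff H (s - int i - 1 + t + k) * wcoeff theta_quot (k + t)) -
        fps_X ^ Suc i * (\<Sum>k\<in>{- int L..int L}. wcoeff H (s + int i + 1 + t + k) * wcoeff theta_quot (k + t)))"
    unfolding odd_coeff_def by (intro fps_cong_diff fps_cong_mult fps_cong_refl *) auto
  also have "\<dots> = (\<Sum>k\<in>{- int L..int L}. wcoeff theta_quot (k + t) * odd_coeff i (s + t + k) H)"
    by (simp add: odd_coeff_def sum_subtractf sum_distrib_left algebra_simps del: power_Suc)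
  finally show ?thesis .
qed

lemma fold_mat_mult_even_mat: "fold_mat H * even_mat = fold_mat (H * theta_quot)"
proof (rule bmat_eqI_cong)
  fix i j b :: nat
  define L where "L = b + i + 2 * j + 3"
  \<comment> \<open>The coefficient of w^k in E times the basis element of column \<open>j\<close>.
    It is even in \<open>k\<close>, so the sum over all integers folds into columns of
    \<open>fold_mat\<close>.\<close>
  define \<epsilon> where "\<epsilon> k = wcoeff theta_quot (k - int j) + (if j = 0 then 0 else wcoeff theta_quot (k + int j))" for k
  have \<epsilon>_minus: "\<epsilon> (- k) = \<epsilon> k" for k
    using wcoeff_theta_quot_minus[of "k - int j"] wcoeff_theta_quot_minus[of "k + int j"]
    by (auto simp: \<epsilon>_def algebra_simps)
  have \<epsilon>_pred: "\<epsilon> (- int k - 1) = \<epsilon> (int k + 1)" for k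
  proof -
    have "- int k - 1 = - (int k + 1)" by simp
    then show ?thesis by (simp only: \<epsilon>_minus)
  qed
  have "fps_cong b (ent (fold_mat (H * theta_quot)) i j)
     ((\<Sum>k\<in>{- int L..int L}. wcoeff theta_quot (k + - int j) * odd_coeff i (1 + int j + - int j + k) H) +
      (if j = 0 then 0 else \<Sum>k\<in>{- int L..int L}. wcoeff theta_quot (k + int j) * odd_coeff i (1 - int j + int j + k) H))"
    (is "fps_cong b _ (?A + (if j = 0 then 0 else ?B))")
  proof -
    have "fps_cong b (odd_coeff i (1 + int j) (H * theta_quot)) ?A"
      by (rule odd_coeff_mult_theta_quot_cong) (simp add: L_def)
    moreover have "fps_cong b (odd_coeff i (1 - int j) (H * theta_quot)) ?B"
      by (rule odd_coeff_mult_theta_quot_cong) (simp add: L_def)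
    ultimately show ?thesis
      by (simp add: ent_fold_mat fps_cong_add)
  qed
  also have "?A + (if j = 0 then 0 else ?B) = (\<Sum>k\<in>{- int L..int L}. \<epsilon> k * odd_coeff i (1 + k) H)"
    by (simp add: \<epsilon>_def sum.distrib algebra_simps)
  also have "\<dots> = \<epsilon> 0 * odd_coeff i 1 H + (\<Sum>k<L. \<epsilon> (int (Suc k)) * (odd_coeff i (1 + int (Suc k)) H + odd_coeff i (1 - int (Suc k)) H))"
    by (simp add: sum_symmetric_int \<epsilon>_pred algebra_simps)
  also have "\<dots> = (\<Sum>k<Suc L. ent (fold_mat H) i k * ent even_mat k j)"
    by (simp add: sum.lessThan_Suc_shift ent_fold_mat ent_even_mat \<epsilon>_def algebra_simps del: sum.lessThan_Suc of_nat_Suc)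
  also have "fps_cong b \<dots> (ent (fold_mat H * even_mat) i j)"
    by (rule fps_cong_sym[OF ent_mult_cong]) (simp add: L_def)
  finally show "fps_cong b (ent (fold_mat H * even_mat) i j) (ent (fold_mat (H * theta_quot)) i j)"
    by (rule fps_cong_sym)
qed

section \<open>Toeplitz matrices and their multiplication defect\<close>

lemma ent_toeplitz_mult_cong:
  assumes "i + j + b < L"
  shows "fps_cong b (ent (toeplitz F * toeplitz G) i j) (\<Sum>k<L. wcoeff F (int k - int i) * wcoeff G (int j - int k))"
  using ent_mult_cong[of j b L "toeplitz F" "toeplitz G" i] assms by (simp add: ent_toeplitz)

text \<open>The first sum is the product of the Toeplitz matrices. The second, over negative inner
  indices, is a product of Hankel matrices; it involves \<open>F\<close> only through powers w^(-i -
  1 - k), so it has order at least i + 1, and it vanishes if \<open>F\<close> has no negative powers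
  of w.\<close>

lemma wcoeff_mult_cong_split:
  assumes "i + j + b < L"
  shows "fps_cong b (wcoeff (F * G) (int j - int i))
    ((\<Sum>k<L. wcoeff F (int k - int i) * wcoeff G (int j - int k)) +
     (\<Sum>k<L. wcoeff F (- int k - 1 - int i) * wcoeff G (int j + int k + 1)))"
proof -
  have "fps_cong b (wcoeff (F * G) (int j - int i))
      (\<Sum>k\<in>{int j - int L<..int j + int L}. wcoeff F (int j - int i - k) * wcoeff G k)"
    by (rule wcoeff_mult) (use assms in auto)
  also have "(\<Sum>k\<in>{int j - int L<..int j + int L}. wcoeff F (int j - int i - k) * wcoeff G k) =
      (\<Sum>k\<in>{- int L..<int L}. wcoeff F (k - int i) * wcoeff G (int j - k))"
    by (rule sum.reindex_bij_witness[of _ "\<lambda>k. int j - k" "\<lambda>k. int j - k"]) (auto intro!: arg_cong2[of _ _ _ _ "(*)"] arg_cong[of _ _ "wcoeff F"])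
  also have "{- int L..<int L} = {0..<int L} \<union> {- int L..<0}"
    by auto
  also have "(\<Sum>k\<in>\<dots>. wcoeff F (k - int i) * wcoeff G (int j - k)) =
      (\<Sum>k\<in>{0..<int L}. wcoeff F (k - int i) * wcoeff G (int j - k)) + (\<Sum>k\<in>{- int L..<0}. wcoeff F (k - int i) * wcoeff G (int j - k))"
    by (rule sum.union_disjoint) auto
  also have "(\<Sum>k\<in>{0..<int L}. wcoeff F (k - int i) * wcoeff G (int j - k)) = (\<Sum>k<L. wcoeff F (int k - int i) * wcoeff G (int j - int k))"
    by (rule sum.reindex_bij_witness[of _ int nat]) auto
  also have "(\<Sum>k\<in>{- int L..<0}. wcoeff F (k - int i) * wcoeff G (int j - k)) =
      (\<Sum>k<L. wcoeff F (- int k - 1 - int i) * wcoeff G (int j + int k + 1))"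
    by (rule sum.reindex_bij_witness[of _ "\<lambda>k. - int k - 1" "\<lambda>k. nat (- k - 1)"]) (auto simp: algebra_simps)
  finally show ?thesis .
qed

lemma small_toeplitz_mult: "small (toeplitz F * toeplitz G - toeplitz (F * G))"
  unfolding small_def ent_diff
proof (intro allI impI)
  fix i j b :: nat assume "b \<le> i"
  obtain L where L: "i + j + b < L" by blast
  have "fps_nth (wcoeff F (- int k - 1 - int i) * wcoeff G (int j + int k + 1)) b = 0" for k
    by (rule fps_mult_nth_0_if[where k = "Suc i" and l = 0]) (use \<open>b \<le> i\<close> in \<open>auto intro!: wcoeff_nth_0\<close>)
  then show "fps_nth (ent (toeplitz F * toeplitz G) i j - ent (toeplitz (F * G)) i j) b = 0"
    using ent_toeplitz_mult_cong[OF L, of F G] wcoeff_mult_cong_split[OF L, of F G]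
    by (simp add: fps_cong_def ent_toeplitz fps_sum_nth)
qed

lemma toeplitz_const_mult: "toeplitz (fps_const g) * toeplitz F = toeplitz (fps_const g * F)"
proof (rule bmat_eqI_cong)
  fix i j b :: nat
  obtain L where L: "i + j + b < L" by blast
  have "wcoeff (fps_const g) (- int k - 1 - int i) = 0" for k
    by (simp add: wcoeff_fps_const)
  then show "fps_cong b (ent (toeplitz (fps_const g) * toeplitz F) i j) (ent (toeplitz (fps_const g * F)) i j)"
    using ent_toeplitz_mult_cong[OF L, of "fps_const g" F] wcoeff_mult_cong_split[OF L, of "fps_const g" F]
    by (simp add: fps_cong_def ent_toeplitz)
qed

lemma toeplitz_one: "toeplitz 1 = 1"
  by (rule bmat_eqI) (auto simp: ent_toeplitz wcoeff_one ent_one)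

lemma small_odd_mat_minus_toeplitz: "small (odd_mat c - toeplitz c)"
  by (auto simp: small_def ent_diff ent_odd_mat ent_toeplitz odd_coeff_def fps_X_power_mult_nth simp del: power_Suc)

text \<open>The reflected terms carry x^(i + 1). The remaining extra term, present for j > 0, is the
  coefficient of w^(-i - j), which is zero because a symbol \<open>fps_const g\<close> has no
  negative powers of w.\<close>

lemma small_fold_mat_minus_toeplitz: "small (fold_mat (fps_const g) - toeplitz (fps_const g))"
  by (auto simp: small_def ent_diff ent_fold_mat ent_toeplitz odd_coeff_def wcoeff_fps_const fps_X_power_mult_nth simp del: power_Suc)

subsection \<open>The Toda relation\<close>

definition upper_toeplitz :: "complex fps \<Rightarrow> bmat" where
  "upper_toeplitz g = toeplitz (fps_const g)"

definition norm_fold_mat :: "complex fps \<Rightarrow> bmat" where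
  "norm_fold_mat g = fold_mat (fps_const g) * upper_toeplitz (inverse g)"

lemma upper_toeplitz_mult: "upper_toeplitz g * upper_toeplitz h = upper_toeplitz (g * h)"
  by (simp add: upper_toeplitz_def toeplitz_const_mult)

lemma upper_toeplitz_one: "upper_toeplitz 1 = 1"
  by (simp add: upper_toeplitz_def toeplitz_one)

lemma upper_toeplitz_inverse:
  assumes "fps_nth g 0 \<noteq> 0"
  shows "upper_toeplitz g * upper_toeplitz (inverse g) = 1" "upper_toeplitz (inverse g) * upper_toeplitz g = 1"
  using assms by (simp_all add: upper_toeplitz_mult upper_toeplitz_one inverse_mult_eq_1 inverse_mult_eq_1')

lemma small_norm_fold_mat:
  assumes "fps_nth g 0 \<noteq> 0"
  shows "small (norm_fold_mat g - 1)"
proof -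
  have "norm_fold_mat g - 1 = (fold_mat (fps_const g) - toeplitz (fps_const g)) * upper_toeplitz (inverse g)"
    using upper_toeplitz_inverse(1)[OF assms] by (simp add: norm_fold_mat_def upper_toeplitz_def algebra_simps)
  then show ?thesis
    by (simp add: small_mult_right small_fold_mat_minus_toeplitz)
qed

lemma odd_mat_theta_inv: "odd_mat theta * odd_mat theta_inv = 1" "odd_mat theta_inv * odd_mat theta = 1"
  using reflect_sym_inverse[OF reflect_sym_theta theta_mult_inv] theta_mult_inv
  by (simp_all add: odd_mat_mult reflect_sym_theta odd_mat_one mult.commute)

definition commutator_mat :: "complex fps \<Rightarrow> bmat" where
  "commutator_mat g = odd_mat theta_inv * upper_toeplitz g * odd_mat theta * upper_toeplitz (inverse g)"

text \<open>Modulo small matrices \<open>odd_mat c\<close> is the Toeplitz matrix of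
  \<open>c\<close>, and there Toeplitz matrices multiply like their symbols, which commute.\<close>

lemma small_upper_toeplitz_odd_mat_commute: "small (upper_toeplitz g * odd_mat c - odd_mat c * upper_toeplitz g)"
proof -
  have eq: "upper_toeplitz g * odd_mat c - odd_mat c * upper_toeplitz g =
      upper_toeplitz g * (odd_mat c - toeplitz c) - (odd_mat c - toeplitz c) * upper_toeplitz g - (toeplitz c * toeplitz (fps_const g) - toeplitz (c * fps_const g))"
    by (simp add: algebra_simps upper_toeplitz_def toeplitz_const_mult mult.commute[of "fps_const g" c])
  show ?thesis
    unfolding eq by (intro small_diff small_mult_left small_mult_right small_odd_mat_minus_toeplitz small_toeplitz_mult)
qed

lemma small_commutator_mat:
  assumes "fps_nth g 0 \<noteq> 0"
  shows "small (commutator_mat g - 1)"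
proof -
  have "odd_mat theta_inv * (odd_mat theta * upper_toeplitz g) * upper_toeplitz (inverse g) = odd_mat theta_inv * odd_mat theta * (upper_toeplitz g * upper_toeplitz (inverse g))"
    by (simp only: mult.assoc)
  also have "\<dots> = 1"
    by (simp add: odd_mat_theta_inv upper_toeplitz_inverse assms)
  finally have eq: "commutator_mat g - 1 = odd_mat theta_inv * (upper_toeplitz g * odd_mat theta - odd_mat theta * upper_toeplitz g) * upper_toeplitz (inverse g)"
    by (simp add: commutator_mat_def algebra_simps)
  show ?thesis
    unfolding eq by (intro small_mult_left small_mult_right small_upper_toeplitz_odd_mat_commute)
qed

abbreviation geo :: "complex fps" where "geo \<equiv> inverse (1 - fps_X)"

text \<open>At the level of symbols this is (E / theta) (1 - w) = 1; the matrix measures how far the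
  two one-sided multiplications are from the Toeplitz matrix of 1 / (1 - w).\<close>

definition quotient_mat :: bmat where
  "quotient_mat = odd_mat theta_inv * even_mat * upper_toeplitz (1 - fps_X)"

lemma inverse_geo: "inverse geo = 1 - fps_X"
  by (rule fps_inverse_idempotent) simp

text \<open>From theta g / (1 - w) = g E: theta acts on the side of the quotient by series invariant
  under w -> x / w, E on the side of the series invariant under w -> 1 / w.\<close>

lemma fold_mat_mult_geo: "fold_mat (fps_const (g * geo)) = odd_mat theta_inv * fold_mat (fps_const g) * even_mat"
proof -
  have "theta * fps_const (g * geo) = fps_const g * theta_quot"
    by (simp add: theta_quot_def mult_ac flip: fps_const_mult)
  then have "odd_mat theta * fold_mat (fps_const (g * geo)) = fold_mat (fps_const g) * even_mat"
    by (simp add: odd_mat_mult_fold_mat reflect_sym_theta fold_mat_mult_even_mat)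
  then have "odd_mat theta_inv * (odd_mat theta * fold_mat (fps_const (g * geo))) = odd_mat theta_inv * fold_mat (fps_const g) * even_mat"
    by (simp add: mult.assoc)
  then show ?thesis
    by (simp add: odd_mat_theta_inv mult.assoc[symmetric])
qed

text \<open>The case g = 1 of \<open>fold_mat_mult_geo\<close> expresses \<open>quotient_mat\<close>
  through the normalized matrices of 1 and 1 / (1 - w), both known to be 1 plus a small
  matrix.\<close>

lemma small_quotient_mat: "small (quotient_mat - 1)"
proof -
  have "fold_mat (fps_const geo) = odd_mat theta_inv * fold_mat 1 * even_mat"
    using fold_mat_mult_geo[of 1] by simp
  then have P: "norm_fold_mat geo = odd_mat theta_inv * norm_fold_mat 1 * even_mat * upper_toeplitz (1 - fps_X)"
    by (simp add: norm_fold_mat_def inverse_geo upper_toeplitz_one)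
  have eq: "quotient_mat - 1 = (norm_fold_mat geo - 1) - odd_mat theta_inv * (norm_fold_mat 1 - 1) * even_mat * upper_toeplitz (1 - fps_X)"
    unfolding P by (simp add: quotient_mat_def algebra_simps)
  show ?thesis
    unfolding eq by (intro small_diff small_mult_left small_mult_right small_norm_fold_mat) auto
qed

lemma even_mat_eq: "even_mat = odd_mat theta * quotient_mat * upper_toeplitz geo"
proof -
  have "odd_mat theta * quotient_mat * upper_toeplitz geo = odd_mat theta * odd_mat theta_inv * even_mat * (upper_toeplitz (1 - fps_X) * upper_toeplitz geo)"
    by (simp add: quotient_mat_def mult.assoc)
  also have "\<dots> = even_mat"
    using upper_toeplitz_inverse(1)[of "1 - fps_X"] by (simp add: odd_mat_theta_inv)
  finally show ?thesis by simp
qed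

lemma inverse_mult_geo: "inverse (g * geo) = inverse g * (1 - fps_X)"
  by (simp add: fps_inverse_mult inverse_geo)

text \<open>Inserting theta and the Toeplitz matrix of g together with their inverses leaves three
  blocks that are each 1 plus a small matrix: a conjugate of the old matrix, a commutator, and a
  conjugate of \<open>quotient_mat\<close>.\<close>

lemma norm_fold_mat_mult_geo:
  assumes "fps_nth g 0 \<noteq> 0"
  shows "norm_fold_mat (g * geo) = (odd_mat theta_inv * norm_fold_mat g * odd_mat theta) * (commutator_mat g * (upper_toeplitz g * quotient_mat * upper_toeplitz (inverse g)))"
proof -
  note cancel = odd_mat_theta_inv upper_toeplitz_inverse[OF assms]
  have c1: "odd_mat theta * (odd_mat theta_inv * A) = A" "upper_toeplitz (inverse g) * (upper_toeplitz g * A) = A" for A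
    using cancel by (simp_all flip: mult.assoc)
  have c2: "upper_toeplitz geo * upper_toeplitz (inverse g * (1 - fps_X)) = upper_toeplitz (inverse g)"
    by (simp add: upper_toeplitz_mult mult.left_commute inverse_mult_eq_1)
  have "(odd_mat theta_inv * norm_fold_mat g * odd_mat theta) * (commutator_mat g * (upper_toeplitz g * quotient_mat * upper_toeplitz (inverse g))) =
      odd_mat theta_inv * fold_mat (fps_const g) * (odd_mat theta * quotient_mat * upper_toeplitz (inverse g))"
    by (simp add: norm_fold_mat_def commutator_mat_def mult.assoc c1)
  also have "odd_mat theta * quotient_mat * upper_toeplitz (inverse g) = even_mat * upper_toeplitz (inverse g * (1 - fps_X))"
    by (simp add: even_mat_eq mult.assoc c2)
  also have "odd_mat theta_inv * fold_mat (fps_const g) * \<dots> = norm_fold_mat (g * geo)"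
    by (simp add: norm_fold_mat_def fold_mat_mult_geo inverse_mult_geo mult.assoc)
  finally show ?thesis by simp
qed

text \<open>The group identity [g h] = [g] (g [h] g^(-1)) for the commutators [g] = theta^(-1) g
  theta g^(-1), with h = 1 / (1 - w).\<close>

lemma commutator_mat_mult_geo:
  assumes "fps_nth g 0 \<noteq> 0"
  shows "commutator_mat (g * geo) = commutator_mat g * (upper_toeplitz g * commutator_mat geo * upper_toeplitz (inverse g))"
proof -
  have c1: "odd_mat theta * (odd_mat theta_inv * A) = A" "upper_toeplitz (inverse g) * (upper_toeplitz g * A) = A" for A
    using odd_mat_theta_inv upper_toeplitz_inverse[OF assms] by (simp_all flip: mult.assoc)
  have "commutator_mat g * (upper_toeplitz g * commutator_mat geo * upper_toeplitz (inverse g)) =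
      odd_mat theta_inv * (upper_toeplitz g * (upper_toeplitz geo * (odd_mat theta * (upper_toeplitz (1 - fps_X) * upper_toeplitz (inverse g)))))"
    by (simp add: commutator_mat_def mult.assoc c1 inverse_geo)
  also have "upper_toeplitz (1 - fps_X) * upper_toeplitz (inverse g) = upper_toeplitz (inverse (g * geo))"
    by (simp add: upper_toeplitz_mult inverse_mult_geo mult.commute)
  finally show ?thesis
    by (simp add: commutator_mat_def upper_toeplitz_mult flip: mult.assoc)
qed

section \<open>The determinant F and its values at powers of 1 / (1 - w)\<close>

definition fdet :: "complex fps \<Rightarrow> complex fps" where
  "fdet g = idet (norm_fold_mat g)"

lemma fdet_mult_geo:
  assumes "fps_nth g 0 \<noteq> 0"
  shows "fdet (g * geo) = fdet g * idet (commutator_mat g) * idet quotient_mat"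
proof -
  have "idet (norm_fold_mat (g * geo)) = idet (odd_mat theta_inv * norm_fold_mat g * odd_mat theta) * idet (commutator_mat g * (upper_toeplitz g * quotient_mat * upper_toeplitz (inverse g)))"
    unfolding norm_fold_mat_mult_geo[OF assms] using assms
    by (intro idet_mult small_mult_minus_one small_conj_minus_one small_norm_fold_mat small_commutator_mat small_quotient_mat)
       (auto simp: odd_mat_theta_inv upper_toeplitz_inverse)
  also have "idet (commutator_mat g * (upper_toeplitz g * quotient_mat * upper_toeplitz (inverse g))) = idet (commutator_mat g) * idet (upper_toeplitz g * quotient_mat * upper_toeplitz (inverse g))"
    using assms by (intro idet_mult small_conj_minus_one small_commutator_mat small_quotient_mat) (auto simp: upper_toeplitz_inverse)
  also have "idet (odd_mat theta_inv * norm_fold_mat g * odd_mat theta) = idet (norm_fold_mat g)"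
    using assms by (intro idet_conj small_norm_fold_mat) (auto simp: odd_mat_theta_inv)
  also have "idet (upper_toeplitz g * quotient_mat * upper_toeplitz (inverse g)) = idet quotient_mat"
    using assms by (intro idet_conj small_quotient_mat) (auto simp: upper_toeplitz_inverse)
  finally show ?thesis by (simp add: fdet_def mult.assoc)
qed

lemma idet_commutator_mat_mult_geo:
  assumes "fps_nth g 0 \<noteq> 0"
  shows "idet (commutator_mat (g * geo)) = idet (commutator_mat g) * idet (commutator_mat geo)"
proof -
  have "idet (commutator_mat g * (upper_toeplitz g * commutator_mat geo * upper_toeplitz (inverse g))) = idet (commutator_mat g) * idet (upper_toeplitz g * commutator_mat geo * upper_toeplitz (inverse g))"
    using assms by (intro idet_mult small_conj_minus_one small_commutator_mat) (auto simp: upper_toeplitz_inverse)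
  also have "idet (upper_toeplitz g * commutator_mat geo * upper_toeplitz (inverse g)) = idet (commutator_mat geo)"
    using assms by (intro idet_conj small_commutator_mat) (auto simp: upper_toeplitz_inverse)
  finally show ?thesis by (simp add: commutator_mat_mult_geo assms)
qed

lemma fdet_toda:
  assumes "fps_nth g 0 \<noteq> 0"
  shows "fdet (g * geo * geo) * fdet g = fdet (g * geo) ^ 2 * idet (commutator_mat geo)"
proof -
  have "fps_nth (g * geo) 0 \<noteq> 0"
    using assms by simp
  from fdet_mult_geo[OF this] show ?thesis
    by (simp add: fdet_mult_geo idet_commutator_mat_mult_geo assms power2_eq_square mult_ac)
qed

lemma fdet_cong:
  assumes "fps_nth g 0 = 1" "b \<le> n"
  shows "fps_cong b (fdet g) (trunc_det n (ent (fold_mat (fps_const g))))"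
proof -
  have up: "ent (upper_toeplitz h) i j = 0" if "j < i" for h i j
    using that by (simp add: upper_toeplitz_def ent_toeplitz wcoeff_fps_const)
  have "trunc_det n (ent (norm_fold_mat g)) = trunc_det n (ent (fold_mat (fps_const g))) * trunc_det n (ent (upper_toeplitz (inverse g)))"
    unfolding norm_fold_mat_def by (rule trunc_det_mult_upper) (rule up)
  also have "trunc_det n (ent (upper_toeplitz (inverse g))) = (\<Prod>i<n. ent (upper_toeplitz (inverse g)) i i)"
    by (rule trunc_det_upper) (rule up)
  also have "\<dots> = 1"
    using assms(1) by (simp add: upper_toeplitz_def ent_toeplitz wcoeff_fps_const)
  finally show ?thesis
    using idet_cong[OF small_norm_fold_mat assms(2), of g] assms(1) by (simp add: fdet_def)
qed

text \<open>Below the diagonal every index of \<open>g\<close> is negative or at least 3. On the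
  diagonal the reflected coefficient of w^2 enters once: through the shift 1 + j for j = 0, through
  1 - j otherwise.\<close>

lemma trunc_det_fold_mat_quadratic:
  assumes "\<And>k. k \<ge> 3 \<Longrightarrow> fps_nth g k = 0" "fps_nth g 0 = 1"
  shows "trunc_det n (ent (fold_mat (fps_const g))) = (\<Prod>i<n. 1 - fps_const (fps_nth g 2) * fps_X ^ Suc i)"
proof -
  have "nat (2 + int i) = i + 2" "nat (2 + int i - int j) = i + 2 - j" "nat (2 + int i + int j) = i + 2 + j" for i j
    by auto
  note * = this
  have z: "fps_nth g (Suc (Suc (i + j))) = 0" if "i > 0 \<or> j > 0" for i j
    using that assms(1)[of "Suc (Suc (i + j))"] by (cases i; cases j) auto
  have "trunc_det n (ent (fold_mat (fps_const g))) = (\<Prod>i<n. ent (fold_mat (fps_const g)) i i)"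
    by (rule trunc_det_upper) (auto simp: ent_fold_mat odd_coeff_def wcoeff_fps_const * assms(1) simp del: power_Suc)
  also have "\<dots> = (\<Prod>i<n. 1 - fps_const (fps_nth g 2) * fps_X ^ Suc i)"
    by (rule prod.cong) (auto simp: ent_fold_mat odd_coeff_def wcoeff_fps_const * assms numeral_2_eq_2 z mult.commute simp del: power_Suc)
  finally show ?thesis .
qed

text \<open>The value at z = -2. Taking the determinant itself as definition gives a power series at
  once; \<open>euler_prod_cong\<close> identifies it with the product of the 1 - x^i.\<close>

definition euler_prod :: "complex fps" where
  "euler_prod = fdet ((1 - fps_X) ^ 2)"

lemma euler_prod_cong:
  assumes "b \<le> n"
  shows "fps_cong b euler_prod (\<Prod>i<n. 1 - fps_X ^ Suc i)"
proof -
  have g: "(1 - fps_X :: complex fps) ^ 2 = 1 - fps_const 2 * fps_X + fps_X ^ 2"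
    by (simp add: power2_eq_square algebra_simps numeral_fps_const)
  have "trunc_det n (ent (fold_mat (fps_const ((1 - fps_X) ^ 2)))) = (\<Prod>i<n. 1 - fps_X ^ Suc i)"
    unfolding g by (subst trunc_det_fold_mat_quadratic) (auto simp: fps_X_nth simp del: power_Suc)
  then show ?thesis
    using fdet_cong[of "(1 - fps_X) ^ 2", OF _ assms] by (simp add: euler_prod_def fps_nth_power_0)
qed

lemma fdet_linear:
  assumes "\<And>k. k \<ge> 2 \<Longrightarrow> fps_nth g k = 0" "fps_nth g 0 = 1"
  shows "fdet g = 1"
proof (rule fps_eqI_cong)
  fix b
  show "fps_cong b (fdet g) 1"
    using fdet_cong[OF assms(2) order.refl, of b] assms by (simp add: trunc_det_fold_mat_quadratic)
qed

lemma geo_mult: "(1 - fps_X) * geo = 1"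
  by (rule inverse_mult_eq_1') simp

text \<open>The index \<open>m\<close> stands for z = m - 1, for which z (z + 1) / 2 is
  \<open>m choose 2\<close>. Two consecutive values are carried along because the Toda relation is
  of second order.\<close>

lemma fdet_geo_power_aux:
  "fdet ((1 - fps_X) * geo ^ m) = euler_prod ^ (m choose 2) \<and>
   fdet ((1 - fps_X) * geo ^ Suc m) = euler_prod ^ (Suc m choose 2)"
proof -
  have base: "fdet (1 - fps_X) = 1" "fdet 1 = 1"
    by (auto intro!: fdet_linear simp: fps_X_nth)
  have nz: "euler_prod \<noteq> 0"
  proof
    assume "euler_prod = 0"
    then have "fps_nth (\<Prod>i<0. 1 - fps_X ^ Suc i) 0 = (0::complex)"
      using euler_prod_cong[of 0 0] unfolding fps_cong_def by (metis fps_zero_nth le_refl)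
    then show False by simp
  qed
  have toda0: "(1 - fps_X) ^ 2 * geo = 1 - fps_X" "(1 - fps_X) * geo = 1"
    using geo_mult by (simp_all add: power2_eq_square mult.assoc)
  \<comment> \<open>At z = -2, -1, 0 all three determinants are known, so this instance of the
    relation determines its constant.\<close>
  have "fdet ((1 - fps_X) ^ 2 * geo * geo) * fdet ((1 - fps_X) ^ 2) = fdet ((1 - fps_X) ^ 2 * geo) ^ 2 * idet (commutator_mat geo)"
    by (rule fdet_toda) (simp add: fps_nth_power_0)
  then have Z: "idet (commutator_mat geo) = euler_prod"
    unfolding toda0 by (simp add: base euler_prod_def)
  show ?thesis
  proof (induction m)
    case 0
    show ?case by (simp add: base geo_mult numeral_2_eq_2)
  next
    case (Suc m)
    have e: "(1 - fps_X) * geo ^ Suc k = (1 - fps_X) * geo ^ k * geo" for k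
      by (simp add: mult_ac)
    have ch: "(Suc (Suc m) choose 2) + (m choose 2) = 2 * (Suc m choose 2) + 1"
      by (simp add: numeral_2_eq_2)
    have "fdet ((1 - fps_X) * geo ^ m * geo * geo) * fdet ((1 - fps_X) * geo ^ m) =
        fdet ((1 - fps_X) * geo ^ m * geo) ^ 2 * idet (commutator_mat geo)"
      by (rule fdet_toda) (simp add: fps_nth_power_0)
    then have "fdet ((1 - fps_X) * geo ^ Suc (Suc m)) * euler_prod ^ (m choose 2) =
        (euler_prod ^ (Suc m choose 2)) ^ 2 * euler_prod"
      using Suc unfolding e by (simp add: Z)
    also have "\<dots> = euler_prod ^ (Suc (Suc m) choose 2) * euler_prod ^ (m choose 2)"
      unfolding power_add[symmetric] ch by (simp add: power_add mult_ac flip: power_mult)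
    finally show ?case
      using Suc nz by simp
  qed
qed

lemma fdet_geo_power: "fdet (geo ^ k) = euler_prod ^ (Suc k choose 2)"
proof -
  have "(1 - fps_X) * geo ^ Suc k = geo ^ k"
    by (simp only: power_Suc mult.assoc[symmetric] geo_mult mult_1_left)
  then show ?thesis
    using fdet_geo_power_aux[of k] by (simp only:)
qed

subsection \<open>Vandermonde expansion\<close>

text \<open>Powers are expanded in the Newton basis \<open>N\<close>, which is lower triangular with
  the required products on its diagonal. The transition matrix \<open>U\<close> is unitriangular;
  its recursion is y N_l = N_(l+1) + y_l N_l.\<close>

lemma trunc_det_vandermonde:
  fixes y :: "nat \<Rightarrow> 'a::idom"
  shows "trunc_det n (\<lambda>i k. y i ^ k) = (\<Prod>j<n. \<Prod>i<j. y j - y i)"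
proof -
  define N where "N i l = (\<Prod>m<l. y i - y m)" for i l
  define U where "U = rec_nat (\<lambda>l. if l = 0 then 1 else 0)
    (\<lambda>k u l. (if l = 0 then 0 else u (l - 1)) + y l * u l)"
  have U0: "U 0 l = (if l = 0 then 1 else 0)"
    and US: "U (Suc k) l = (if l = 0 then 0 else U k (l - 1)) + y l * U k l" for k l
    by (simp_all add: U_def)
  have U_upper: "U k l = 0" if "k < l" for k l
    using that by (induction k arbitrary: l) (auto simp: U0 US)
  have U_diag: "U k k = 1" for k
    by (induction k) (auto simp: U0 US U_upper)
  have *: "(\<Sum>l<Suc k. N i l * U k l) = y i ^ k" for i k
  proof (induction k)
    case (Suc k)
    have "(\<Sum>l<Suc (Suc k). N i l * U (Suc k) l) =
        (\<Sum>l<Suc k. N i (Suc l) * U k l) + (\<Sum>l<Suc (Suc k). N i l * (y l * U k l))"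
      unfolding US by (subst (1) sum.lessThan_Suc_shift)
        (simp add: sum.lessThan_Suc_shift[of _ "Suc k"] algebra_simps sum.distrib del: sum.lessThan_Suc)
    also have "(\<Sum>l<Suc (Suc k). N i l * (y l * U k l)) = (\<Sum>l<Suc k. N i l * (y l * U k l))"
      by (simp add: U_upper)
    also have "(\<Sum>l<Suc k. N i (Suc l) * U k l) + \<dots> = (\<Sum>l<Suc k. y i * (N i l * U k l))"
      unfolding sum.distrib[symmetric] by (rule sum.cong) (auto simp: N_def algebra_simps)
    also have "\<dots> = y i ^ Suc k"
      by (simp add: Suc.IH flip: sum_distrib_left del: sum.lessThan_Suc)
    finally show ?case .
  qed (auto simp: N_def U0)
  have "trunc_det n (\<lambda>i k. y i ^ k) = trunc_det n (\<lambda>i k. \<Sum>l<n. N i l * U k l)"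
  proof (rule trunc_det_cong)
    fix i k assume "k < n"
    have "(\<Sum>l<n. N i l * U k l) = (\<Sum>l<Suc k. N i l * U k l)"
      by (rule sum.mono_neutral_right) (use \<open>k < n\<close> in \<open>auto simp: U_upper\<close>)
    then show "y i ^ k = (\<Sum>l<n. N i l * U k l)"
      by (simp only: *)
  qed
  also have "\<dots> = trunc_det n N * trunc_det n (\<lambda>l k. U k l)"
    by (rule trunc_det_mult)
  also have "trunc_det n (\<lambda>l k. U k l) = 1"
    by (subst trunc_det_upper) (auto simp: U_upper U_diag)
  also have "trunc_det n N = prod_list (diag_mat (mat n n (\<lambda>(i, j). N i j)))"
    unfolding trunc_det_def
    by (rule det_lower_triangular[of n]) (auto simp: N_def intro!: prod_zero)
  also have "diag_mat (mat n n (\<lambda>(i, j). N i j)) = map (\<lambda>i. N i i) [0..<n]"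
    by (auto simp: diag_mat_def)
  finally show ?thesis
    by (simp add: prod.distinct_set_conv_list[symmetric] lessThan_atLeast0 N_def)
qed

lemma trunc_det_mult_rows:
  fixes c :: "nat \<Rightarrow> 'a::comm_ring_1"
  shows "trunc_det n (\<lambda>i j. c i * A i j) = (\<Prod>i<n. c i) * trunc_det n A"
  by (simp add: trunc_det_altdef prod.distrib sum_distrib_left lessThan_atLeast0 mult_ac)

lemma trunc_det_diff_rows:
  fixes A B :: "nat \<Rightarrow> nat \<Rightarrow> 'a::comm_ring_1"
  shows "trunc_det n (\<lambda>i j. A i j - B i j) =
    (\<Sum>S\<in>Pow {..<n}. (- 1) ^ card S * trunc_det n (\<lambda>i j. if i \<in> S then B i j else A i j))"
proof -
  have "(\<Prod>i<n. A i (p i) - B i (p i)) =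
      (\<Sum>S\<in>Pow {..<n}. (- 1) ^ card S * (\<Prod>i<n. if i \<in> S then B i (p i) else A i (p i)))" for p
    unfolding prod_diff_conv_sum[OF finite_lessThan]
  proof (rule sum.cong)
    fix S assume "S \<in> Pow {..<n}"
    then have "{..<n} \<inter> {i. i \<in> S} = S" "{..<n} \<inter> - {i. i \<in> S} = {..<n} - S"
      by auto
    then show "(- 1) ^ card S * (\<Prod>x\<in>S. B x (p x)) * (\<Prod>x\<in>{..<n} - S. A x (p x)) =
        (- 1) ^ card S * (\<Prod>i<n. if i \<in> S then B i (p i) else A i (p i))"
      by (subst prod.If_cases) (simp_all add: mult.assoc)
  qed simp
  then show ?thesis
    unfolding trunc_det_altdef lessThan_atLeast0[symmetric]
    by (simp add: sum_distrib_left mult_ac) (rule sum.swap)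
qed

lemma trunc_det_fps_const:
  fixes A :: "nat \<Rightarrow> nat \<Rightarrow> 'a::comm_ring_1"
  shows "trunc_det n (\<lambda>i j. fps_const (A i j)) = fps_const (trunc_det n A)"
proof -
  have prod: "(\<Prod>i\<in>I. fps_const (f i)) = fps_const (\<Prod>i\<in>I. f i)" for f :: "nat \<Rightarrow> 'a" and I
    by (induction I rule: infinite_finite_induct) auto
  have "signof p * fps_const x = fps_const (signof p * x)" for p :: "nat \<Rightarrow> nat" and x :: 'a
    by (simp add: sign_def)
  then show ?thesis
    by (simp add: trunc_det_altdef prod fps_eq_iff fps_sum_nth)
qed

definition odd_vandermonde :: "nat \<Rightarrow> (nat \<Rightarrow> 'a::idom) \<Rightarrow> 'a" where
  "odd_vandermonde n v = (\<Prod>i<n. v i) * (\<Prod>j<n. \<Prod>i<j. v j ^ 2 - v i ^ 2)"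

lemma trunc_det_odd_powers: "trunc_det n (\<lambda>i k. v i ^ (2 * k + 1)) = odd_vandermonde n v"
proof -
  have "v i ^ (2 * k + 1) = v i * (v i ^ 2) ^ k" for i k
    by (simp add: power_mult)
  then show ?thesis
    by (simp only: trunc_det_mult_rows trunc_det_vandermonde odd_vandermonde_def)
qed

section \<open>Odd interpolation of the matrix entries at z = 2 n\<close>

lemma odd_poly_expand:
  fixes p :: "complex poly"
  assumes "degree p < 2 * n" "\<And>v. poly p (- v) = - poly p v"
  shows "poly p v = (\<Sum>k<n. coeff p (2 * k + 1) * v ^ (2 * k + 1))"
proof -
  have "pcompose p [:0, -1:] = - p"
    by (rule poly_eq_poly_eq_iff[THEN iffD1], rule ext) (simp add: poly_pcompose assms(2))
  then have "(- 1) ^ i * coeff p i = - coeff p i" for i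
    by (metis coeff_minus coeff_pcompose_linear)
  from this[of "2 * k" for k] have even: "coeff p (2 * k) = 0" for k
    by simp
  have "(\<Sum>i<2 * n. f i) = (\<Sum>k<n. f (2 * k) + f (2 * k + 1))" for f :: "nat \<Rightarrow> complex"
    by (induction n) (auto simp: algebra_simps)
  note split = this
  have "poly p v = (\<Sum>i\<le>degree p. coeff p i * v ^ i)"
    by (rule poly_altdef)
  also have "\<dots> = (\<Sum>i<2 * n. coeff p i * v ^ i)"
    by (rule sum.mono_neutral_left) (use assms(1) in \<open>auto simp: coeff_eq_0\<close>)
  finally show ?thesis
    by (simp add: split even)
qed

lemma fps_nth_geo: "fps_nth geo k = 1"
proof -
  have "inverse (inverse (Abs_fps (\<lambda>_. 1 :: complex))) = Abs_fps (\<lambda>_. 1)"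
    by (rule fps_inverse_idempotent) simp
  then show ?thesis
    by (simp add: fps_inverse_gp')
qed

lemma fps_nth_geo_power: "fps_nth (geo ^ Suc m) k = of_nat ((k + m) choose m)"
proof (induction m arbitrary: k)
  case 0
  show ?case by (simp add: fps_nth_geo)
next
  case (Suc m)
  have "fps_nth (geo ^ Suc (Suc m)) k = (\<Sum>i\<le>k. of_nat ((i + m) choose m))"
    unfolding power_Suc2[of _ "Suc m"] fps_mult_nth Suc fps_nth_geo by (simp add: atLeast0AtMost)
  also have "\<dots> = of_nat ((k + Suc m) choose Suc m)"
    using choose_rising_sum(1)[of m k] by (simp add: add.commute flip: of_nat_sum)
  finally show ?case .
qed

text \<open>Interpolates the coefficients of \<open>1 / (1 - X)^(2 n)\<close>, shifted so as to be odd.\<close>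

definition hpoly :: "nat \<Rightarrow> complex poly" where
  "hpoly n = Polynomial.smult (1 / fact (2 * n - 1)) (\<Prod>i<2 * n - 1. [:of_nat n - 1 - of_nat i, 1:])"

lemma poly_hpoly:
  "poly (hpoly n) v = (v + of_nat n - 1) gchoose (2 * n - 1)"
  by (simp add: hpoly_def poly_prod gbinomial_prod_rev lessThan_atLeast0 algebra_simps)

lemma degree_hpoly: "n \<ge> 1 \<Longrightarrow> degree (hpoly n) < 2 * n"
  by (simp add: hpoly_def degree_prod_eq_sum_degree)

lemma poly_hpoly_minus:
  assumes "n \<ge> 1"
  shows "poly (hpoly n) (- v) = - poly (hpoly n) v"
proof -
  have "(\<Prod>i<2 * n - 1. - v + of_nat n - 1 - of_nat i) = (\<Prod>i<2 * n - 1. - (v + of_nat n - 1 - of_nat (2 * n - 1 - Suc i)))"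
    by (rule prod.cong) (auto simp: of_nat_diff algebra_simps)
  also have "\<dots> = (- 1) ^ (2 * n - 1) * (\<Prod>i<2 * n - 1. v + of_nat n - 1 - of_nat (2 * n - 1 - Suc i))"
    by (simp only: prod_uminus card_lessThan)
  also have "(\<Prod>i<2 * n - 1. v + of_nat n - 1 - of_nat (2 * n - 1 - Suc i)) = (\<Prod>i<2 * n - 1. v + of_nat n - 1 - of_nat i)"
    by (rule prod.nat_diff_reindex)
  also have "(- 1 :: complex) ^ (2 * n - 1) = - 1"
    using assms by (simp add: uminus_power_if)
  finally show ?thesis
    by (simp add: hpoly_def poly_prod algebra_simps)
qed

text \<open>The coefficient of w^m is \<open>(m + 2 * n - 1) choose (2 * n - 1)\<close>. As a
  polynomial in \<open>m\<close> this vanishes for -2 n < m < 0, like the coefficients there.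
  Entries with i, j < n use no smaller index.\<close>

lemma wcoeff_geo_power:
  assumes "n \<ge> 1" "m > - 2 * int n"
  shows "wcoeff (fps_const (geo ^ (2 * n))) m = fps_const (poly (hpoly n) (of_int m + of_nat n))"
proof -
  obtain l where l: "2 * n = Suc l" "2 * n - 1 = l"
    using assms(1) by (cases "2 * n") auto
  show ?thesis
  proof (cases "m \<ge> 0")
    case True
    then obtain k where k: "m = int k"
      using zero_le_imp_eq_int by blast
    have "of_nat (2 * n) = (of_nat (Suc l) :: complex)"
      using l(1) by (simp only:)
    then have eq: "of_nat k + of_nat n + of_nat n - 1 = (of_nat (k + l) :: complex)"
      by simp
    have "poly (hpoly n) (of_int m + of_nat n) = of_nat (k + l) gchoose l"
      by (simp only: poly_hpoly k of_int_of_nat_eq l(2) eq)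
    then show ?thesis
      using True by (simp only: k wcoeff_fps_const l(1) fps_nth_geo_power nat_int if_True binomial_gbinomial)
  next
    case False
    define k where "k = nat (m + 2 * int n - 1)"
    have "of_int m + of_nat n + of_nat n - 1 = (of_int (int k) :: complex)"
      using assms(2) by (simp add: k_def)
    moreover have "k < 2 * n - 1"
      using False assms by (auto simp: k_def)
    ultimately show ?thesis
      using False by (simp add: wcoeff_fps_const poly_hpoly binomial_eq_0 flip: binomial_gbinomial)
  qed
qed

text \<open>One odd polynomial for each column: its value at n - i gives the unreflected part of the
  entry in row i, its value at n + i + 2 the reflected part.\<close>

definition rpoly :: "nat \<Rightarrow> nat \<Rightarrow> complex poly" where
  "rpoly n j = pcompose (hpoly n) [:of_nat j, 1:] + (if j = 0 then 0 else pcompose (hpoly n) [:- of_nat j, 1:])"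

lemma poly_rpoly:
  "poly (rpoly n j) v = poly (hpoly n) (v + of_nat j) + (if j = 0 then 0 else poly (hpoly n) (v - of_nat j))"
  by (simp add: rpoly_def poly_pcompose algebra_simps)

lemma degree_rpoly: "n \<ge> 1 \<Longrightarrow> degree (rpoly n j) < 2 * n"
  unfolding rpoly_def using degree_hpoly[of n]
  by (auto intro!: degree_add_less simp: degree_pcompose)

lemma poly_rpoly_minus:
  assumes "n \<ge> 1"
  shows "poly (rpoly n j) (- v) = - poly (rpoly n j) v"
proof -
  have e: "- v + of_nat j = - (v - of_nat j)" "- v - of_nat j = - (v + of_nat j)"
    by auto
  show ?thesis
    unfolding poly_rpoly e poly_hpoly_minus[OF assms] by simp
qed

lemma ent_fold_mat_geo_power:
  assumes "n \<ge> 1" "i < n" "j < n"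
  shows "ent (fold_mat (fps_const (geo ^ (2 * n)))) i j =
    fps_const (poly (rpoly n j) (of_nat n - of_nat i)) -
    fps_X ^ Suc i * fps_const (poly (rpoly n j) (of_nat n + of_nat i + 2))"
proof -
  have "odd_coeff i (1 + s) (fps_const (geo ^ (2 * n))) =
      fps_const (poly (hpoly n) (of_nat n - of_nat i + of_int s)) -
      fps_X ^ Suc i * fps_const (poly (hpoly n) (of_nat n + of_nat i + 2 + of_int s))"
    if "\<bar>s\<bar> \<le> int j" for s
    unfolding odd_coeff_def using that assms by (subst (1 2) wcoeff_geo_power) (auto simp: algebra_simps simp del: power_Suc)
  from this[of "int j"] this[of "- int j"] show ?thesis
    by (auto simp: ent_fold_mat poly_rpoly algebra_simps simp del: power_Suc simp flip: fps_const_add)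
qed

text \<open>Row \<open>i\<close> belongs to the part \<open>a = i + 1\<close>, which moves the exponent \<open>n + 1 - a\<close> to \<open>n + 1 + a\<close>.\<close>

definition swap_pos :: "nat \<Rightarrow> nat set \<Rightarrow> nat \<Rightarrow> complex" where
  "swap_pos n S i = (if i \<in> S then of_nat n + of_nat i + 2 else of_nat n - of_nat i)"

text \<open>Expanding the column polynomials in odd powers factors the matrix into rows of odd
  powers and a constant matrix \<open>C\<close>. Without the reflected terms the product is
  unitriangular, so the determinant of \<open>C\<close> is the inverse of the unmoved Vandermonde
  product, which is thereby nonzero.\<close>

lemma trunc_det_fold_mat_geo_power:
  assumes "n \<ge> 1"
  shows "trunc_det n (ent (fold_mat (fps_const (geo ^ (2 * n))))) =
    (\<Sum>S\<in>Pow {..<n}. (- 1) ^ card S * fps_X ^ (\<Sum>i\<in>S. Suc i) *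
      fps_const (odd_vandermonde n (swap_pos n S) / odd_vandermonde n (swap_pos n {})))"
    and "odd_vandermonde n (swap_pos n {}) \<noteq> 0"
proof -
  define C where "C k j = coeff (rpoly n j) (2 * k + 1)" for k j
  have expand: "poly (rpoly n j) v = (\<Sum>k<n. v ^ (2 * k + 1) * C k j)" for j v
    using odd_poly_expand[OF degree_rpoly poly_rpoly_minus, OF assms assms] by (simp add: C_def mult.commute)
  define a b where "a i k = (of_nat n - of_nat i :: complex) ^ (2 * k + 1)"
    and "b i k = (of_nat n + of_nat i + 2 :: complex) ^ (2 * k + 1)" for i k :: nat
  have "odd_vandermonde n (swap_pos n {}) * trunc_det n C = trunc_det n (\<lambda>i j. poly (rpoly n j) (of_nat n - of_nat i))"
    unfolding expand trunc_det_mult by (simp add: swap_pos_def flip: trunc_det_odd_powers)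
  also have "\<dots> = 1"
  proof -
    have p: "fps_const (poly (hpoly n) (of_nat n - of_nat i + of_int s)) = wcoeff (fps_const (geo ^ (2 * n))) (s - int i)"
      if "i < n" "\<bar>s\<bar> < int n" for i s
      using that assms by (subst wcoeff_geo_power) (auto simp: algebra_simps)
    have r: "fps_const (poly (rpoly n j) (of_nat n - of_nat i)) = wcoeff (fps_const (geo ^ (2 * n))) (int j - int i)"
      if "i < n" "j < n" for i j
      using p[of i "int j"] p[of i "- int j"] that
      by (auto simp: poly_rpoly wcoeff_fps_const simp flip: fps_const_add)
    have r1: "poly (rpoly n j) (of_nat n - of_nat i) = (if j = i then 1 else 0)" if "i < n" "j \<le> i" for i j
    proof -
      have "fps_nth (fps_const (poly (rpoly n j) (of_nat n - of_nat i))) 0 = (if j = i then 1 else 0)"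
        using that by (subst r) (auto simp: wcoeff_fps_const fps_nth_power_0)
      then show ?thesis by simp
    qed
    then show ?thesis
      by (subst trunc_det_upper) auto
  qed
  finally have det: "odd_vandermonde n (swap_pos n {}) * trunc_det n C = 1" .
  then show nz: "odd_vandermonde n (swap_pos n {}) \<noteq> 0"
    by auto
  have "trunc_det n (ent (fold_mat (fps_const (geo ^ (2 * n))))) =
      trunc_det n (\<lambda>i j. \<Sum>k<n. (fps_const (a i k) - fps_X ^ Suc i * fps_const (b i k)) * fps_const (C k j))"
  proof (rule trunc_det_cong)
    have "fps_const (\<Sum>k<m. f k) = (\<Sum>k<m. fps_const (f k))" for f :: "nat \<Rightarrow> complex" and m :: nat
      by (induction m) (auto simp flip: fps_const_add)
    then show "ent (fold_mat (fps_const (geo ^ (2 * n)))) i j =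
        (\<Sum>k<n. (fps_const (a i k) - fps_X ^ Suc i * fps_const (b i k)) * fps_const (C k j))"
      if "i < n" "j < n" for i j
      unfolding ent_fold_mat_geo_power[OF assms that] expand a_def b_def
      by (simp add: left_diff_distrib sum_subtractf sum_distrib_left mult.assoc del: power_Suc flip: fps_const_mult)
  qed
  also have "\<dots> = trunc_det n (\<lambda>i k. fps_const (a i k) - fps_X ^ Suc i * fps_const (b i k)) * fps_const (trunc_det n C)"
    by (simp only: trunc_det_mult trunc_det_fps_const)
  also have "trunc_det n (\<lambda>i k. fps_const (a i k) - fps_X ^ Suc i * fps_const (b i k)) =
      (\<Sum>S\<in>Pow {..<n}. (- 1) ^ card S * (fps_X ^ (\<Sum>i\<in>S. Suc i) * fps_const (odd_vandermonde n (swap_pos n S))))"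
    unfolding trunc_det_diff_rows
  proof (rule sum.cong)
    fix S assume S: "S \<in> Pow {..<n}"
    have "trunc_det n (\<lambda>i j. if i \<in> S then fps_X ^ Suc i * fps_const (b i j) else fps_const (a i j)) =
        trunc_det n (\<lambda>i j. (if i \<in> S then fps_X ^ Suc i else 1) * fps_const (swap_pos n S i ^ (2 * j + 1)))"
      by (rule trunc_det_cong) (auto simp: swap_pos_def a_def b_def)
    also have "\<dots> = (\<Prod>i<n. if i \<in> S then fps_X ^ Suc i else 1) * fps_const (odd_vandermonde n (swap_pos n S))"
      by (simp only: trunc_det_mult_rows trunc_det_fps_const trunc_det_odd_powers)
    also have "(\<Prod>i<n. if i \<in> S then fps_X ^ Suc i else (1 :: complex fps)) = (\<Prod>i\<in>S. fps_X ^ Suc i)"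
      by (rule prod.mono_neutral_cong_right) (use S in auto)
    also have "\<dots> = fps_X ^ (\<Sum>i\<in>S. Suc i)"
      by (rule power_sum[symmetric])
    finally show "(- 1) ^ card S * trunc_det n (\<lambda>i j. if i \<in> S then fps_X ^ Suc i * fps_const (b i j) else fps_const (a i j)) =
        (- 1) ^ card S * (fps_X ^ (\<Sum>i\<in>S. Suc i) * fps_const (odd_vandermonde n (swap_pos n S)))"
      by simp
  qed simp
  also have "trunc_det n C = inverse (odd_vandermonde n (swap_pos n {}))"
    using det by (simp add: inverse_unique)
  finally show "trunc_det n (ent (fold_mat (fps_const (geo ^ (2 * n))))) =
    (\<Sum>S\<in>Pow {..<n}. (- 1) ^ card S * fps_X ^ (\<Sum>i\<in>S. Suc i) *
      fps_const (odd_vandermonde n (swap_pos n S) / odd_vandermonde n (swap_pos n {})))"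
    by (simp add: sum_distrib_right divide_inverse mult.assoc del: power_Suc sum.lessThan_Suc)
qed

subsection \<open>Hook lengths of doubled distinct partitions\<close>

lemma downset_eq_atLeastAtMost:
  fixes D :: "nat set"
  assumes "finite D" "0 \<notin> D" "\<And>i j. j \<in> D \<Longrightarrow> 1 \<le> i \<Longrightarrow> i \<le> j \<Longrightarrow> i \<in> D"
  shows "D = {1..card D}"
proof (cases "D = {}")
  case False
  have "D = {1..Max D}"
  proof (intro subset_antisym subsetI)
    fix i assume "i \<in> D"
    then show "i \<in> {1..Max D}"
      using assms(1,2) by (cases i) auto
  next
    fix i assume "i \<in> {1..Max D}"
    then show "i \<in> D"
      using assms(3)[of "Max D" i] Max_in[OF assms(1) False] by auto
  qed
  then show ?thesis
    by (metis card_atLeastAtMost diff_Suc_1)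
qed auto

lemma part_antimono:
  assumes "is_partition l" "1 \<le> i" "i \<le> i'"
  shows "part l i' \<le> part l i"
proof (cases "i = i' \<or> i' > length l")
  case False
  then have "i - 1 < i' - 1" "i' - 1 < length l"
    using assms by auto
  then show ?thesis
    using assms sorted_wrt_nth_less[of "(\<ge>)" l "i - 1" "i' - 1"] by (auto simp: is_partition_def part_def)
qed (auto simp: part_def)

lemma part_pos_iff:
  assumes "is_partition l" "1 \<le> i"
  shows "part l i > 0 \<longleftrightarrow> i \<le> length l"
  using assms by (auto simp: part_def is_partition_def)

lemma diagram_iff: "(i, j) \<in> diagram l \<longleftrightarrow> 1 \<le> i \<and> 1 \<le> j \<and> j \<le> part l i"
  by (auto simp: diagram_def part_def)

lemma finite_diagram: "finite (diagram l)"
proof (rule finite_subset)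
  show "diagram l \<subseteq> (SIGMA i:{1..length l}. {1..part l i})"
    by (auto simp: diagram_def)
qed simp

abbreviation cpart :: "nat list \<Rightarrow> nat \<Rightarrow> nat" where
  "cpart l j \<equiv> part (Defs.conjugate l) j"

lemma le_cpart_iff:
  assumes "is_partition l" "1 \<le> i" "1 \<le> j"
  shows "i \<le> cpart l j \<longleftrightarrow> j \<le> part l i"
proof -
  define D where "D = {i. (i, j) \<in> diagram l}"
  have "D = {1..card D}"
  proof (rule downset_eq_atLeastAtMost)
    show "finite D"
      using finite_imageI[OF finite_diagram[of l], of fst] by (rule finite_subset[rotated]) (force simp: D_def)
  qed (use part_antimono[OF assms(1)] in \<open>auto simp: D_def diagram_iff intro: le_trans\<close>)
  moreover have "cpart l j = card D"
  proof -
    have len: "length (Defs.conjugate l) = part l 1"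
      by (simp add: Defs.conjugate_def)
    show ?thesis
    proof (cases "j \<le> part l 1")
      case True
      then have "[1..<Suc (part l 1)] ! (j - 1) = j"
        using assms by (subst nth_upt) auto
      then have "Defs.conjugate l ! (j - 1) = card D"
        using assms True by (simp add: Defs.conjugate_def D_def del: upt_Suc)
      then show ?thesis
        using True len assms by (simp add: part_def[of "Defs.conjugate l"])
    next
      case False
      then have "D = {}"
        using part_antimono[OF assms(1), of 1] by (fastforce simp: D_def diagram_iff)
      then show ?thesis
        using False len by (simp add: part_def[of "Defs.conjugate l"])
    qed
  qed
  ultimately have "i \<le> cpart l j \<longleftrightarrow> i \<in> D"
    using assms(2) by (metis atLeastAtMost_iff)
  then show ?thesis
    using assms by (simp add: D_def diagram_iff)
qed

lemma le_durfee_iff: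
  assumes "is_partition l" "1 \<le> i"
  shows "i \<le> durfee l \<longleftrightarrow> i \<le> part l i"
proof -
  define D where "D = {i. 1 \<le> i \<and> i \<le> part l i}"
  have "D = {1..card D}"
  proof (rule downset_eq_atLeastAtMost)
    show "finite D"
      by (rule finite_subset[of _ "{..length l}"]) (auto simp: D_def part_def split: if_splits)
  qed (use part_antimono[OF assms(1)] in \<open>auto simp: D_def intro: le_trans\<close>)
  then have "i \<le> card D \<longleftrightarrow> i \<in> D"
    using assms(2) by (metis atLeastAtMost_iff)
  then show ?thesis
    using assms by (simp add: durfee_def D_def)
qed

lemma nat_eqI_le: "(\<And>m. 1 \<le> m \<Longrightarrow> m \<le> a \<longleftrightarrow> m \<le> b) \<Longrightarrow> a = (b :: nat)"
  by (metis le_antisym le_refl less_one not_less zero_le)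

text \<open>Removes the existential quantifiers: the witnesses must be \<open>durfee l\<close> and
  \<open>part l i - i\<close>, and the latter decrease strictly since the parts decrease
  weakly.\<close>

lemma DD_iff:
  "l \<in> DD \<longleftrightarrow> is_partition l \<and> (\<forall>i\<in>{1..durfee l}. i < part l i \<and> cpart l i + 1 = part l i)"
proof
  assume l: "l \<in> DD"
  show "is_partition l \<and> (\<forall>i\<in>{1..durfee l}. i < part l i \<and> cpart l i + 1 = part l i)"
  proof (cases "l = []")
    case True
    then show ?thesis by (simp add: is_partition_def durfee_def part_def)
  next
    case False
    then obtain a where a: "strict_antimono_on {1..durfee l} a" "a (durfee l) \<ge> (1::nat)"
      "\<forall>i\<in>{1..durfee l}. int (part l i) - int i = int (a i) \<and> int (cpart l i) - int i = int (a i) - 1"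
      using l by (auto simp: DD_def)
    have "a i \<ge> 1" if "i \<in> {1..durfee l}" for i
      using monotone_onD[OF a(1), of i "durfee l"] a(2) that by (cases "i = durfee l") auto
    then have "i < part l i \<and> cpart l i + 1 = part l i" if "i \<in> {1..durfee l}" for i
      using a(3) that by fastforce
    then show ?thesis
      using l by (simp add: DD_def)
  qed
next
  assume l: "is_partition l \<and> (\<forall>i\<in>{1..durfee l}. i < part l i \<and> cpart l i + 1 = part l i)"
  show "l \<in> DD"
  proof (cases "l = []")
    case False
    have d: "durfee l \<ge> 1"
      using False l le_durfee_iff[of l 1] part_pos_iff[of l 1] by (simp add: Suc_le_eq)
    have "strict_antimono_on {1..durfee l} (\<lambda>i. part l i - i)"
    proof (rule monotone_onI)
      fix i j assume ij: "i \<in> {1..durfee l}" "j \<in> {1..durfee l}" "i < j"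
      then show "part l i - i > part l j - j"
        using l part_antimono[of l i j] by fastforce
    qed
    moreover have "durfee l < part l (durfee l)"
      using l d by (metis atLeastAtMost_iff le_refl)
    then have "part l (durfee l) - durfee l \<ge> 1"
      by simp
    ultimately show ?thesis
      unfolding DD_def using l d
      by (intro CollectI conjI disjI2 exI[of _ "durfee l"] exI[of _ "\<lambda>i. part l i - i"]) force+
  qed (simp add: DD_def is_partition_def)
qed

text \<open>For a doubled distinct partition these are the parts of the strict partition that is
  doubled. As a set they match the subsets of rows in the expansion of the determinant.\<close>

definition frob :: "nat list \<Rightarrow> nat set" where
  "frob l = (\<lambda>i. part l i - i) ` {1..durfee l}"

lemma DD_part:
  assumes "l \<in> DD" "i \<in> {1..durfee l}"
  shows "part l i = (part l i - i) + i" "cpart l i = (part l i - i) + i - 1" "part l i - i \<ge> 1" "part l i > durfee l" "cpart l i \<ge> durfee l"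
proof -
  have l: "is_partition l" "i < part l i" "cpart l i + 1 = part l i"
    using assms by (auto simp: DD_iff)
  have "durfee l \<in> {1..durfee l}"
    using assms(2) by auto
  then have "durfee l < part l (durfee l)"
    using assms(1) by (auto simp: DD_iff)
  also have "\<dots> \<le> part l i"
    using assms(2) part_antimono[OF l(1)] by auto
  finally show "part l i > durfee l" .
  with l show "part l i = (part l i - i) + i" "cpart l i = (part l i - i) + i - 1" "part l i - i \<ge> 1" "cpart l i \<ge> durfee l"
    by auto
qed

lemma DD_strict:
  assumes "l \<in> DD" "1 \<le> i" "i < j" "j \<le> durfee l"
  shows "part l j - j < part l i - i"
  using part_antimono[of l i j] DD_part[OF assms(1), of i] DD_part[OF assms(1), of j] assms
  by (auto simp: DD_iff)

lemma frob_inj: "l \<in> DD \<Longrightarrow> inj_on (\<lambda>i. part l i - i) {1..durfee l}"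
  by (rule linorder_inj_onI) (use DD_strict in \<open>fastforce+\<close>)

lemma finite_frob: "finite (frob l)"
  by (simp add: frob_def)

lemma zero_notin_frob: "l \<in> DD \<Longrightarrow> 0 \<notin> frob l"
  using DD_part(3)[of l] by (fastforce simp: frob_def)

lemma card_frob:
  assumes "l \<in> DD"
  shows "card (frob l) = durfee l"
  unfolding frob_def card_image[OF frob_inj[OF assms]] by simp

lemma frob_less:
  assumes "l \<in> DD" "i \<in> {1..durfee l}"
  shows "{b \<in> frob l. b < part l i - i} = (\<lambda>i. part l i - i) ` {i<..durfee l}"
proof -
  have "i < k" if "k \<in> {1..durfee l}" "part l k - k < part l i - i" for k
    using that assms DD_strict[OF assms(1), of k i] by (cases k i rule: linorder_cases) auto
  then show ?thesis
    using assms DD_strict[OF assms(1), of i] by (auto simp: frob_def)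
qed

lemma card_frob_less:
  assumes "l \<in> DD" "i \<in> {1..durfee l}"
  shows "card {b \<in> frob l. b < part l i - i} = durfee l - i"
proof -
  have "inj_on (\<lambda>i. part l i - i) {i<..durfee l}"
    by (rule inj_on_subset[OF frob_inj[OF assms(1)]]) auto
  then show ?thesis
    unfolding frob_less[OF assms] by (simp add: card_image)
qed

lemma diagram_split:
  assumes "l \<in> DD"
  defines "d \<equiv> durfee l"
  shows "diagram l = {1..d} \<times> {1..d} \<union> (SIGMA i:{1..d}. {d<..part l i}) \<union>
    (\<lambda>(j, i). (i, j)) ` (SIGMA j:{1..d}. {d<..cpart l j})"
proof -
  have l: "is_partition l"
    using assms by (simp add: DD_iff)
  have in_iff: "(i, j) \<in> (\<lambda>(j, i). (i, j)) ` (SIGMA j:{1..d}. {d<..cpart l j}) \<longleftrightarrow> j \<in> {1..d} \<and> i \<in> {d<..cpart l j}" for i j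
    by force
  have *: "j \<le> part l i \<longleftrightarrow> (i \<le> d \<and> (j \<le> d \<or> j \<le> part l i)) \<or> (j \<le> d \<and> d < i \<and> i \<le> cpart l j)"
    if ij: "1 \<le> i" "1 \<le> j" for i j
  proof (cases "i \<le> d")
    case True
    then show ?thesis
      using DD_part(4)[OF assms(1), of i] ij by (auto simp: d_def)
  next
    case False
    then have "part l (Suc d) \<le> d"
      using le_durfee_iff[OF l, of "Suc d"] by (auto simp: d_def)
    moreover have "part l i \<le> part l (Suc d)"
      using False part_antimono[OF l, of "Suc d" i] by auto
    ultimately show ?thesis
      using False le_cpart_iff[OF l ij] by auto
  qed
  show ?thesis
  proof (rule Set.set_eqI)
    fix p :: "nat \<times> nat"
    obtain i j where p: "p = (i, j)"
      by (cases p)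
    show "p \<in> diagram l \<longleftrightarrow> p \<in> {1..d} \<times> {1..d} \<union> (SIGMA i:{1..d}. {d<..part l i}) \<union>
      (\<lambda>(j, i). (i, j)) ` (SIGMA j:{1..d}. {d<..cpart l j})"
      unfolding p Un_iff in_iff diagram_iff mem_Sigma_iff atLeastAtMost_iff greaterThanAtMost_iff
      using *[of i j] by linarith
  qed
qed

text \<open>Row and column data of a diagram are complementary: the numbers subtracted from
  \<open>a\<close> are distinct, avoid \<open>frob l\<close>, and are as many as the remaining
  candidates. The two ranges differ only in 0, since the arm of a diagonal box exceeds its leg by
  one; this is the unpaired hook \<open>a\<close> to the right of the square.\<close>

lemma DD_hooks_outside_square:
  assumes "l \<in> DD" "i \<in> {1..durfee l}"
  defines "d \<equiv> durfee l" and "a \<equiv> part l i - i"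
  shows "bij_betw (\<lambda>j. j - 1 - cpart l j) {d<..part l i} ({..<a} - frob l)"
    and "bij_betw (\<lambda>j. j - part l j) {d<..cpart l i} ({1..<a} - frob l)"
    and "j \<in> {d<..part l i} \<Longrightarrow> hook l i j = a - (j - 1 - cpart l j)"
    and "j \<in> {d<..cpart l i} \<Longrightarrow> hook l j i = a - (j - part l j)"
proof -
  have l: "is_partition l"
    using assms by (simp add: DD_iff)
  have i: "1 \<le> i" "i \<le> d"
    using assms by auto
  note P = DD_part[OF assms(1,2), folded d_def a_def]
  have big: "cpart l j \<le> d" "part l j \<le> d" if "d < j" for j
  proof -
    have "part l (Suc d) \<le> d"
      using le_durfee_iff[OF l, of "Suc d"] by (auto simp: d_def)
    then show "part l j \<le> d"
      using that part_antimono[OF l, of "Suc d" j] by auto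
    have "\<not> j \<le> part l (Suc d)"
      using \<open>part l (Suc d) \<le> d\<close> that by auto
    then show "cpart l j \<le> d"
      using that le_cpart_iff[OF l, of "Suc d" j] by auto
  qed
  have frobE: "\<exists>k\<in>{1..d}. b = part l k - k \<and> part l k = b + k \<and> cpart l k = b + k - 1 \<and> b \<ge> 1" if "b \<in> frob l" for b
    using that DD_part[OF assms(1)] by (fastforce simp: frob_def d_def)
  have less_a: "card ({..<a} \<inter> frob l) = d - i" "card ({1..<a} \<inter> frob l) = d - i"
  proof -
    have "{..<a} \<inter> frob l = {b \<in> frob l. b < a}" "{1..<a} \<inter> frob l = {b \<in> frob l. b < a}"
      using zero_notin_frob[OF assms(1)] by (auto simp: Suc_le_eq intro: gr0I)
    then show "card ({..<a} \<inter> frob l) = d - i" "card ({1..<a} \<inter> frob l) = d - i"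
      using card_frob_less[OF assms(1,2)] by (simp_all add: a_def d_def)
  qed
  have cj: "i \<le> cpart l j \<and> cpart l j \<le> d" if "j \<in> {d<..part l i}" for j
    using that le_cpart_iff[OF l, of i j] big[of j] i by auto
  have cj': "i \<le> part l j \<and> part l j \<le> d" if "j \<in> {d<..cpart l i}" for j
    using that le_cpart_iff[OF l, of j i] big[of j] i by auto
  show "j \<in> {d<..part l i} \<Longrightarrow> hook l i j = a - (j - 1 - cpart l j)"
    using cj[of j] P by (auto simp: hook_def)
  show "j \<in> {d<..cpart l i} \<Longrightarrow> hook l j i = a - (j - part l j)"
    using cj'[of j] P i by (auto simp: hook_def)
  show "bij_betw (\<lambda>j. j - 1 - cpart l j) {d<..part l i} ({..<a} - frob l)"
  proof -
    have inj: "inj_on (\<lambda>j. j - 1 - cpart l j) {d<..part l i}"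
    proof (rule linorder_inj_onI)
      fix j k assume jk: "j < k" "j \<in> {d<..part l i}" "k \<in> {d<..part l i}"
      have "cpart l k \<le> cpart l j"
        using jk le_cpart_iff[OF l, of "cpart l k" k] le_cpart_iff[OF l, of "cpart l k" j]
        by (cases "cpart l k = 0") auto
      then show "j - 1 - cpart l j \<noteq> k - 1 - cpart l k"
        using jk cj[of j] cj[of k] by auto
    qed auto
    have sub: "(\<lambda>j. j - 1 - cpart l j) ` {d<..part l i} \<subseteq> {..<a} - frob l"
    proof clarify
      fix j assume j: "j \<in> {d<..part l i}"
      have "j - 1 - cpart l j \<notin> frob l"
      proof
        assume "j - 1 - cpart l j \<in> frob l"
        then obtain k where k: "1 \<le> k" "part l k = j - 1 - cpart l j + k"
          using frobE by (metis atLeastAtMost_iff)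
        \<comment> \<open>If the box (k, j) belongs to the diagram, \<open>part l k - k\<close> is
          too large for this equation; otherwise it is too small.\<close>
        show False
        proof (cases "k \<le> cpart l j")
          case True
          then show ?thesis
            using k j cj[OF j] le_cpart_iff[OF l, of k j] by auto
        next
          case False
          then show ?thesis
            using k j cj[OF j] le_cpart_iff[OF l, of k j] by auto
        qed
      qed
      moreover have "j - 1 - cpart l j < a"
        using j cj[OF j] P by auto
      ultimately show "j - 1 - cpart l j \<in> {..<a} - frob l"
        by simp
    qed
    have "card ({..<a} - frob l) = a - (d - i)"
      by (subst card_Diff_subset_Int) (simp_all add: less_a)
    also have "\<dots> = card ((\<lambda>j. j - 1 - cpart l j) ` {d<..part l i})"
      unfolding card_image[OF inj] using P i by simp
    finally have "card ((\<lambda>j. j - 1 - cpart l j) ` {d<..part l i}) = card ({..<a} - frob l)"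
      by (rule sym)
    with sub have "(\<lambda>j. j - 1 - cpart l j) ` {d<..part l i} = {..<a} - frob l"
      by (intro card_subset_eq) simp_all
    with inj show ?thesis
      by (rule bij_betw_imageI)
  qed
  show "bij_betw (\<lambda>j. j - part l j) {d<..cpart l i} ({1..<a} - frob l)"
  proof -
    have inj: "inj_on (\<lambda>j. j - part l j) {d<..cpart l i}"
    proof (rule linorder_inj_onI)
      fix j k assume jk: "j < k" "j \<in> {d<..cpart l i}" "k \<in> {d<..cpart l i}"
      then have "part l k \<le> part l j"
        using part_antimono[OF l, of j k] by auto
      then show "j - part l j \<noteq> k - part l k"
        using jk cj'[of j] cj'[of k] by auto
    qed auto
    have sub: "(\<lambda>j. j - part l j) ` {d<..cpart l i} \<subseteq> {1..<a} - frob l"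
    proof clarify
      fix j assume j: "j \<in> {d<..cpart l i}"
      have "j - part l j \<notin> frob l"
      proof
        assume "j - part l j \<in> frob l"
        then obtain k where k: "1 \<le> k" "cpart l k = j - part l j + k - 1"
          using frobE by (metis atLeastAtMost_iff)
        show False
        proof (cases "k \<le> part l j")
          case True
          then show ?thesis
            using k j cj'[OF j] le_cpart_iff[OF l, of j k] by auto
        next
          case False
          then show ?thesis
            using k j cj'[OF j] le_cpart_iff[OF l, of j k] by auto
        qed
      qed
      moreover have "j - part l j < a" "1 \<le> j - part l j"
        using j cj'[OF j] P i by auto
      ultimately show "j - part l j \<in> {1..<a} - frob l"
        by simp
    qed
    have "card ({1..<a} - frob l) = a - 1 - (d - i)"
      by (subst card_Diff_subset_Int) (simp_all add: less_a(2)[simplified])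
    also have "\<dots> = card ((\<lambda>j. j - part l j) ` {d<..cpart l i})"
      unfolding card_image[OF inj] using P i by simp
    finally have "card ((\<lambda>j. j - part l j) ` {d<..cpart l i}) = card ({1..<a} - frob l)"
      by (rule sym)
    with sub have "(\<lambda>j. j - part l j) ` {d<..cpart l i} = {1..<a} - frob l"
      by (intro card_subset_eq) simp_all
    with inj show ?thesis
      by (rule bij_betw_imageI)
  qed
qed

section \<open>The hook product in terms of the strict partition\<close>

lemma prod_square_split:
  fixes g :: "nat \<Rightarrow> nat \<Rightarrow> 'a::comm_monoid_mult"
  shows "(\<Prod>i\<in>{1..d}. \<Prod>j\<in>{1..d}. g i j) = (\<Prod>i\<in>{1..d}. g i i * (\<Prod>j\<in>{i<..d}. g i j * g j i))"
proof (induction d)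
  case (Suc d)
  have 1: "{1..Suc d} = insert (Suc d) {1..d}"
    by auto
  have "(\<Prod>j\<in>{i<..Suc d}. g i j * g j i) = (\<Prod>j\<in>{i<..d}. g i j * g j i) * (g i (Suc d) * g (Suc d) i)"
    if "i \<in> {1..d}" for i
  proof -
    have "{i<..Suc d} = insert (Suc d) {i<..d}"
      using that by auto
    then show ?thesis by (simp add: mult.commute)
  qed
  then have "(\<Prod>i\<in>{1..d}. g i i * (\<Prod>j\<in>{i<..Suc d}. g i j * g j i)) =
      (\<Prod>i\<in>{1..d}. (g i i * (\<Prod>j\<in>{i<..d}. g i j * g j i)) * (g i (Suc d) * g (Suc d) i))"
    by (intro prod.cong) (simp_all only: mult.assoc)
  also have "\<dots> = (\<Prod>i\<in>{1..d}. \<Prod>j\<in>{1..d}. g i j) * ((\<Prod>i\<in>{1..d}. g i (Suc d)) * (\<Prod>i\<in>{1..d}. g (Suc d) i))"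
    unfolding Suc.IH prod.distrib[of "\<lambda>i. g i i * (\<Prod>j\<in>{i<..d}. g i j * g j i)"] by (simp only: prod.distrib)
  finally have "(\<Prod>i\<in>{1..d}. g i i * (\<Prod>j\<in>{i<..Suc d}. g i j * g j i)) = \<dots>" .
  moreover have "(\<Prod>i\<in>{1..d}. \<Prod>j\<in>{1..Suc d}. g i j) =
      (\<Prod>i\<in>{1..d}. g i (Suc d)) * (\<Prod>i\<in>{1..d}. \<Prod>j\<in>{1..d}. g i j)"
    unfolding 1 by (simp add: prod.distrib)
  moreover have "(\<Prod>i\<in>{1..Suc d}. h i) = h (Suc d) * (\<Prod>i\<in>{1..d}. h i)" for h :: "nat \<Rightarrow> 'a"
    unfolding 1 by simp
  ultimately show ?case
    by (simp add: mult_ac)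
qed simp

text \<open>The factor of \<open>a\<close> collects the diagonal hook 2 a, the unpaired hook a, and
  pairs of equal hooks of opposite sign: a + b inside the Durfee square for smaller elements b, a -
  b outside it for smaller non-elements b. Each pair contributes 1 - u^2 / h^2.\<close>

definition hookprod :: "nat set \<Rightarrow> complex \<Rightarrow> complex" where
  "hookprod S u = (\<Prod>a\<in>S. (1 - u / (2 * of_nat a)) * (1 - u / of_nat a) *
     ((\<Prod>b\<in>{b \<in> S. b < a}. 1 - u ^ 2 / (of_nat a + of_nat b) ^ 2) *
      (\<Prod>b\<in>{1..<a} - S. 1 - u ^ 2 / (of_nat a - of_nat b) ^ 2)))"

lemma one_minus_div_mult: "(1 - u / s) * (1 - u / (s * - 1)) = 1 - u ^ 2 / s ^ 2" for u s :: complex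
  by (simp add: algebra_simps power2_eq_square)

lemma prod_diagram:
  fixes f :: "nat \<times> nat \<Rightarrow> 'a::comm_monoid_mult"
  assumes "l \<in> DD"
  defines "d \<equiv> durfee l"
  shows "prod f (diagram l) = (\<Prod>i\<in>{1..d}. \<Prod>j\<in>{1..d}. f (i, j)) *
    (\<Prod>i\<in>{1..d}. \<Prod>j\<in>{d<..part l i}. f (i, j)) * (\<Prod>j\<in>{1..d}. \<Prod>i\<in>{d<..cpart l j}. f (i, j))"
proof -
  have inj: "inj_on (\<lambda>(j, i). (i, j)) (SIGMA j:{1..d}. {d<..cpart l j})"
    by (auto simp: inj_on_def)
  have "prod f (diagram l) = prod f ({1..d} \<times> {1..d}) * prod f (SIGMA i:{1..d}. {d<..part l i}) *
      prod f ((\<lambda>(j, i). (i, j)) ` (SIGMA j:{1..d}. {d<..cpart l j}))"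
    unfolding diagram_split[OF assms(1)] d_def[symmetric]
    by (subst prod.union_disjoint, auto)+
  also have "prod f ((\<lambda>(j, i). (i, j)) ` (SIGMA j:{1..d}. {d<..cpart l j})) =
      prod (\<lambda>(j, i). f (i, j)) (SIGMA j:{1..d}. {d<..cpart l j})"
    by (subst prod.reindex[OF inj]) (simp add: o_def case_prod_unfold)
  finally show ?thesis
    by (simp add: prod.cartesian_product prod.Sigma case_prod_unfold)
qed

lemma DD_hook_prod:
  assumes "l \<in> DD"
  shows "(\<Prod>(i, j)\<in>diagram l. 1 - u / (of_nat (hook l i j) * of_int (hook_sign i j))) = hookprod (frob l) u"
proof -
  define d where "d = durfee l"
  define a where "a i = part l i - i" for i
  define f where "f i j = 1 - u / (of_nat (hook l i j) * of_int (hook_sign i j))" for i j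
  have l: "is_partition l"
    using assms by (simp add: DD_iff)
  note P = DD_part[OF assms, folded a_def d_def]
  have square: "hook l i j = a i + a j" if "i \<in> {1..d}" "j \<in> {1..d}" for i j
    using P[OF that(1)] P[OF that(2)] that by (auto simp: hook_def)
  have frob: "frob l = a ` {1..d}" "inj_on a {1..d}"
    using frob_inj[OF assms] unfolding frob_def a_def[abs_def] d_def by auto
  have inside: "(\<Prod>i\<in>{1..d}. \<Prod>j\<in>{1..d}. f i j) =
      (\<Prod>i\<in>{1..d}. (1 - u / (2 * of_nat (a i))) * (\<Prod>b\<in>{b \<in> frob l. b < a i}. 1 - u ^ 2 / (of_nat (a i) + of_nat b) ^ 2))"
    unfolding prod_square_split
  proof (rule prod.cong)
    fix i assume i: "i \<in> {1..d}"
    have inj: "inj_on a {i<..d}"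
      by (rule inj_on_subset[OF frob(2)]) (use i in auto)
    have "(\<Prod>j\<in>{i<..d}. f i j * f j i) = (\<Prod>j\<in>{i<..d}. 1 - u ^ 2 / (of_nat (a i) + of_nat (a j)) ^ 2)"
    proof (rule prod.cong)
      fix j assume "j \<in> {i<..d}"
      then have j: "j \<in> {1..d}" "i < j"
        using i by auto
      have "f i j = 1 - u / (of_nat (a i) + of_nat (a j))" "f j i = 1 - u / ((of_nat (a i) + of_nat (a j)) * - 1)"
        using j(2) unfolding f_def square[OF i j(1)] square[OF j(1) i]
        by (simp_all add: hook_sign_def add.commute)
      then show "f i j * f j i = 1 - u ^ 2 / (of_nat (a i) + of_nat (a j)) ^ 2"
        by (simp only: one_minus_div_mult)
    qed simp
    also have "\<dots> = (\<Prod>b\<in>{b \<in> frob l. b < a i}. 1 - u ^ 2 / (of_nat (a i) + of_nat b) ^ 2)"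
    proof -
      have "{b \<in> frob l. b < a i} = a ` {i<..d}"
        using frob_less[OF assms, of i] i unfolding a_def[abs_def] d_def by simp
      then show ?thesis
        by (simp only: prod.reindex[OF inj] o_def)
    qed
    finally have "(\<Prod>j\<in>{i<..d}. f i j * f j i) = \<dots>" .
    moreover have "f i i = 1 - u / (2 * of_nat (a i))"
      unfolding f_def square[OF i i] by (simp add: hook_sign_def)
    ultimately show "f i i * (\<Prod>j\<in>{i<..d}. f i j * f j i) =
        (1 - u / (2 * of_nat (a i))) * (\<Prod>b\<in>{b \<in> frob l. b < a i}. 1 - u ^ 2 / (of_nat (a i) + of_nat b) ^ 2)"
      by (simp only:)
  qed simp
  have "(\<Prod>j\<in>{d<..part l i}. f i j) * (\<Prod>j\<in>{d<..cpart l i}. f j i) =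
      (1 - u / of_nat (a i)) * (\<Prod>b\<in>{1..<a i} - frob l. 1 - u ^ 2 / (of_nat (a i) - of_nat b) ^ 2)"
    if i: "i \<in> {1..d}" for i
  proof -
    note H = DD_hooks_outside_square[OF assms, of i, folded d_def, OF i, folded a_def]
    have "(\<Prod>j\<in>{d<..part l i}. f i j) = (\<Prod>j\<in>{d<..part l i}. 1 - u / of_nat (a i - (j - 1 - cpart l j)))"
      using i by (intro prod.cong) (auto simp: f_def H(3) hook_sign_def)
    also have "\<dots> = (\<Prod>b\<in>{..<a i} - frob l. 1 - u / of_nat (a i - b))"
      by (rule prod.reindex_bij_betw[OF H(1)])
    also have "{..<a i} - frob l = insert 0 ({1..<a i} - frob l)"
      using zero_notin_frob[OF assms] P(3)[OF i] by auto
    also have "(\<Prod>b\<in>\<dots>. 1 - u / of_nat (a i - b)) = (1 - u / of_nat (a i)) * (\<Prod>b\<in>{1..<a i} - frob l. 1 - u / of_nat (a i - b))"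
      by simp
    finally have 1: "(\<Prod>j\<in>{d<..part l i}. f i j) = \<dots>" .
    have "(\<Prod>j\<in>{d<..cpart l i}. f j i) = (\<Prod>j\<in>{d<..cpart l i}. 1 - u / (of_nat (a i - (j - part l j)) * - 1))"
      using i by (intro prod.cong) (auto simp: f_def H(4) hook_sign_def)
    also have "\<dots> = (\<Prod>b\<in>{1..<a i} - frob l. 1 - u / (of_nat (a i - b) * - 1))"
      by (rule prod.reindex_bij_betw[OF H(2)])
    finally have 2: "(\<Prod>j\<in>{d<..cpart l i}. f j i) = \<dots>" .
    have "(\<Prod>b\<in>{1..<a i} - frob l. 1 - u / of_nat (a i - b)) * (\<Prod>b\<in>{1..<a i} - frob l. 1 - u / (of_nat (a i - b) * - 1)) =
        (\<Prod>b\<in>{1..<a i} - frob l. 1 - u ^ 2 / (of_nat (a i) - of_nat b) ^ 2)"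
      unfolding prod.distrib[symmetric] one_minus_div_mult by (rule prod.cong) (auto simp: of_nat_diff)
    then show ?thesis
      unfolding 1 2 mult.assoc by (simp only:)
  qed
  then have outside: "(\<Prod>i\<in>{1..d}. \<Prod>j\<in>{d<..part l i}. f i j) * (\<Prod>j\<in>{1..d}. \<Prod>i\<in>{d<..cpart l j}. f i j) =
      (\<Prod>i\<in>{1..d}. (1 - u / of_nat (a i)) * (\<Prod>b\<in>{1..<a i} - frob l. 1 - u ^ 2 / (of_nat (a i) - of_nat b) ^ 2))"
    unfolding prod.distrib[symmetric] by (intro prod.cong) simp_all
  have "(\<Prod>(i, j)\<in>diagram l. f i j) =
      (\<Prod>i\<in>{1..d}. (1 - u / (2 * of_nat (a i))) * (\<Prod>b\<in>{b \<in> frob l. b < a i}. 1 - u ^ 2 / (of_nat (a i) + of_nat b) ^ 2)) *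
      (\<Prod>i\<in>{1..d}. (1 - u / of_nat (a i)) * (\<Prod>b\<in>{1..<a i} - frob l. 1 - u ^ 2 / (of_nat (a i) - of_nat b) ^ 2))"
    unfolding prod_diagram[OF assms, of "\<lambda>(i, j). f i j", folded d_def] prod.case mult.assoc[of _ "prod _ _" "prod _ _"]
      outside inside ..
  also have "\<dots> = (\<Prod>i\<in>{1..d}. (1 - u / (2 * of_nat (a i))) * (1 - u / of_nat (a i)) *
      ((\<Prod>b\<in>{b \<in> frob l. b < a i}. 1 - u ^ 2 / (of_nat (a i) + of_nat b) ^ 2) *
       (\<Prod>b\<in>{1..<a i} - frob l. 1 - u ^ 2 / (of_nat (a i) - of_nat b) ^ 2)))"
    unfolding prod.distrib[symmetric] by (rule prod.cong) (simp_all only: mult_ac)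
  also have "\<dots> = hookprod (frob l) u"
    unfolding hookprod_def prod.reindex[OF frob(2), folded frob(1)] o_def ..
  finally show ?thesis
    by (simp only: f_def)
qed

text \<open>The first d rows and the first d columns cover the diagram and meet in the square of d^2
  boxes; row and column i together have 2 a_i + 2 i - 1 boxes.\<close>

lemma weight_DD:
  assumes "l \<in> DD"
  shows "weight l = 2 * \<Sum>(frob l)"
proof -
  define d where "d = durfee l"
  define a where "a i = part l i - i" for i
  note P = DD_part[OF assms, folded a_def d_def]
  have "weight l = (\<Sum>i\<in>{1..length l}. part l i)"
    by (auto simp: weight_def sum_list_sum_nth part_def intro!: sum.reindex_bij_witness[of _ "\<lambda>i. i - 1" Suc])
  also have "\<dots> = card (SIGMA i:{1..length l}. {1..part l i})"
    by simp
  also have "(SIGMA i:{1..length l}. {1..part l i}) = diagram l"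
    by (auto simp: diagram_def)
  also have "card (diagram l) = d * d + (\<Sum>i\<in>{1..d}. part l i - d) + (\<Sum>i\<in>{1..d}. cpart l i - d)"
  proof -
    have inj: "inj_on (\<lambda>(j, i). (i, j)) (SIGMA j:{1..d}. {d<..cpart l j})"
      by (auto simp: inj_on_def)
    show ?thesis
      unfolding diagram_split[OF assms] d_def[symmetric]
      by ((subst card_Un_disjoint, (auto)[3])+, subst card_image[OF inj]) simp
  qed
  finally have "weight l + d * d = (\<Sum>i\<in>{1..d}. (part l i - d) + d) + (\<Sum>i\<in>{1..d}. (cpart l i - d) + d)"
    by (simp add: sum.distrib)
  also have "\<dots> = (\<Sum>i\<in>{1..d}. part l i + cpart l i)"
    unfolding sum.distrib[symmetric]
  proof (rule sum.cong)
    fix i assume "i \<in> {1..d}"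
    then show "part l i - d + d + (cpart l i - d + d) = part l i + cpart l i"
      using P(4,5)[of i] by simp
  qed simp
  finally have "weight l + d * d + d = (\<Sum>i\<in>{1..d}. part l i + cpart l i + 1)"
    by (simp only: sum.distrib sum_constant card_atLeastAtMost) simp
  also have "\<dots> = (\<Sum>i\<in>{1..d}. 2 * a i + 2 * i)"
  proof (rule sum.cong)
    fix i assume "i \<in> {1..d}"
    then show "part l i + cpart l i + 1 = 2 * a i + 2 * i"
      using P(1-3)[of i] by simp
  qed simp
  also have "\<dots> = 2 * (\<Sum>i\<in>{1..d}. a i) + 2 * \<Sum>{1..d}"
    by (simp add: sum.distrib sum_distrib_left)
  also have "2 * \<Sum>{1..d} = d * d + d"
    using gauss_sum_from_Suc_0[of d, where 'a = nat] by (induction d) auto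
  also have "(\<Sum>i\<in>{1..d}. a i) = \<Sum>(frob l)"
    using frob_inj[OF assms] by (simp add: frob_def sum.reindex a_def d_def)
  finally show ?thesis by simp
qed

section \<open>The bijection with finite sets of positive integers\<close>

lemma frob_rank:
  assumes "l \<in> DD" "i \<in> {1..durfee l}"
  shows "card {b \<in> frob l. b \<ge> part l i - i} = i"
proof -
  have "{b \<in> frob l. b \<ge> part l i - i} = frob l - {b \<in> frob l. b < part l i - i}"
    by auto
  then show ?thesis
    using card_frob_less[OF assms] card_frob[OF assms(1)] assms(2) finite_frob[of l]
    by (simp add: card_Diff_subset)
qed

text \<open>By \<open>frob_rank\<close> the set determines each a_i as its i-th largest element.
  This fixes the first d rows and the first d columns, and the columns determine all rows below the
  square.\<close>

lemma inj_frob: "inj_on frob DD"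
proof (rule inj_onI)
  fix l m assume lm: "l \<in> DD" "m \<in> DD" "frob l = frob m"
  have part: "is_partition l" "is_partition m"
    using lm by (auto simp: DD_iff)
  have d: "durfee l = durfee m"
    using lm card_frob by metis
  have a: "part l i - i = part m i - i" if i: "i \<in> {1..durfee l}" for i
  proof -
    have strict: "card {b \<in> frob l. b \<ge> y} < card {b \<in> frob l. b \<ge> x}" if "x < y" "x \<in> frob l" for x y
    proof (rule psubset_card_mono)
      have "x \<in> {b \<in> frob l. b \<ge> x}" "x \<notin> {b \<in> frob l. b \<ge> y}"
        using that by auto
      then show "{b \<in> frob l. b \<ge> y} \<subset> {b \<in> frob l. b \<ge> x}"
        using that(1) by fastforce
    qed (simp add: finite_frob)
    have "part l i - i \<in> frob l" "part m i - i \<in> frob l"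
      using i d lm(3) by (auto simp: frob_def)
    then show ?thesis
      using strict[of "part l i - i" "part m i - i"] strict[of "part m i - i" "part l i - i"]
        frob_rank[OF lm(1) i] frob_rank[OF lm(2), of i] i d lm(3)
      by (cases "part l i - i" "part m i - i" rule: linorder_cases) auto
  qed
  have "part l i = part m i" if "1 \<le> i" for i
  proof (rule nat_eqI_le)
    fix j :: nat assume "1 \<le> j"
    show "j \<le> part l i \<longleftrightarrow> j \<le> part m i"
    proof (cases "i \<le> durfee l")
      case True
      then show ?thesis
        using DD_part(1)[OF lm(1), of i] DD_part(1)[OF lm(2), of i] a[of i] d that by auto
    next
      case False
      have "cpart l j = cpart m j" if "j \<le> durfee l"
        using DD_part(2)[OF lm(1), of j] DD_part(2)[OF lm(2), of j] a[of j] d that \<open>1 \<le> j\<close> by auto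
      moreover have "\<not> j \<le> part l i" "\<not> j \<le> part m i" if "\<not> j \<le> durfee l"
        using False that le_durfee_iff[OF part(1), of "Suc (durfee l)"] le_durfee_iff[OF part(2), of "Suc (durfee l)"]
          part_antimono[OF part(1), of "Suc (durfee l)" i] part_antimono[OF part(2), of "Suc (durfee l)" i] d
        by auto
      ultimately show ?thesis
        using le_cpart_iff[OF part(1) that \<open>1 \<le> j\<close>] le_cpart_iff[OF part(2) that \<open>1 \<le> j\<close>]
        by (cases "j \<le> durfee l") auto
    qed
  qed
  note eq = this
  have "length l = length m"
    by (rule nat_eqI_le) (use eq part_pos_iff[OF part(1)] part_pos_iff[OF part(2)] in auto)
  then show "l = m"
  proof (rule nth_equalityI)
    show "l ! i = m ! i" if "i < length l" for i
      using eq[of "Suc i"] that \<open>length l = length m\<close> by (simp add: part_def)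
  qed
qed

lemma frob_surj:
  assumes "finite S" "0 \<notin> S"
  shows "\<exists>l\<in>DD. frob l = S"
proof -
  define xs where "xs = rev (sorted_list_of_set S)"
  define d where "d = length xs"
  define a where "a i = xs ! (i - 1)" for i
  have a_strict: "a j < a i" if "1 \<le> i" "i < j" "j \<le> d" for i j
    using sorted_wrt_nth_less[of "(<)" "sorted_list_of_set S" "d - j" "d - i"] that
    by (simp add: a_def xs_def d_def rev_nth strict_sorted_list_of_set)
  have a_image: "a ` {1..d} = S"
  proof -
    have "S = set xs"
      using assms(1) by (simp add: xs_def)
    also have "\<dots> = (!) xs ` {..<d}"
      by (auto simp: d_def set_conv_nth)
    also have "{..<d} = (\<lambda>i. i - 1) ` {1..d}"
      by (auto simp: image_iff intro!: bexI[of _ "Suc _"])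
    finally show ?thesis
      by (simp add: image_image a_def)
  qed
  have a_pos: "a i \<ge> 1" if "1 \<le> i" "i \<le> d" for i
    using assms(2) a_image that by (metis atLeastAtMost_iff imageI less_one not_le)
  have a_mono: "a j + j \<le> a i + i" if "1 \<le> i" "i \<le> j" "j \<le> d" for i j
    using that(2,3)
  proof (induction j rule: dec_induct)
    case (step j)
    then show ?case
      using a_strict[of j "Suc j"] that(1) by simp
  qed simp
  have a_d: "d + 1 \<le> a i + i" if "1 \<le> i" "i \<le> d" for i
    using a_mono[of i d] a_pos[of d] that by simp
  \<comment> \<open>Column k must get length a_k + k - 1, so a row i > d reaches column k exactly if
    i < a_k + k.\<close>
  define lam where "lam i = (if i \<le> d then a i + i else card {k \<in> {1..d}. i < a k + k})" for i
  \<comment> \<open>The number of rows is the length a_1 + 1 - 1 of the first column.\<close>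
  define L where "L = (if d = 0 then 0 else a 1)"
  define l where "l = map (\<lambda>i. lam (Suc i)) [0..<L]"
  have lam_gt: "lam i \<le> d" if "d < i" for i
  proof -
    have "card {k \<in> {1..d}. i < a k + k} \<le> card {1..d}"
      by (rule card_mono) auto
    then show ?thesis
      using that by (simp add: lam_def)
  qed
  have d_le_L: "d \<le> L"
    using a_d[of 1] by (auto simp: L_def)
  have part_l: "part l i = lam i" if "1 \<le> i" for i
  proof (cases "i \<le> L")
    case False
    have "\<not> i < a k + k" if "1 \<le> k" "k \<le> d" for k
      using a_mono[of 1 k] that False by (auto simp: L_def split: if_splits)
    then have "lam i = 0"
      using False d_le_L by (auto simp: lam_def)
    then show ?thesis
      using False by (simp add: part_def l_def)
  next
    case True
    with that obtain k where "i = Suc k" "k < L"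
      by (cases i) auto
    then show ?thesis
      by (simp add: part_def l_def)
  qed
  have lam_mono: "lam j \<le> lam i" if "1 \<le> i" "i \<le> j" for i j
  proof (cases "j \<le> d")
    case True
    then show ?thesis
      using a_mono[of i j] that by (simp add: lam_def)
  next
    case False
    show ?thesis
    proof (cases "i \<le> d")
      case True
      then show ?thesis
        using False lam_gt[of j] a_d[of i] that by (simp add: lam_def)
    next
      case i: False
      then show ?thesis
        using False that by (auto simp: lam_def intro!: card_mono)
    qed
  qed
  have lam_pos: "lam i > 0" if "1 \<le> i" "i \<le> L" for i
  proof (cases "i \<le> d")
    case False
    then have "1 \<in> {k \<in> {1..d}. i < a k + k}"
      using that by (auto simp: L_def split: if_splits)
    then show ?thesis
      using False by (auto simp: lam_def card_gt_0_iff)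
  qed (use that in \<open>simp add: lam_def\<close>)
  have l: "is_partition l"
    unfolding is_partition_def l_def
    by (auto simp: sorted_wrt_map sorted_wrt_iff_nth_less intro!: lam_mono lam_pos)
  have durfee: "durfee l = d"
  proof (rule nat_eqI_le)
    fix m :: nat assume "1 \<le> m"
    then show "m \<le> durfee l \<longleftrightarrow> m \<le> d"
      using lam_gt[of m] by (auto simp: le_durfee_iff[OF l] part_l lam_def)
  qed
  have cpart: "cpart l i + 1 = part l i" if i: "1 \<le> i" "i \<le> d" for i
  proof -
    have "cpart l i = a i + i - 1"
    proof (rule nat_eqI_le)
      fix m :: nat assume m: "1 \<le> m"
      have "i \<le> lam m \<longleftrightarrow> m \<le> a i + i - 1"
      proof (cases "m \<le> d")
        case True
        then show ?thesis
          using a_d[of m] a_d[of i] m i by (auto simp: lam_def)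
      next
        case False
        define D where "D = {k \<in> {1..d}. m < a k + k}"
        have "D = {1..card D}"
        proof (rule downset_eq_atLeastAtMost)
          show "j \<in> D" if "k \<in> D" "1 \<le> j" "j \<le> k" for j k
            using that a_mono[of j k] by (auto simp: D_def)
        qed (auto simp: D_def)
        then have "i \<le> card D \<longleftrightarrow> i \<in> D"
          using i(1) by (metis atLeastAtMost_iff)
        then show ?thesis
          using False i by (auto simp: lam_def D_def)
      qed
      then show "m \<le> cpart l i \<longleftrightarrow> m \<le> a i + i - 1"
        using le_cpart_iff[OF l m i(1)] part_l[OF m] by simp
    qed
    then show ?thesis
      using i part_l[of i] by (simp add: lam_def)
  qed
  have "l \<in> DD"
    unfolding DD_iff durfee using l cpart a_pos part_l by (auto simp: lam_def Suc_le_eq)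
  moreover have "frob l = S"
  proof -
    have "frob l = a ` {1..d}"
      unfolding frob_def durfee by (rule image_cong) (auto simp: part_l lam_def)
    then show ?thesis
      by (simp only: a_image)
  qed
  ultimately show ?thesis by blast
qed

lemma bij_betw_frob: "bij_betw frob DD {S. finite S \<and> 0 \<notin> S}"
  unfolding bij_betw_def
  using inj_frob finite_frob zero_notin_frob frob_surj by (auto simp: image_iff) blast

subsection \<open>Evaluation of the Vandermonde quotients\<close>

text \<open>\<open>K\<close> absorbs the signs of the factors in which the entry at \<open>c\<close>
  is subtracted; it cancels when two values of this entry are compared.\<close>

lemma odd_vandermonde_factor:
  fixes v :: "nat \<Rightarrow> 'a::idom"
  assumes "c < n"
  shows "\<exists>K. \<forall>y. odd_vandermonde n (v(c := y)) = K * (y * (\<Prod>i\<in>{..<n} - {c}. y ^ 2 - v i ^ 2))"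
proof -
  define P where "P = (SIGMA j:{..<n}. {..<j})"
  define A where "A = {(j, i) \<in> P. j \<noteq> c \<and> i \<noteq> c}"
  have P: "P = A \<union> (Pair c ` {..<c} \<union> (\<lambda>j. (j, c)) ` {c<..<n})"
    using assms by (auto simp: P_def A_def)
  have fin: "finite A"
    by (rule finite_subset[of _ P]) (auto simp: A_def P_def)
  have disj: "A \<inter> (Pair c ` {..<c} \<union> (\<lambda>j. (j, c)) ` {c<..<n}) = {}" "Pair c ` {..<c} \<inter> (\<lambda>j. (j, c)) ` {c<..<n} = {}"
    by (auto simp: A_def)
  have split: "prod f P = prod f A * ((\<Prod>i<c. f (c, i)) * (\<Prod>j\<in>{c<..<n}. f (j, c)))" for f :: "nat \<times> nat \<Rightarrow> 'a"
    unfolding P using fin disj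
    by (simp add: prod.union_disjoint prod.reindex inj_on_def)
  have ln: "{..<n} = insert c ({..<c} \<union> {c<..<n})" "{..<n} - {c} = {..<c} \<union> {c<..<n}"
    using assms by auto
  have "odd_vandermonde n (v(c := y)) =
      ((\<Prod>i\<in>{..<n} - {c}. v i) * (\<Prod>(j, i)\<in>A. v j ^ 2 - v i ^ 2) * (- 1) ^ card {c<..<n}) *
      (y * (\<Prod>i\<in>{..<n} - {c}. y ^ 2 - v i ^ 2))" for y
  proof -
    define w where "w = v(c := y)"
    have 1: "(\<Prod>i<n. w i) = y * (\<Prod>i\<in>{..<n} - {c}. v i)"
    proof -
      have "(\<Prod>i<n. w i) = w c * (\<Prod>i\<in>{..<n} - {c}. w i)"
        using assms by (intro prod.remove) auto
      also have "(\<Prod>i\<in>{..<n} - {c}. w i) = (\<Prod>i\<in>{..<n} - {c}. v i)"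
        by (rule prod.cong) (auto simp: w_def)
      finally show ?thesis by (simp add: w_def)
    qed
    have 2: "(\<Prod>(j, i)\<in>A. w j ^ 2 - w i ^ 2) = (\<Prod>(j, i)\<in>A. v j ^ 2 - v i ^ 2)"
      by (rule prod.cong) (auto simp: w_def A_def)
    have 3: "(\<Prod>i<c. w c ^ 2 - w i ^ 2) = (\<Prod>i<c. y ^ 2 - v i ^ 2)"
      by (rule prod.cong) (auto simp: w_def)
    have "(\<Prod>j\<in>{c<..<n}. w j ^ 2 - w c ^ 2) = (\<Prod>j\<in>{c<..<n}. - (y ^ 2 - v j ^ 2))"
      by (rule prod.cong) (auto simp: w_def)
    then have 4: "(\<Prod>j\<in>{c<..<n}. w j ^ 2 - w c ^ 2) = (- 1) ^ card {c<..<n} * (\<Prod>j\<in>{c<..<n}. y ^ 2 - v j ^ 2)"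
      by (simp only: prod_uminus)
    have "(\<Prod>j<n. \<Prod>i<j. w j ^ 2 - w i ^ 2) = (\<Prod>(j, i)\<in>P. w j ^ 2 - w i ^ 2)"
      by (simp add: P_def prod.Sigma)
    also have "\<dots> = (\<Prod>(j, i)\<in>A. v j ^ 2 - v i ^ 2) * ((\<Prod>i<c. y ^ 2 - v i ^ 2) *
        ((- 1) ^ card {c<..<n} * (\<Prod>j\<in>{c<..<n}. y ^ 2 - v j ^ 2)))"
      unfolding split by (simp only: prod.case 2 3 4)
    also have "(\<Prod>i\<in>{..<n} - {c}. y ^ 2 - v i ^ 2) = (\<Prod>i<c. y ^ 2 - v i ^ 2) * (\<Prod>j\<in>{c<..<n}. y ^ 2 - v j ^ 2)"
      unfolding ln(2) by (rule prod.union_disjoint) auto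
    ultimately show ?thesis
      unfolding odd_vandermonde_def w_def[symmetric] 1 by (simp add: mult_ac)
  qed
  then show ?thesis by blast
qed

lemma odd_vandermonde_ratio:
  fixes v :: "nat \<Rightarrow> 'a::field"
  assumes "c < n" "v c \<noteq> 0" "\<And>i. i < n \<Longrightarrow> i \<noteq> c \<Longrightarrow> v c ^ 2 \<noteq> v i ^ 2"
  shows "odd_vandermonde n (v(c := y)) =
    odd_vandermonde n v * (y / v c * (\<Prod>i\<in>{..<n} - {c}. (y ^ 2 - v i ^ 2) / (v c ^ 2 - v i ^ 2)))"
proof -
  obtain K where K: "odd_vandermonde n (v(c := y)) = K * (y * (\<Prod>i\<in>{..<n} - {c}. y ^ 2 - v i ^ 2))" for y
    using odd_vandermonde_factor[OF assms(1), of v] by blast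
  have "odd_vandermonde n v = K * (v c * (\<Prod>i\<in>{..<n} - {c}. v c ^ 2 - v i ^ 2))"
    using K[of "v c"] by simp
  moreover have "(\<Prod>i\<in>{..<n} - {c}. v c ^ 2 - v i ^ 2) \<noteq> 0"
    using assms(3) by simp
  ultimately show ?thesis
    using assms(2) by (simp add: K prod_dividef field_simps)
qed

lemma prod_shift_fact: "(\<Prod>b\<in>{1..m}. of_nat k + of_nat b :: complex) = fact (k + m) / fact k"
proof (induction m)
  case (Suc m)
  have "{1..Suc m} = insert (Suc m) {1..m}"
    by auto
  then have "(\<Prod>b\<in>{1..Suc m}. of_nat k + of_nat b :: complex) = (of_nat k + of_nat (Suc m)) * (fact (k + m) / fact k)"
    by (simp add: Suc.IH[simplified])
  also have "\<dots> = fact (k + Suc m) / fact k"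
    by (simp add: algebra_simps add_divide_distrib)
  finally show ?case .
qed simp

lemma prod_reflect_fact:
  "(\<Prod>b\<in>{1..m}. of_nat k + of_nat (m + 1 - b) :: complex) = fact (k + m) / fact k"
proof -
  have "(\<Prod>b\<in>{1..m}. of_nat k + of_nat (m + 1 - b) :: complex) = (\<Prod>b\<in>{1..m}. of_nat k + of_nat b)"
    by (rule prod.reindex_bij_witness[of _ "\<lambda>b. m + 1 - b" "\<lambda>b. m + 1 - b"]) auto
  then show ?thesis by (simp only: prod_shift_fact)
qed

text \<open>The effect of one move when nothing has moved before. With y = n + 1 + a and v_b = n + 1
  - b, the differences y^2 - v_b^2 and v_a^2 - v_b^2 split into the linear factors shown. The number
  u = 2 n + 2 is twice the centre n + 1 of the move and becomes 2 t + 2.\<close>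

lemma hook_ratio_single:
  fixes n a :: nat
  assumes "1 \<le> a" "a \<le> n"
  defines "u \<equiv> 2 * of_nat n + 2 :: complex"
  shows "(of_nat n + 1 + of_nat a) / (of_nat n + 1 - of_nat a) *
      (\<Prod>b\<in>{1..n} - {a}. (of_nat a + of_nat b) * (u + of_nat a - of_nat b) / ((of_nat b - of_nat a) * (u - of_nat a - of_nat b))) =
    (1 - u / (2 * of_nat a)) * (1 - u / of_nat a) * (\<Prod>b\<in>{1..<a}. 1 - u ^ 2 / (of_nat a - of_nat b) ^ 2)"
proof -
  obtain c where a: "a = Suc c"
    using assms(1) by (cases a) auto
  obtain k where n: "n = a + k"
    using assms(2) le_Suc_ex by blast
  define \<alpha> where "\<alpha> = (of_nat a :: complex)"
  define A where "A = of_nat n + 1 + \<alpha>"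
  define B where "B = of_nat n + 1 - \<alpha>"
  define N1 where "N1 = (\<Prod>b\<in>{1..n} - {a}. \<alpha> + of_nat b)"
  define N2 where "N2 = (\<Prod>b\<in>{1..n} - {a}. u + \<alpha> - of_nat b)"
  define D1 where "D1 = (\<Prod>b\<in>{1..n} - {a}. of_nat b - \<alpha>)"
  define D2 where "D2 = (\<Prod>b\<in>{1..n} - {a}. u - \<alpha> - of_nat b)"
  define s where "s = (- 1 :: complex) ^ c"
  define F where "F = (fact (n + a) :: complex)"
  define w where "w = (fact (2 * n + 1 + a) :: complex)"
  define f where "f = (fact c :: complex)"
  define g where "g = (fact k :: complex)"
  define h where "h = (fact (a + 2 * k + 1) :: complex)"
  define r where "r = (fact (2 * n + 1) :: complex)"
  have pos: "F \<noteq> 0" "w \<noteq> 0" "f \<noteq> 0" "g \<noteq> 0" "h \<noteq> 0" "r \<noteq> 0"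
    unfolding F_def w_def f_def g_def h_def r_def by (rule fact_nonzero)+
  have \<alpha>: "\<alpha> \<noteq> 0"
    using assms(1) by (simp add: \<alpha>_def)
  note pos = pos \<alpha>
  have AB: "A = of_nat (n + 1 + a)" "B = of_nat (k + 1)" "u = of_nat (2 * n + 2)" "u - 2 * \<alpha> = of_nat (2 * k + 2)"
    "u - \<alpha> = of_nat (a + 2 * k + 2)"
    by (simp_all add: A_def B_def \<alpha>_def u_def n)
  have nz: "A \<noteq> 0" "B \<noteq> 0" "u \<noteq> 0" "u - 2 * \<alpha> \<noteq> 0" "u - \<alpha> \<noteq> 0"
    unfolding AB(1) AB(2) AB(4) AB(5) by (simp_all only: AB(3) of_nat_eq_0_iff)
  have fact_a: "fact a = \<alpha> * f"
    by (simp add: a f_def \<alpha>_def)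
  have remove: "prod q {1..n} = q a * prod q ({1..n} - {a})" for q :: "nat \<Rightarrow> complex"
    using assms by (intro prod.remove) auto
  \<comment> \<open>Restoring the omitted factor b = a turns the product into a quotient of
    factorials; the same device serves for \<open>N2\<close> and \<open>D2\<close>.\<close>
  have e1: "N1 = F / (2 * \<alpha> * (\<alpha> * f))"
  proof -
    have "2 * \<alpha> * N1 = (\<Prod>b\<in>{1..n}. of_nat a + of_nat b)"
      unfolding remove by (simp add: N1_def \<alpha>_def)
    also have "\<dots> = F / (\<alpha> * f)"
      unfolding prod_shift_fact fact_a by (simp add: F_def add.commute)
    finally show ?thesis
      using pos by (simp add: field_simps)
  qed
  have e2: "N2 = w / (u * (A * F))"
  proof -
    have "u * N2 = (\<Prod>b\<in>{1..n}. u + \<alpha> - of_nat b)"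
      unfolding remove by (simp add: N2_def \<alpha>_def)
    also have "\<dots> = (\<Prod>b\<in>{1..n}. of_nat (n + 1 + a) + of_nat (n + 1 - b))"
      by (rule prod.cong) (auto simp: u_def \<alpha>_def of_nat_diff)
    also have "\<dots> = fact (n + 1 + a + n) / fact (n + 1 + a)"
      by (rule prod_reflect_fact)
    also have "(fact (n + 1 + a) :: complex) = A * F"
      by (simp add: A_def F_def \<alpha>_def)
    also have "fact (n + 1 + a + n) = w"
      unfolding w_def by (rule arg_cong[of _ _ fact]) simp
    finally show ?thesis
      using pos nz by (simp add: field_simps)
  qed
  \<comment> \<open>Here the factor at b = a would be zero, so the range is split at
    \<open>a\<close>; the \<open>c\<close> factors below it are negative and give the sign
    \<open>s\<close>.\<close>
  have e3: "D1 = s * f * g"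
  proof -
    have eq: "{1..n} - {a} = {1..c} \<union> {a<..n}"
      using assms by (auto simp: a)
    have "D1 = (\<Prod>b\<in>{1..c}. of_nat b - \<alpha>) * (\<Prod>b\<in>{a<..n}. of_nat b - \<alpha>)"
      unfolding D1_def eq by (rule prod.union_disjoint) (auto simp: a)
    also have "(\<Prod>b\<in>{1..c}. of_nat b - \<alpha>) = (\<Prod>b\<in>{1..c}. - (of_nat 0 + of_nat (c + 1 - b)))"
      by (rule prod.cong) (auto simp: \<alpha>_def a of_nat_diff)
    also have "\<dots> = s * f"
      unfolding prod_uminus prod_reflect_fact by (simp add: s_def f_def)
    also have "(\<Prod>b\<in>{a<..n}. of_nat b - \<alpha>) = (\<Prod>b\<in>{1..k}. of_nat 0 + of_nat b)"
      by (rule prod.reindex_bij_witness[of _ "\<lambda>b. b + a" "\<lambda>b. b - a"]) (auto simp: n \<alpha>_def of_nat_diff)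
    also have "\<dots> = g"
      unfolding prod_shift_fact by (simp add: g_def)
    finally show ?thesis .
  qed
  have e4: "D2 = h / ((u - 2 * \<alpha>) * (B * g))"
  proof -
    have "(u - 2 * \<alpha>) * D2 = (\<Prod>b\<in>{1..n}. u - \<alpha> - of_nat b)"
      unfolding remove by (simp add: D2_def \<alpha>_def)
    also have "\<dots> = (\<Prod>b\<in>{1..n}. of_nat (k + 1) + of_nat (n + 1 - b))"
      by (rule prod.cong) (auto simp: u_def \<alpha>_def of_nat_diff n)
    also have "\<dots> = fact (k + 1 + n) / fact (k + 1)"
      by (rule prod_reflect_fact)
    also have "(fact (k + 1) :: complex) = B * g"
      by (simp add: B_def g_def \<alpha>_def n)
    also have "fact (k + 1 + n) = h"
      unfolding h_def n by (rule arg_cong[of _ _ fact]) simp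
    finally show ?thesis
      using pos nz by (simp add: field_simps)
  qed
  have e5: "(\<Prod>b\<in>{1..<a}. 1 - u ^ 2 / (\<alpha> - of_nat b) ^ 2) = s * (r / ((u - \<alpha>) * h)) * (w / (u * r)) / f ^ 2"
  proof -
    have "(\<Prod>b\<in>{1..<a}. 1 - u ^ 2 / (\<alpha> - of_nat b) ^ 2) = (\<Prod>b\<in>{1..c}. 1 - u ^ 2 / of_nat b ^ 2)"
      by (rule prod.reindex_bij_witness[of _ "\<lambda>b. a - b" "\<lambda>b. a - b"]) (auto simp: a \<alpha>_def of_nat_diff)
    also have "\<dots> = (\<Prod>b\<in>{1..c}. (- (u - of_nat b)) * (u + of_nat b) / of_nat b ^ 2)"
      by (rule prod.cong) (auto simp: field_simps power2_eq_square)
    also have "\<dots> = s * (\<Prod>b\<in>{1..c}. u - of_nat b) * (\<Prod>b\<in>{1..c}. u + of_nat b) / (\<Prod>b\<in>{1..c}. of_nat b) ^ 2"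
      by (simp only: prod_dividef prod.distrib prod_uminus prod_power_distrib s_def card_atLeastAtMost diff_Suc_1)
    also have "(\<Prod>b\<in>{1..c}. of_nat b :: complex) = f"
      using prod_shift_fact[of 0 c] by (simp add: f_def)
    also have "(\<Prod>b\<in>{1..c}. u + of_nat b) = fact (2 * n + 2 + c) / fact (2 * n + 2)"
      unfolding prod_shift_fact[symmetric] by (simp add: u_def add.commute)
    also have "(fact (2 * n + 2) :: complex) = u * r"
      by (simp add: u_def r_def)
    also have "fact (2 * n + 2 + c) = w"
      unfolding w_def a by (rule arg_cong[of _ _ fact]) simp
    also have "(\<Prod>b\<in>{1..c}. u - of_nat b) = (\<Prod>b\<in>{1..c}. of_nat (a + 2 * k + 2) + of_nat (c + 1 - b))"
      by (rule prod.cong) (auto simp: u_def n a of_nat_diff)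
    also have "\<dots> = fact (a + 2 * k + 2 + c) / fact (a + 2 * k + 2)"
      by (rule prod_reflect_fact)
    also have "(fact (a + 2 * k + 2) :: complex) = (u - \<alpha>) * h"
      by (simp add: u_def h_def n \<alpha>_def)
    also have "fact (a + 2 * k + 2 + c) = r"
      unfolding r_def n a by (rule arg_cong[of _ _ fact]) simp
    finally show ?thesis .
  qed
  have s: "s * s = 1" "s \<noteq> 0"
    by (simp_all add: s_def flip: power_mult_distrib)
  have "A / B * (N1 * N2 / (D1 * D2)) = w * (u - 2 * \<alpha>) / (2 * \<alpha> ^ 2 * f ^ 2 * u * s * h)"
    unfolding e1 e2 e3 e4 using pos nz s(2) by (simp add: divide_simps power2_eq_square)
  also have "\<dots> = w * (u - 2 * \<alpha>) * s / (2 * \<alpha> ^ 2 * f ^ 2 * u * h)"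
    using s pos nz by (simp add: divide_simps)
  also have "\<dots> = (1 - u / (2 * \<alpha>)) * (1 - u / \<alpha>) * (s * (r / ((u - \<alpha>) * h)) * (w / (u * r)) / f ^ 2)"
  proof -
    have "(1 - u / (2 * \<alpha>)) * (1 - u / \<alpha>) = (u - 2 * \<alpha>) * (u - \<alpha>) / (2 * \<alpha> ^ 2)"
      using pos by (simp add: field_simps power2_eq_square)
    then show ?thesis
      using pos nz by (simp add: mult_ac)
  qed
  finally have "A / B * (N1 * N2 / (D1 * D2)) = (1 - u / (2 * \<alpha>)) * (1 - u / \<alpha>) * (\<Prod>b\<in>{1..<a}. 1 - u ^ 2 / (\<alpha> - of_nat b) ^ 2)"
    by (simp only: e5)
  moreover have "N1 * N2 / (D1 * D2) = (\<Prod>b\<in>{1..n} - {a}. (\<alpha> + of_nat b) * (u + \<alpha> - of_nat b) / ((of_nat b - \<alpha>) * (u - \<alpha> - of_nat b)))"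
    by (simp only: N1_def N2_def D1_def D2_def prod_dividef prod.distrib)
  ultimately show ?thesis
    by (simp only: A_def B_def \<alpha>_def)
qed

text \<open>Each factor looks only at numbers below its own element, so a new maximum leaves the old
  factors alone.\<close>

lemma hookprod_insert_max:
  assumes "finite S" "\<And>b. b \<in> S \<Longrightarrow> b < a"
  shows "hookprod (insert a S) u = hookprod S u * ((1 - u / (2 * of_nat a)) * (1 - u / of_nat a) *
     ((\<Prod>b\<in>S. 1 - u ^ 2 / (of_nat a + of_nat b) ^ 2) *
      (\<Prod>b\<in>{1..<a} - S. 1 - u ^ 2 / (of_nat a - of_nat b) ^ 2)))"
proof -
  have "a \<notin> S"
    using assms(2) by blast
  have 1: "{b \<in> insert a S. b < a} = S" "{1..<a} - insert a S = {1..<a} - S"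
    using assms(2) by auto
  have 2: "{b \<in> insert a S. b < c} = {b \<in> S. b < c}" "{1..<c} - insert a S = {1..<c} - S" if "c \<in> S" for c
    using assms(2)[OF that] by auto
  have "(\<Prod>c\<in>S. (1 - u / (2 * of_nat c)) * (1 - u / of_nat c) *
     ((\<Prod>b\<in>{b \<in> insert a S. b < c}. 1 - u ^ 2 / (of_nat c + of_nat b) ^ 2) *
      (\<Prod>b\<in>{1..<c} - insert a S. 1 - u ^ 2 / (of_nat c - of_nat b) ^ 2))) = hookprod S u"
    unfolding hookprod_def by (rule prod.cong) (simp_all only: 2)
  then show ?thesis
    unfolding hookprod_def[of "insert a S"] prod.insert[OF assms(1) \<open>a \<notin> S\<close>] 1
    by (simp only: mult.commute)
qed

lemma swap_pos_neq:
  assumes "c < n" "i < n" "i \<noteq> c"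
  shows "(of_nat n - of_nat c :: complex) ^ 2 \<noteq> swap_pos n S i ^ 2"
proof
  define m where "m = (if i \<in> S then n + i + 2 else n - i)"
  have "swap_pos n S i = of_nat m"
    using assms by (simp add: swap_pos_def m_def of_nat_diff)
  moreover assume "(of_nat n - of_nat c :: complex) ^ 2 = swap_pos n S i ^ 2"
  moreover have "(of_nat n - of_nat c :: complex) = of_nat (n - c)"
    using assms by (simp add: of_nat_diff)
  ultimately have "(of_nat ((n - c) ^ 2) :: complex) = of_nat (m ^ 2)"
    by simp
  then have "(n - c) ^ 2 = m ^ 2"
    by (simp only: of_nat_eq_iff)
  then have "n - c = m"
    by (simp add: power2_eq_iff_nonneg)
  then show False
    using assms by (auto simp: m_def split: if_splits)
qed

text \<open>Compared with \<open>hook_ratio_single\<close>, the elements b of the shifted set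
  already sit at n + 1 + b. This multiplies the factor of b by \<open>H b / J b\<close>, trading the
  hook a - b for a + b exactly as membership of b does in \<open>hookprod\<close>.\<close>

lemma odd_vandermonde_swap_pos_insert:
  assumes "c < n" "\<And>i. i \<in> S \<Longrightarrow> i < c"
  defines "a \<equiv> Suc c" and "u \<equiv> 2 * of_nat n + 2 :: complex"
  shows "odd_vandermonde n (swap_pos n (insert c S)) = odd_vandermonde n (swap_pos n S) *
    ((1 - u / (2 * of_nat a)) * (1 - u / of_nat a) *
     ((\<Prod>b\<in>Suc ` S. 1 - u ^ 2 / (of_nat a + of_nat b) ^ 2) *
      (\<Prod>b\<in>{1..<a} - Suc ` S. 1 - u ^ 2 / (of_nat a - of_nat b) ^ 2)))"
proof -
  have S: "c \<notin> S" "finite S" "S \<subseteq> {..<n}"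
    using assms(1) less_trans[OF assms(2) assms(1)] assms(2) finite_subset[of S "{..<c}"] by auto
  define y where "y = (of_nat n + of_nat c + 2 :: complex)"
  define G where "G b = (of_nat a + of_nat b) * (u + of_nat a - of_nat b) / ((of_nat b - of_nat a) * (u - of_nat a - of_nat b))" for b :: nat
  define H where "H b = (1 - u ^ 2 / (of_nat a + of_nat b) ^ 2)" for b :: nat
  define J where "J b = (1 - u ^ 2 / (of_nat a - of_nat b) ^ 2)" for b :: nat
  have swap: "swap_pos n (insert c S) = (swap_pos n S)(c := y)"
    by (auto simp: swap_pos_def y_def)
  have vc: "swap_pos n S c = of_nat n - of_nat c"
    using S by (simp add: swap_pos_def)
  have vc0: "(of_nat n - of_nat c :: complex) \<noteq> 0"
    using assms(1) by simp
  have "odd_vandermonde n (swap_pos n (insert c S)) = odd_vandermonde n (swap_pos n S) *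
      (y / (of_nat n - of_nat c) * (\<Prod>i\<in>{..<n} - {c}. (y ^ 2 - swap_pos n S i ^ 2) / ((of_nat n - of_nat c) ^ 2 - swap_pos n S i ^ 2)))"
    unfolding swap
    using odd_vandermonde_ratio[of c n "swap_pos n S" y] assms(1) vc0 swap_pos_neq[of c n _ S] by (simp add: vc)
  also have "(\<Prod>i\<in>{..<n} - {c}. (y ^ 2 - swap_pos n S i ^ 2) / ((of_nat n - of_nat c) ^ 2 - swap_pos n S i ^ 2)) =
      (\<Prod>i\<in>{..<n} - {c}. G (Suc i) * (if i \<in> S then H (Suc i) / J (Suc i) else 1))"
  proof (rule prod.cong)
    fix i assume "i \<in> {..<n} - {c}"
    then have i: "i < n" "i \<noteq> c" by auto
    show "(y ^ 2 - swap_pos n S i ^ 2) / ((of_nat n - of_nat c) ^ 2 - swap_pos n S i ^ 2) =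
        G (Suc i) * (if i \<in> S then H (Suc i) / J (Suc i) else 1)"
    proof (cases "i \<in> S")
      case False
      have "y ^ 2 - swap_pos n S i ^ 2 = (of_nat a + of_nat (Suc i)) * (u + of_nat a - of_nat (Suc i))"
        "(of_nat n - of_nat c) ^ 2 - swap_pos n S i ^ 2 = (of_nat (Suc i) - of_nat a) * (u - of_nat a - of_nat (Suc i))"
        using False by (simp_all add: swap_pos_def y_def a_def u_def power2_eq_square algebra_simps)
      then show ?thesis
        using False by (simp add: G_def)
    next
      case True
      then have ic: "i < c" using assms(2) by simp
      define \<alpha> \<beta> where "\<alpha> = (of_nat a :: complex)" and "\<beta> = (of_nat (Suc i) :: complex)"
      have 1: "y ^ 2 - swap_pos n S i ^ 2 = (\<alpha> - \<beta>) * (u + \<alpha> + \<beta>)"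
        "(of_nat n - of_nat c) ^ 2 - swap_pos n S i ^ 2 = - ((\<alpha> + \<beta>) * (u - \<alpha> + \<beta>))"
        using True by (simp_all add: swap_pos_def y_def a_def u_def \<alpha>_def \<beta>_def power2_eq_square algebra_simps)
      have e: "\<alpha> - \<beta> = of_nat (c - i)" "u - \<alpha> + \<beta> = of_nat (2 * n + 2 + i - c)" "u + \<alpha> - \<beta> = of_nat (2 * n + 2 + c - i)"
        "u - \<alpha> - \<beta> = of_nat (2 * n - c - i)" "\<alpha> + \<beta> = of_nat (c + i + 2)"
        using ic assms(1) by (simp_all add: u_def \<alpha>_def \<beta>_def a_def of_nat_diff)
      have nz: "\<alpha> - \<beta> \<noteq> 0" "u - \<alpha> + \<beta> \<noteq> 0" "u + \<alpha> - \<beta> \<noteq> 0" "u - \<alpha> - \<beta> \<noteq> 0" "\<alpha> + \<beta> \<noteq> 0"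
        unfolding e of_nat_eq_0_iff using ic assms(1) by auto
      have sq: "1 - u ^ 2 / x ^ 2 = (x - u) * (x + u) / x ^ 2" if "x \<noteq> 0" for x :: complex
        using that by (simp add: field_simps power2_eq_square)
      have H: "H (Suc i) = (\<alpha> + \<beta> - u) * (\<alpha> + \<beta> + u) / (\<alpha> + \<beta>) ^ 2"
        unfolding H_def \<alpha>_def[symmetric] \<beta>_def[symmetric] by (rule sq) (rule nz)
      have J: "J (Suc i) = (\<alpha> - \<beta> - u) * (\<alpha> - \<beta> + u) / (\<alpha> - \<beta>) ^ 2"
        unfolding J_def \<alpha>_def[symmetric] \<beta>_def[symmetric] by (rule sq) (rule nz)
      have G: "G (Suc i) = (\<alpha> + \<beta>) * (u + \<alpha> - \<beta>) / ((\<beta> - \<alpha>) * (u - \<alpha> - \<beta>))"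
        by (simp only: G_def \<alpha>_def \<beta>_def)
      define p1 p2 p3 p4 p5 where "p1 = \<alpha> - \<beta>" and "p2 = u - \<alpha> + \<beta>" and "p3 = u + \<alpha> - \<beta>"
        and "p4 = u - \<alpha> - \<beta>" and "p5 = \<alpha> + \<beta>"
      have q: "\<alpha> + \<beta> - u = - p4" "\<alpha> - \<beta> - u = - p2" "\<alpha> - \<beta> + u = p3" "\<beta> - \<alpha> = - p1" "\<alpha> + \<beta> + u = u + \<alpha> + \<beta>"
        by (simp_all add: p1_def p2_def p3_def p4_def p5_def)
      have "G (Suc i) * (H (Suc i) / J (Suc i)) = p1 * (u + \<alpha> + \<beta>) / - (p5 * p2)"
        unfolding G H J q using nz
        unfolding p1_def[symmetric] p2_def[symmetric] p3_def[symmetric] p4_def[symmetric] p5_def[symmetric]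
        by (simp add: divide_simps power2_eq_square)
      then show ?thesis
        using True by (simp add: 1 p1_def p2_def p5_def)
    qed
  qed simp
  also have "\<dots> = (\<Prod>b\<in>{1..n} - {a}. G b) * (\<Prod>b\<in>Suc ` S. H b / J b)"
  proof -
    have im: "Suc ` ({..<n} - {c}) = {1..n} - {a}"
      by (simp add: image_set_diff a_def image_Suc_lessThan)
    have "(\<Prod>i\<in>{..<n} - {c}. G (Suc i)) = (\<Prod>b\<in>{1..n} - {a}. G b)"
      unfolding im[symmetric] by (simp add: prod.reindex)
    moreover have "(\<Prod>i\<in>{..<n} - {c}. if i \<in> S then H (Suc i) / J (Suc i) else 1) = (\<Prod>b\<in>Suc ` S. H b / J b)"
      unfolding prod.reindex[OF inj_Suc[THEN inj_on_subset, OF subset_UNIV]]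
      by (rule prod.mono_neutral_cong_right) (use S in auto)
    ultimately show ?thesis
      by (simp add: prod.distrib)
  qed
  also have "y / (of_nat n - of_nat c) * ((\<Prod>b\<in>{1..n} - {a}. G b) * (\<Prod>b\<in>Suc ` S. H b / J b)) =
      (y / (of_nat n - of_nat c) * (\<Prod>b\<in>{1..n} - {a}. G b)) * (\<Prod>b\<in>Suc ` S. H b / J b)"
    by (simp only: mult.assoc)
  also have "y / (of_nat n - of_nat c) * (\<Prod>b\<in>{1..n} - {a}. G b) =
      (1 - u / (2 * of_nat a)) * (1 - u / of_nat a) * (\<Prod>b\<in>{1..<a}. J b)"
    using hook_ratio_single[of a n] assms(1) by (simp add: G_def J_def u_def a_def y_def add_ac)
  also have "(\<Prod>b\<in>{1..<a}. J b) = (\<Prod>b\<in>Suc ` S. J b) * (\<Prod>b\<in>{1..<a} - Suc ` S. J b)"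
  proof -
    have "Suc ` S \<subseteq> {1..<a}"
      using assms(2) by (auto simp: a_def)
    then show ?thesis
      by (subst prod.subset_diff[of "Suc ` S"]) (auto simp: mult.commute)
  qed
  also have "(1 - u / (2 * of_nat a)) * (1 - u / of_nat a) * ((\<Prod>b\<in>Suc ` S. J b) * (\<Prod>b\<in>{1..<a} - Suc ` S. J b)) * (\<Prod>b\<in>Suc ` S. H b / J b) =
      (1 - u / (2 * of_nat a)) * (1 - u / of_nat a) * ((\<Prod>b\<in>Suc ` S. H b) * (\<Prod>b\<in>{1..<a} - Suc ` S. J b))"
  proof -
    have "(\<Prod>b\<in>Suc ` S. J b) \<noteq> 0"
    proof -
      have "J (Suc i) \<noteq> 0" if "i \<in> S" for i
      proof
        assume "J (Suc i) = 0"
        have d: "(of_nat a - of_nat (Suc i) :: complex) = of_nat (c - i)" "c - i \<noteq> 0"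
          using assms(2)[OF that] by (simp_all add: a_def of_nat_diff)
        then have "u ^ 2 = of_nat (c - i) ^ 2"
          using \<open>J (Suc i) = 0\<close> unfolding J_def d(1) by simp
        then have "(of_nat ((2 * n + 2) ^ 2) :: complex) = of_nat ((c - i) ^ 2)"
          by (simp only: u_def of_nat_power of_nat_add of_nat_mult of_nat_numeral)
        then have "(2 * n + 2) ^ 2 = (c - i) ^ 2"
          by (simp only: of_nat_eq_iff)
        then have "2 * n + 2 = c - i"
          by (simp only: power2_eq_iff_nonneg[OF zero_le zero_le])
        then show False
          using assms(1) by simp
      qed
      then show ?thesis
        using S by simp
    qed
    then show ?thesis
      by (simp add: prod_dividef)
  qed
  finally show ?thesis
    by (simp only: H_def J_def)
qed

lemma odd_vandermonde_swap_pos: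
  assumes "S \<subseteq> {..<n}"
  shows "odd_vandermonde n (swap_pos n S) = odd_vandermonde n (swap_pos n {}) * hookprod (Suc ` S) (2 * of_nat n + 2)"
proof -
  have "finite S"
    using assms by (rule finite_subset) simp
  then show ?thesis
    using assms
  proof (induction S rule: finite_linorder_max_induct)
    case (insert c S)
    then have *: "c < n" "\<And>i. i \<in> S \<Longrightarrow> i < c"
      by auto
    have "hookprod (insert (Suc c) (Suc ` S)) (2 * of_nat n + 2) = hookprod (Suc ` S) (2 * of_nat n + 2) *
      ((1 - (2 * of_nat n + 2) / (2 * of_nat (Suc c))) * (1 - (2 * of_nat n + 2) / of_nat (Suc c)) *
     ((\<Prod>b\<in>Suc ` S. 1 - (2 * of_nat n + 2) ^ 2 / (of_nat (Suc c) + of_nat b) ^ 2) *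
      (\<Prod>b\<in>{1..<Suc c} - Suc ` S. 1 - (2 * of_nat n + 2) ^ 2 / (of_nat (Suc c) - of_nat b) ^ 2)))"
      by (rule hookprod_insert_max) (use insert *(2) in auto)
    then show ?case
      using insert odd_vandermonde_swap_pos_insert[OF *] by (simp only: image_insert insert_subset mult.assoc)
  qed (simp add: hookprod_def)
qed

subsection \<open>The Euler product\<close>

lemma fps_nth_inverse_one_minus_X_power:
  assumes "d \<ge> 1"
  shows "fps_nth (inverse (1 - fps_X ^ d) :: complex fps) m = (if d dvd m then 1 else 0)"
proof -
  define Q :: "complex fps" where "Q = Abs_fps (\<lambda>m. if d dvd m then 1 else 0)"
  have "(1 - fps_X ^ d) * Q = 1"
  proof (rule fps_ext)
    fix m
    have "d dvd m \<longleftrightarrow> d dvd (m - d)" if "d \<le> m"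
      using that by (metis dvd_minus_self le_antisym nat_le_linear not_less)
    moreover have "d dvd m \<longleftrightarrow> m = 0" if "m < d"
      using that by (auto dest: dvd_imp_le)
    ultimately show "fps_nth ((1 - fps_X ^ d) * Q) m = fps_nth 1 m"
      using assms by (auto simp: left_diff_distrib fps_X_power_mult_nth Q_def)
  qed
  then have "inverse (1 - fps_X ^ d) = Q"
    by (rule fps_inverse_unique)
  then show ?thesis
    by (simp add: Q_def)
qed

lemma fps_nth_log_term:
  assumes "k \<ge> 1" "m \<ge> 1"
  shows "fps_nth (log_term k) m = (if k dvd m then 1 / of_nat k else 0)"
proof -
  have "fps_nth (of_nat k * (1 - fps_X ^ k) :: complex fps) 0 \<noteq> 0"
    using assms by (simp add: fps_mult_nth_0)
  then have "log_term k = fps_X ^ k * inverse (of_nat k * (1 - fps_X ^ k))"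
    by (simp add: log_term_def fps_divide_unit)
  also have "inverse (of_nat k * (1 - fps_X ^ k) :: complex fps) = fps_const (1 / of_nat k) * inverse (1 - fps_X ^ k)"
    by (simp add: fps_inverse_mult fps_const_inverse inverse_eq_divide flip: fps_of_nat)
  finally have "fps_nth (log_term k) m = (if m < k then 0 else if k dvd (m - k) then 1 / of_nat k else 0)"
    using assms by (simp add: fps_X_power_mult_nth fps_nth_inverse_one_minus_X_power)
  moreover have "k dvd (m - k) \<longleftrightarrow> k dvd m" if "k \<le> m"
    using that by (metis dvd_minus_self le_antisym nat_le_linear not_less)
  ultimately show ?thesis
    using assms(2) by (auto dest: dvd_imp_le)
qed

definition log_series :: "complex fps" where
  "log_series = (\<Sum>k. log_term (Suc k))"

lemma log_series_nth_0: "fps_nth log_series 0 = 0"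
  unfolding log_series_def by (rule suminf_log_term_nth_0)

lemma log_series_nth:
  assumes "m \<ge> 1"
  shows "fps_nth log_series m = (\<Sum>d | d dvd m. 1 / of_nat d)"
proof -
  have eq: "log_series = Abs_fps (\<lambda>n. \<Sum>k<n. fps_nth (log_term (Suc k)) n)"
    unfolding log_series_def using sums_unique[OF sums_log_term] by simp
  have "fps_nth log_series m = (\<Sum>k<m. if Suc k dvd m then 1 / of_nat (Suc k) else 0)"
    unfolding eq using assms by (simp add: fps_nth_log_term del: of_nat_Suc)
  also have "\<dots> = (\<Sum>d\<in>{1..m}. if d dvd m then 1 / of_nat d else 0)"
    by (rule sum.reindex_bij_witness[of _ "\<lambda>d. d - 1" Suc]) auto
  also have "\<dots> = (\<Sum>d | d dvd m. 1 / of_nat d)"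
    using assms by (intro sum.mono_neutral_cong_right) (auto dest: dvd_imp_le intro: Suc_leI dvd_pos_nat)
  finally show ?thesis .
qed

lemma sum_divisors_reflect:
  assumes "m \<ge> (1::nat)"
  shows "(\<Sum>d | d dvd m. of_nat d) = of_nat m * (\<Sum>d | d dvd m. 1 / of_nat d :: complex)"
  unfolding sum_distrib_left
  by (rule sum.reindex_bij_witness[of _ "\<lambda>d. m div d" "\<lambda>d. m div d"])
     (use assms in \<open>auto elim!: dvdE\<close>)

lemma euler_product_power_altdef: "euler_product_power c = fps_exp (- c) oo log_series"
proof -
  have "fps_const (- c) * log_series = (fps_const (- c) * fps_X) oo log_series"
    by (simp add: fps_compose_mult_distrib[OF log_series_nth_0] log_series_nth_0 del: fps_const_neg)
  then have "euler_product_power c = fps_exp 1 oo ((fps_const (- c) * fps_X) oo log_series)"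
    by (simp only: euler_product_power_def log_series_def)
  also have "\<dots> = (fps_exp 1 oo (fps_const (- c) * fps_X)) oo log_series"
    by (rule fps_compose_assoc) (auto simp: log_series_nth_0)
  also have "fps_exp 1 oo (fps_const (- c) * fps_X) = fps_exp (- c)"
    by (simp only: fps_exp_compose_linear mult_1_right)
  finally show ?thesis .
qed

lemma euler_product_power_of_nat: "euler_product_power (of_nat c) = euler_product_power 1 ^ c"
proof -
  have "fps_exp (- of_nat c) = (fps_exp (- 1) :: complex fps) ^ c"
    by (simp add: fps_exp_power_mult)
  then show ?thesis
    by (simp add: euler_product_power_altdef fps_compose_power[OF log_series_nth_0])
qed

text \<open>Logarithmic differentiation of exp(-L): the coefficient of x^m in L is the sum of 1 / d
  over the divisors d of m, so m times it is the divisor sum of m.\<close>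

lemma euler_product_power_1_recurrence:
  "of_nat (Suc m) * fps_nth (euler_product_power 1) (Suc m) =
   - (\<Sum>i\<le>m. fps_nth (euler_product_power 1) i * (\<Sum>d | d dvd (Suc m - i). of_nat d))"
proof -
  have "fps_deriv (euler_product_power 1) = - (euler_product_power 1 * fps_deriv log_series)"
    unfolding euler_product_power_altdef
    by (simp add: fps_compose_deriv log_series_nth_0 fps_compose_uminus fps_const_neg[symmetric] fps_compose_mult_distrib del: fps_const_neg)
  then have "fps_nth (fps_deriv (euler_product_power 1)) m = fps_nth (- (euler_product_power 1 * fps_deriv log_series)) m"
    by (simp only:)
  then show ?thesis
    unfolding fps_deriv_nth fps_neg_nth fps_mult_nth
    by (simp add: sum_divisors_reflect log_series_nth Suc_diff_le atLeast0AtMost mult.commute)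
qed

lemma fps_deriv_prod:
  fixes f :: "'b \<Rightarrow> 'a::comm_ring_1 fps"
  assumes "finite I"
  shows "fps_deriv (\<Prod>i\<in>I. f i) = (\<Sum>i\<in>I. fps_deriv (f i) * (\<Prod>j\<in>I - {i}. f j))"
  using assms
proof (induction I rule: finite_induct)
  case (insert a I)
  have "(\<Sum>i\<in>I. fps_deriv (f i) * (\<Prod>j\<in>insert a I - {i}. f j)) =
      (\<Sum>i\<in>I. f a * (fps_deriv (f i) * (\<Prod>j\<in>I - {i}. f j)))"
  proof (rule sum.cong)
    fix i assume "i \<in> I"
    then have "insert a I - {i} = insert a (I - {i})"
      using insert.hyps by auto
    then show "fps_deriv (f i) * (\<Prod>j\<in>insert a I - {i}. f j) = f a * (fps_deriv (f i) * (\<Prod>j\<in>I - {i}. f j))"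
      using insert.hyps by (simp add: mult_ac)
  qed simp
  moreover have "insert a I - {a} = I"
    using insert.hyps by auto
  ultimately show ?case
    using insert.hyps by (simp add: insert.IH sum_distrib_left add.commute)
qed simp

text \<open>The logarithmic derivative of the finite product yields the same divisor sums as long as
  m < n, since every divisor involved is then at most n. With the initial value 1 the recurrence
  determines all coefficients up to order n.\<close>

lemma finite_product_recurrence:
  assumes "m < n"
  defines "P \<equiv> \<Prod>i<n. 1 - fps_X ^ Suc i :: complex fps"
  shows "of_nat (Suc m) * fps_nth P (Suc m) = - (\<Sum>i\<le>m. fps_nth P i * (\<Sum>d | d dvd (Suc m - i). of_nat d))"
proof -
  define D where "D = (\<Sum>i<n. of_nat (Suc i) * fps_X ^ i * inverse (1 - fps_X ^ Suc i) :: complex fps)"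
  have unit: "(1 - fps_X ^ Suc i) * inverse (1 - fps_X ^ Suc i) = (1 :: complex fps)" for i
    by (rule inverse_mult_eq_1') simp
  have "fps_deriv P = - (P * D)"
  proof -
    have "fps_deriv P = (\<Sum>i<n. fps_deriv (1 - fps_X ^ Suc i) * prod (\<lambda>i. 1 - fps_X ^ Suc i) ({..<n} - {i}))"
      unfolding P_def by (rule fps_deriv_prod) simp
    also have "\<dots> = (\<Sum>i<n. - (P * (of_nat (Suc i) * fps_X ^ i * inverse (1 - fps_X ^ Suc i))))"
    proof (rule sum.cong)
      fix i assume "i \<in> {..<n}"
      then have "P = (1 - fps_X ^ Suc i) * prod (\<lambda>i. 1 - fps_X ^ Suc i) ({..<n} - {i})"
        unfolding P_def by (intro prod.remove) auto
      moreover have "fps_deriv (1 - fps_X ^ Suc i) = (- (of_nat (Suc i) * fps_X ^ i) :: complex fps)"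
        by (rule fps_ext) (auto simp: fps_X_power_nth fps_of_nat[symmetric] simp del: power_Suc of_nat_Suc)
      ultimately show "fps_deriv (1 - fps_X ^ Suc i) * prod (\<lambda>i. 1 - fps_X ^ Suc i) ({..<n} - {i}) =
          - (P * (of_nat (Suc i) * fps_X ^ i * inverse (1 - fps_X ^ Suc i)))"
        using unit[of i] by (simp add: mult_ac del: power_Suc)
    qed simp
    also have "\<dots> = - (P * D)"
      by (simp only: D_def sum_negf sum_distrib_left)
    finally show ?thesis .
  qed
  moreover have "fps_nth D k = (\<Sum>d | d dvd Suc k. of_nat d)" if "k < n" for k
  proof -
    have "fps_nth D k = (\<Sum>i<n. if Suc i dvd Suc k then of_nat (Suc i) else 0)"
      unfolding D_def fps_sum_nth
    proof (rule sum.cong)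
      fix i
      have dvd: "Suc i dvd (k - i) \<longleftrightarrow> Suc i dvd Suc k" if "i \<le> k"
        using that by (metis Suc_diff_Suc diff_Suc_Suc dvd_minus_self le_imp_less_Suc not_less_eq)
      have not_dvd: "\<not> Suc i dvd Suc k" if "k < i"
        using that by (auto dest: dvd_imp_le)
      have eq: "fps_nth (of_nat (Suc i) * fps_X ^ i * inverse (1 - fps_X ^ Suc i)) k =
          of_nat (Suc i) * fps_nth (fps_X ^ i * inverse (1 - fps_X ^ Suc i)) k"
        by (simp add: mult.assoc del: of_nat_Suc power_Suc flip: fps_of_nat)
      show "fps_nth (of_nat (Suc i) * fps_X ^ i * inverse (1 - fps_X ^ Suc i)) k =
          (if Suc i dvd Suc k then of_nat (Suc i) else (0 :: complex))"
        unfolding eq using dvd not_dvd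
        by (cases "i \<le> k") (simp_all add: fps_X_power_mult_nth fps_nth_inverse_one_minus_X_power del: power_Suc of_nat_Suc)
    qed simp
    also have "\<dots> = (\<Sum>d\<in>{1..n}. if d dvd Suc k then of_nat d else 0)"
      by (rule sum.reindex_bij_witness[of _ "\<lambda>d. d - 1" Suc]) auto
    also have "\<dots> = (\<Sum>d | d dvd Suc k. of_nat d)"
    proof (rule sum.mono_neutral_cong_right)
      have "1 \<le> d \<and> d \<le> n" if "d dvd Suc k" for d
        using dvd_imp_le[OF that] dvd_pos_nat[OF _ that] \<open>k < n\<close> by (simp add: Suc_le_eq)
      then show "{d. d dvd Suc k} \<subseteq> {1..n}"
        by auto
    qed auto
    finally show ?thesis .
  qed
  ultimately have "fps_nth (fps_deriv P) m = - (\<Sum>i\<le>m. fps_nth P i * (\<Sum>d | d dvd (Suc m - i). of_nat d))"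
    using assms(1) by (simp add: fps_mult_nth atLeast0AtMost Suc_diff_le)
  then show ?thesis
    by (simp only: fps_deriv_nth Suc_eq_plus1)
qed

lemma euler_product_power_1: "euler_product_power 1 = euler_prod"
proof (rule fps_eqI_cong)
  fix n
  define P where "P = (\<Prod>i<n. 1 - fps_X ^ Suc i :: complex fps)"
  have "fps_nth (euler_product_power 1) m = fps_nth P m" if "m \<le> n" for m
    using that
  proof (induction m rule: less_induct)
    case (less m)
    show ?case
    proof (cases m)
      case 0
      have "fps_nth P 0 = 1"
        unfolding P_def by (induction n) (auto simp: fps_mult_nth_0)
      then show ?thesis
        using 0 by (simp add: euler_product_power_altdef fps_compose_nth)
    next
      case (Suc k)
      have "of_nat (Suc k) * fps_nth (euler_product_power 1) (Suc k) = of_nat (Suc k) * fps_nth P (Suc k)"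
        unfolding euler_product_power_1_recurrence P_def
        using less Suc by (subst finite_product_recurrence) (auto simp: P_def)
      then show ?thesis
        using Suc by (simp del: of_nat_Suc)
    qed
  qed
  then have "fps_cong n (euler_product_power 1) P"
    by (simp add: fps_cong_def)
  then show "fps_cong n (euler_product_power 1) euler_prod"
    using euler_prod_cong[of n n] fps_cong_trans fps_cong_sym unfolding P_def by blast
qed

subsection \<open>Comparison of coefficients\<close>

lemma fdet_hook_expansion:
  assumes "n \<ge> 1"
  shows "fps_cong n (euler_prod ^ (2 * n ^ 2 + n))
    (\<Sum>S\<in>Pow {..<n}. (- 1) ^ card S * fps_X ^ (\<Sum>i\<in>S. Suc i) * fps_const (hookprod (Suc ` S) (2 * of_nat n + 2)))"
proof -
  have "Suc (2 * n) choose 2 = 2 * n ^ 2 + n"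
    by (simp add: choose_two power2_eq_square algebra_simps)
  then have "fdet (geo ^ (2 * n)) = euler_prod ^ (2 * n ^ 2 + n)"
    by (simp add: fdet_geo_power)
  moreover have "odd_vandermonde n (swap_pos n S) / odd_vandermonde n (swap_pos n {}) = hookprod (Suc ` S) (2 * of_nat n + 2)"
    if "S \<in> Pow {..<n}" for S
    using that trunc_det_fold_mat_geo_power(2)[OF assms] odd_vandermonde_swap_pos[of S n] by simp
  then have "trunc_det n (ent (fold_mat (fps_const (geo ^ (2 * n))))) =
      (\<Sum>S\<in>Pow {..<n}. (- 1) ^ card S * fps_X ^ (\<Sum>i\<in>S. Suc i) * fps_const (hookprod (Suc ` S) (2 * of_nat n + 2)))"
    unfolding trunc_det_fold_mat_geo_power(1)[OF assms] by (intro sum.cong) auto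
  ultimately show ?thesis
    using fdet_cong[of "geo ^ (2 * n)" n n] by (simp add: fps_nth_power_0)
qed

definition strict_partitions :: "nat \<Rightarrow> nat set set" where
  "strict_partitions N = {S. finite S \<and> 0 \<notin> S \<and> \<Sum>S = N}"

lemma strict_partitions_subset:
  assumes "S \<in> strict_partitions N"
  shows "S \<subseteq> {1..N}"
proof
  fix a assume "a \<in> S"
  then have "a \<le> \<Sum>S"
    using assms by (intro member_le_sum) (auto simp: strict_partitions_def)
  then show "a \<in> {1..N}"
    using assms \<open>a \<in> S\<close> by (cases a) (auto simp: strict_partitions_def)
qed

lemma finite_strict_partitions: "finite (strict_partitions N)"
  by (rule finite_subset[of _ "Pow {1..N}"]) (use strict_partitions_subset in auto)

definition hook_coeff :: "nat \<Rightarrow> complex \<Rightarrow> complex" where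
  "hook_coeff N t = (\<Sum>S\<in>strict_partitions N. (- 1) ^ card S * hookprod S (2 * t + 2))"

text \<open>A strict partition of \<open>N \<le> n\<close> has all its parts in 1, ..., n, so the
  subsets of the n rows account for every one of them.\<close>

lemma euler_product_power_nth_of_nat:
  assumes "n \<ge> 1" "N \<le> n"
  shows "fps_nth (euler_product_power (2 * of_nat n ^ 2 + of_nat n)) N = hook_coeff N (of_nat n)"
proof -
  have "2 * of_nat n ^ 2 + of_nat n = (of_nat (2 * n ^ 2 + n) :: complex)"
    by simp
  then have "fps_nth (euler_product_power (2 * of_nat n ^ 2 + of_nat n)) N = fps_nth (euler_prod ^ (2 * n ^ 2 + n)) N"
    by (simp only: euler_product_power_of_nat euler_product_power_1)
  also have "\<dots> = fps_nth (\<Sum>S\<in>Pow {..<n}. (- 1) ^ card S * fps_X ^ (\<Sum>i\<in>S. Suc i) *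
      fps_const (hookprod (Suc ` S) (2 * of_nat n + 2))) N"
    using fdet_hook_expansion[OF assms(1)] assms(2) by (simp add: fps_cong_def)
  also have "\<dots> = (\<Sum>S\<in>Pow {..<n}. if (\<Sum>i\<in>S. Suc i) = N then (- 1) ^ card S * hookprod (Suc ` S) (2 * of_nat n + 2) else 0)"
    unfolding fps_sum_nth
  proof (rule sum.cong)
    fix S :: "nat set"
    have "(- 1) ^ card S * fps_X ^ (\<Sum>i\<in>S. Suc i) * fps_const (hookprod (Suc ` S) (2 * of_nat n + 2)) =
        fps_const ((- 1) ^ card S * hookprod (Suc ` S) (2 * of_nat n + 2)) * fps_X ^ (\<Sum>i\<in>S. Suc i)"
      by (cases "even (card S)") (simp_all add: mult.commute)
    then show "fps_nth ((- 1) ^ card S * fps_X ^ (\<Sum>i\<in>S. Suc i) * fps_const (hookprod (Suc ` S) (2 * of_nat n + 2))) N =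
        (if (\<Sum>i\<in>S. Suc i) = N then (- 1) ^ card S * hookprod (Suc ` S) (2 * of_nat n + 2) else 0)"
      by (simp only: fps_mult_left_const_nth fps_X_power_nth) simp
  qed simp
  also have "\<dots> = (\<Sum>S | S \<in> Pow {..<n} \<and> (\<Sum>i\<in>S. Suc i) = N. (- 1) ^ card S * hookprod (Suc ` S) (2 * of_nat n + 2))"
    by (rule sum.inter_filter[symmetric]) simp
  also have "\<dots> = hook_coeff N (of_nat n)"
    unfolding hook_coeff_def
  proof (rule sum.reindex_bij_witness[of _ "\<lambda>S. (\<lambda>a. a - 1) ` S" "image Suc"])
    fix S assume H: "S \<in> strict_partitions N"
    have S: "S \<subseteq> {1..n}" "\<Sum>S = N"
      using strict_partitions_subset[OF H] H assms(2) by (auto simp: strict_partitions_def)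
    have Suc_pred: "Suc (a - 1) = a" if "a \<in> S" for a
      using S(1) that by auto
    show "Suc ` (\<lambda>a. a - 1) ` S = S"
      using Suc_pred by (simp add: image_image)
    have inj: "inj_on (\<lambda>a. a - 1) S"
      by (rule inj_onI) (metis Suc_pred)
    have "(\<Sum>i\<in>(\<lambda>a. a - 1) ` S. Suc i) = N"
    proof -
      have "(\<Sum>i\<in>(\<lambda>a. a - 1) ` S. Suc i) = (\<Sum>a\<in>S. Suc (a - 1))"
        by (simp only: sum.reindex[OF inj] o_def)
      also have "\<dots> = \<Sum>S"
        by (rule sum.cong) (use Suc_pred in auto)
      finally show ?thesis
        using S(2) by simp
    qed
    then show "(\<lambda>a. a - 1) ` S \<in> {S \<in> Pow {..<n}. (\<Sum>i\<in>S. Suc i) = N}"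
      using S(1) by (auto simp: Suc_le_eq dest!: subsetD)
  next
    fix S assume S: "S \<in> {S \<in> Pow {..<n}. (\<Sum>i\<in>S. Suc i) = N}"
    then have "finite S"
      by (auto intro: finite_subset)
    with S show "Suc ` S \<in> strict_partitions N"
      by (auto simp: strict_partitions_def sum.reindex)
    show "(\<lambda>a. a - 1) ` Suc ` S = S"
      by (simp add: image_image)
    show "(- 1) ^ card (Suc ` S) * hookprod (Suc ` S) (2 * of_nat n + 2) =
        (- 1) ^ card S * hookprod (Suc ` S) (2 * of_nat n + 2)"
      by (simp add: card_image)
  qed
  finally show ?thesis .
qed

section \<open>Polynomial dependence on t\<close>

definition is_poly :: "(complex \<Rightarrow> complex) \<Rightarrow> bool" where
  "is_poly f \<longleftrightarrow> (\<exists>p. \<forall>t. f t = poly p t)"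

lemma is_poly_const: "is_poly (\<lambda>t. c)"
  unfolding is_poly_def by (rule exI[of _ "[:c:]"]) simp

lemma is_poly_id: "is_poly (\<lambda>t. t)"
  unfolding is_poly_def by (rule exI[of _ "[:0, 1:]"]) simp

lemma is_poly_add: "is_poly f \<Longrightarrow> is_poly g \<Longrightarrow> is_poly (\<lambda>t. f t + g t)"
  unfolding is_poly_def by (metis poly_add)

lemma is_poly_mult: "is_poly f \<Longrightarrow> is_poly g \<Longrightarrow> is_poly (\<lambda>t. f t * g t)"
  unfolding is_poly_def by (metis poly_mult)

lemma is_poly_diff: "is_poly f \<Longrightarrow> is_poly g \<Longrightarrow> is_poly (\<lambda>t. f t - g t)"
  unfolding is_poly_def by (metis poly_diff)

lemma is_poly_divide_const: "is_poly f \<Longrightarrow> is_poly (\<lambda>t. f t / c)"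
  using is_poly_mult[OF is_poly_const[of "1 / c"]] by simp

lemma is_poly_sum: "(\<And>x. x \<in> A \<Longrightarrow> is_poly (f x)) \<Longrightarrow> is_poly (\<lambda>t. \<Sum>x\<in>A. f x t)"
  by (induction A rule: infinite_finite_induct) (auto intro: is_poly_const is_poly_add)

lemma is_poly_prod: "(\<And>x. x \<in> A \<Longrightarrow> is_poly (f x)) \<Longrightarrow> is_poly (\<lambda>t. \<Prod>x\<in>A. f x t)"
  by (induction A rule: infinite_finite_induct) (auto intro: is_poly_const is_poly_mult)

lemma is_poly_power: "is_poly f \<Longrightarrow> is_poly (\<lambda>t. f t ^ n)"
  by (induction n) (auto intro: is_poly_const is_poly_mult)

lemmas is_poly_intros = is_poly_const is_poly_id is_poly_add is_poly_mult is_poly_diff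
  is_poly_divide_const is_poly_sum is_poly_prod is_poly_power

lemma is_poly_eqI:
  assumes "is_poly f" "is_poly g" "\<And>n. n \<ge> m \<Longrightarrow> f (of_nat n) = g (of_nat n)"
  shows "f t = g t"
proof -
  obtain p q where pq: "f t = poly p t" "g t = poly q t" for t
    using assms(1,2) unfolding is_poly_def by blast
  have "infinite (of_nat ` {m..} :: complex set)"
    by (simp add: finite_image_iff inj_on_def infinite_Ici)
  moreover have "of_nat ` {m..} \<subseteq> {x. poly (p - q) x = 0}"
    using assms(3) pq by auto
  ultimately have "p - q = 0"
    using poly_roots_finite[of "p - q"] finite_subset by blast
  then show ?thesis
    using pq by simp
qed

lemma is_poly_hook_coeff: "is_poly (hook_coeff N)"
  unfolding hook_coeff_def[abs_def] hookprod_def by (intro is_poly_intros)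

text \<open>The logarithm has no constant term, so the coefficient of x^N in its exponential
  involves only the powers of the exponent up to N.\<close>

lemma is_poly_euler_product_power: "is_poly (\<lambda>t. fps_nth (euler_product_power (2 * t ^ 2 + t)) N)"
proof -
  have "fps_nth (euler_product_power c) N = (\<Sum>i=0..N. (0 - c) ^ i / fact i * fps_nth (log_series ^ i) N)" for c
    by (simp add: euler_product_power_altdef fps_compose_nth)
  then show ?thesis
    by (simp only:) (intro is_poly_intros)
qed

lemma euler_product_power_nth:
  "fps_nth (euler_product_power (2 * t ^ 2 + t)) N = hook_coeff N t"
  by (rule is_poly_eqI[OF is_poly_euler_product_power is_poly_hook_coeff, of "max 1 N"])
     (simp add: euler_product_power_nth_of_nat)

text \<open>Convergence is coefficientwise: the coefficient of x^N of a finite partial sum is final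
  as soon as the index set contains the finitely many doubled distinct partitions of weight 2
  N.\<close>

theorem theorem1p1:
  fixes t :: complex
  shows "((\<lambda>l. fps_const (of_int (durfee_sign l)) * fps_X ^ (weight l div 2) *
            fps_const (\<Prod>(i, j)\<in>diagram l.
              1 - (2 * t + 2) / (of_nat (hook l i j) * of_int (hook_sign i j))))
          has_sum euler_product_power (2 * t ^ 2 + t)) DD"
proof -
  define f where "f l = fps_const (of_int (durfee_sign l)) * fps_X ^ (weight l div 2) *
            fps_const (\<Prod>(i, j)\<in>diagram l.
              1 - (2 * t + 2) / (of_nat (hook l i j) * of_int (hook_sign i j)))" for l
  have f_nth: "fps_nth (f l) N = (if \<Sum>(frob l) = N then (- 1) ^ card (frob l) * hookprod (frob l) (2 * t + 2) else 0)"
    if "l \<in> DD" for l N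
    unfolding f_def DD_hook_prod[OF that]
    using that by (simp add: weight_DD durfee_sign_def card_frob mult.assoc fps_X_power_mult_nth mult.commute[of "fps_X ^ _"])
  have "(sum f \<longlongrightarrow> euler_product_power (2 * t ^ 2 + t)) (finite_subsets_at_top DD)"
  proof (rule tendsto_fpsI)
    fix N
    define X where "X = {l \<in> DD. \<Sum>(frob l) = N}"
    have bij: "bij_betw frob X (strict_partitions N)"
    proof (rule bij_betw_imageI)
      show "inj_on frob X"
        by (rule inj_on_subset[OF inj_frob]) (auto simp: X_def)
      have "frob ` X = {S \<in> frob ` DD. \<Sum>S = N}"
        by (auto simp: X_def)
      then show "frob ` X = strict_partitions N"
        using bij_betw_imp_surj_on[OF bij_betw_frob] by (auto simp: strict_partitions_def)
    qed
    have fin: "finite X"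
      using bij finite_strict_partitions bij_betw_finite by blast
    have "fps_nth (sum f Y) N = fps_nth (euler_product_power (2 * t ^ 2 + t)) N"
      if Y: "finite Y" "X \<subseteq> Y" "Y \<subseteq> DD" for Y
    proof -
      have "fps_nth (sum f Y) N = (\<Sum>l\<in>X. (- 1) ^ card (frob l) * hookprod (frob l) (2 * t + 2))"
        unfolding fps_sum_nth using Y
        by (intro sum.mono_neutral_cong_right) (auto simp: X_def f_nth subset_iff)
      also have "\<dots> = hook_coeff N t"
        unfolding hook_coeff_def by (rule sum.reindex_bij_betw[OF bij])
      finally show ?thesis
        by (simp only: euler_product_power_nth)
    qed
    then show "\<forall>\<^sub>F Y in finite_subsets_at_top DD. fps_nth (sum f Y) N = fps_nth (euler_product_power (2 * t ^ 2 + t)) N"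
      unfolding eventually_finite_subsets_at_top using fin by (intro exI[of _ X]) (auto simp: X_def)
  qed
  then show ?thesis
    unfolding has_sum_def f_def by simp
qed

end
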